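(* Let $\rho>1$ and let $F$ be a $\mathbb{C}^N$-valued function that is analytic in $E$ and meromorphic in $E_\rho=\mathrm{int}\,\Gamma_\rho$, with exactly $\mu$ poles $z_1,\dots,z_\mu$ in $E_\rho$, all simple, so that $F(z)=\sum_{s=1}^\mu\frac{v_s}{z-z_s}+\Theta(z)$ with $v_s\in\mathbb{C}^N$ nonzero and $\Theta$ analytic in $E_\rho$. Order the poles so that $\Phi(z_1)\le\Phi(z_2)\le\cdots\le\Phi(z_\mu)\le\rho$. Let $k\ge1$ be fixed and assume $\prod_{i=1}^k(q,v_i)\ne0$. When $k<\mu$, assume in addition that $$\Phi(z_k)<\Phi(z_{k+1})=\cdots=\Phi(z_{k+r})<\begin{cases}\Phi(z_{k+r+1})&\text{if }k+r<\mu,\\ \rho&\text{if }k+r=\mu.\end{cases}$$ Put $\widetilde K=E_\rho\setminus\{z_1,\dots,z_\mu\}$. Then, for all sufficiently large $p$, $R_{p,k}(z)$ exists and is unique, and the following hold. (i) When $k<\mu$, $$F(z)-R_{p,k}(z)=O\Big(\frac{\Psi_p(z)}{\widetilde\Psi_{p,k}}\Big)\quad\text{as }p\to\infty,\qquad|\widetilde\Psi_{p,k}|=\min_{1\le j\le r}|\Psi_p(z_{k+j})|,$$ uniformly on every compact subset of $\widetilde K$. Consequently, $$\limsup_{p\to\infty}\|F(z)-R_{p,k}(z)\|^{1/p}\le\frac{\Phi(z)}{\Phi(z_{k+1})},\quad z\in\widetilde K,$$ uniformly on each compact subset of $\widetilde K$, and $$\limsup_{p\to\infty}\|F(z)-R_{p,k}(z)\|^{1/p}\le\frac{1}{\Phi(z_{k+1})},\quad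 z\in E,$$ uniformly on $E$. Thus, uniform convergence takes place for $z$ in any compact subset of $\widetilde K_k=\mathrm{int}\,\Gamma_{\sigma_k}\setminus\{z_1,\dots,z_k\}$, $\sigma_k=\Phi(z_{k+1})$. When $r=1$ and $\widehat T^{(p)}_{1,\dots,k+1}(z)\ne0$ (in addition to $T_{1,\dots,k}\ne0$, which follows from the hypotheses), one has the more refined result $$F(z)-R_{p,k}(z)\sim B_p(z)\frac{\psi_{1,p}(z)}{\Psi_p(z_{k+1})}\quad\text{as }p\to\infty,$$ $$B_p(z)=(-1)^k\,\frac{\widehat T^{(p)}_{1,\dots,k+1}(z)}{T_{1,\dots,k}}\prod_{i=1}^k\frac{z_{k+1}-z_i}{z-z_i},$$ and $B_p(z)$ is bounded for all large $p$. (ii) When $k=\mu$, $$\limsup_{p\to\infty}\|F(z)-R_{p,k}(z)\|^{1/p}\le\frac{\Phi(z)}{\rho},\quad z\in\widetilde K,$$ uniformly on each compact subset of $\widetilde K$, and $$\limsup_{p\to\infty}\|F(z)-R_{p,k}(z)\|^{1/p}\le\frac1\rho,\quad z\in E,$$ uniformly on $E$.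
   Context: Sets and interpolation points. $E$ is a closed and bounded set in the complex plane whose complement $K$ (which includes the point at infinity) has a classical Green's function $g(z)$ with pole at infinity, continuous on $\partial E$ and zero on $\partial E$. Put $\Phi(z)=\exp[g(z)]$ on $K$, with the convention $\Phi(z)=1$ for $z\in E$, and $\kappa=\mathrm{cap}(E)$, the logarithmic capacity of $E$. For $\sigma>1$, $\Gamma_\sigma$ is the locus $\Phi(z)=\sigma$ and $E_\sigma=\mathrm{int}\,\Gamma_\sigma$ is its interior (so $E\subset E_\sigma$). For each $p\in\{1,2,\dots\}$ there is given a set of interpolation points $\xi^{(p)}_1,\dots,\xi^{(p)}_{p+k}$, not necessarily distinct (equal points being listed consecutively), such that the $\xi_i^{(p)}$ have no limit points in $K$ and $$\lim_{p\to\infty}\Big|\prod_{i=1}^{p+k}(z-\xi_i^{(p)})\Big|^{1/p}=\kappa\,\Phi(z)$$ uniformly in $z$ on every compact subset of $K$. For fixed $p$ write $\xi_i=\xi_i^{(p)}$. The ITEA construction. $(\cdot,\cdot)$ is an inner product on $\mathbb{C}^N$ (linear in its second argument), $q\in\mathbb{C}^N$ is a fixed nonzero vector, and $\|\cdot\|$ is a vector norm on $\mathbb{C}^N$. Put $\psi_{m,n}(z)=\prod_{r=m}^n(z-\xi_r)$ for $n\ge m\ge1$, $\psi_{m,m-1}(z)=1$, and $\Psi_p(z)=\psi_{1,p+k}(z)$. Let $D_{m,n}=F[\xi_m,\dots,\xi_n]$ be the divided difference of $F$ over $\{\xi_m,\dots,\xi_n\}$ (in the generalized Hermite sense if points coincide),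 let $G_{m,n}(z)=\sum_{i=m}^nD_{m,i}\psi_{m,i-1}(z)$ be the (Hermite) interpolating polynomial of $F$ at $\xi_m,\dots,\xi_n$, and put $u_{i,j}=(q,D_{j+1,p+i})$. The ITEA interpolant is $$R_{p,k}(z)=\frac{\sum_{j=0}^kc_j\psi_{1,j}(z)G_{j+1,p}(z)}{\sum_{j=0}^kc_j\psi_{1,j}(z)},$$ where $c_k=1$ and $c_0,\dots,c_{k-1}$ solve $\sum_{j=0}^{k-1}u_{i,j}c_j=-u_{i,k}$, $i=1,\dots,k$ (uniquely solvable when $\det(u_{i,j})_{1\le i\le k,\,0\le j\le k-1}\ne0$). Determinants. $T_{s_1,\dots,s_k}=\det(\alpha_{i,s_j})_{1\le i,j\le k}$, where $\alpha_{i,s}=(q,v_s)\,\psi_{p+i+1,p+k}(z_s)$; this determinant does not depend on $p$. $\widehat T^{(p)}_{s_0,s_1,\dots,s_k}(z)$ is the $\mathbb{C}^N$-valued $(k+1)\times(k+1)$ determinant, defined by expansion along its first row, with first row $\widehat e^{(p)}_{s_0}(z),\widehat e^{(p)}_{s_1}(z),\dots,\widehat e^{(p)}_{s_k}(z)$ and with $(i+1)$-st row $\alpha_{i,s_0},\alpha_{i,s_1},\dots,\alpha_{i,s_k}$ for $i=1,\dots,k$, where $\widehat e^{(p)}_s(z)=\frac{v_s}{z-z_s}\psi_{p+1,p+k}(z_s)$. In particular $\widehat T^{(p)}_{1,\dots,k+1}(z)$ is the case $s_j=j+1$, $j=0,\dots,k$.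
   Formalization: The O-bound with Ψ_p(z) is proved on compact subsets of K̃∖E, and with ψ_{1,p}(z) in the numerator on all of K̃ (as printed it fails on E); "~" is proved where T̂^{(p)}(z) stays bounded away from 0 (≠0 is not enough), plus an additive o(1) form everywhere. *)

theory Defs
  imports
    "HOL-Complex_Analysis.Complex_Analysis"
    "HOL-Library.Landau_Symbols"
    "Jordan_Normal_Form.Determinant"
begin

no_notation Matrix.vec_index (infixl "$" 100)

section \<open>Green's function and logarithmic capacity\<close>

definition partial_x :: "(complex \<Rightarrow> real) \<Rightarrow> complex \<Rightarrow> real" where
  "partial_x u z = deriv (\<lambda>t::real. u (z + of_real t)) 0"

definition partial_y :: "(complex \<Rightarrow> real) \<Rightarrow> complex \<Rightarrow> real" where
  "partial_y u z = deriv (\<lambda>t::real. u (z + \<i> * of_real t)) 0"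

definition harmonic_on :: "(complex \<Rightarrow> real) \<Rightarrow> complex set \<Rightarrow> bool" where
  "harmonic_on u S \<longleftrightarrow> open S
     \<and> (\<forall>f\<in>{u, partial_x u, partial_y u}. \<forall>z\<in>S. f differentiable (at z))
     \<and> (\<forall>f\<in>{partial_x (partial_x u), partial_x (partial_y u),
              partial_y (partial_x u), partial_y (partial_y u)}. continuous_on S f)
     \<and> (\<forall>z\<in>S. partial_x (partial_x u) z + partial_y (partial_y u) z = 0)"

text \<open>
  The classical Green's function with pole at infinity of the complement of \<open>E\<close>. The values of
  \<open>g\<close> on \<open>E\<close> are irrelevant. Positivity is part of the classical notion (by the maximum
  principle it says that the complement of \<open>E\<close> is a domain).
\<close>

definition greens_function :: "complex set \<Rightarrow> (complex \<Rightarrow> real) \<Rightarrow> bool" where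
  "greens_function E g \<longleftrightarrow>
     harmonic_on g (- E)
     \<and> (\<forall>z\<in>- E. g z > 0)
     \<and> (\<exists>\<gamma>. ((\<lambda>z. g z - ln (cmod z)) \<longlongrightarrow> \<gamma>) at_infinity)
     \<and> (\<forall>\<zeta>\<in>frontier E. (g \<longlongrightarrow> 0) (at \<zeta> within - E))"

definition green_exp :: "complex set \<Rightarrow> (complex \<Rightarrow> real) \<Rightarrow> complex \<Rightarrow> real" where
  "green_exp E g z = (if z \<in> E then 1 else exp (g z))"

text \<open>
  The logarithmic capacity of a compact set as its Chebyshev constant
  \<open>lim\<^sub>n (min\<^sub>r max\<^sub>E \<bar>r\<bar>)\<^sup>1\<^sup>/\<^sup>n\<close>, with \<open>r\<close> ranging over the monic polynomials of degree \<open>n\<close>.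
\<close>

definition log_capacity :: "complex set \<Rightarrow> real" where
  "log_capacity E =
     lim (\<lambda>n. root n (INF r\<in>{r::complex poly. degree r = n \<and> lead_coeff r = 1}.
                         SUP z\<in>E. cmod (poly r z)))"

definition level_curve :: "(complex \<Rightarrow> real) \<Rightarrow> real \<Rightarrow> complex set" where
  "level_curve \<Phi> \<sigma> = {z. \<Phi> z = \<sigma>}"

section \<open>Interpolation points\<close>

text \<open>
  Row \<open>p\<close> of the array consists of \<open>\<xi> p 1, \<dots>, \<xi> p (p + k)\<close>. Rows are finite, so infinitely many
  members of the array lie in a set iff infinitely many rows meet that set. The set \<open>K\<close> contains
  the point at infinity, which must not be a limit point either.
\<close>

definition finite_limit_point :: "nat \<Rightarrow> (nat \<Rightarrow> nat \<Rightarrow> complex) \<Rightarrow> complex \<Rightarrow> bool" where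
  "finite_limit_point k \<xi> \<zeta> \<longleftrightarrow>
     (\<forall>e>0. \<exists>\<^sub>F p in sequentially. \<exists>i\<in>{1..p + k}. dist (\<xi> p i) \<zeta> < e)"

definition infinite_limit_point :: "nat \<Rightarrow> (nat \<Rightarrow> nat \<Rightarrow> complex) \<Rightarrow> bool" where
  "infinite_limit_point k \<xi> \<longleftrightarrow>
     (\<forall>B. \<exists>\<^sub>F p in sequentially. \<exists>i\<in>{1..p + k}. cmod (\<xi> p i) > B)"

definition equal_points_consecutive :: "nat \<Rightarrow> (nat \<Rightarrow> complex) \<Rightarrow> bool" where
  "equal_points_consecutive n \<xi> \<longleftrightarrow>
     (\<forall>i j l. 1 \<le> i \<longrightarrow> i \<le> j \<longrightarrow> j \<le> l \<longrightarrow> l \<le> n \<longrightarrow> \<xi> i = \<xi> l \<longrightarrow> \<xi> j = \<xi> i)"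

section \<open>Inner products and norms on the complex coordinate space\<close>

definition is_inner_product :: "(complex ^ 'n \<Rightarrow> complex ^ 'n \<Rightarrow> complex) \<Rightarrow> bool" where
  "is_inner_product ip \<longleftrightarrow>
     (\<forall>x y w. ip x (y + w) = ip x y + ip x w)
     \<and> (\<forall>c x y. ip x (c *s y) = c * ip x y)
     \<and> (\<forall>x y. ip y x = cnj (ip x y))
     \<and> (\<forall>x. x \<noteq> 0 \<longrightarrow> Im (ip x x) = 0 \<and> Re (ip x x) > 0)"

definition is_vector_norm :: "(complex ^ 'n \<Rightarrow> real) \<Rightarrow> bool" where
  "is_vector_norm nrm \<longleftrightarrow>
     (\<forall>x. nrm x \<ge> 0) \<and> (\<forall>x. nrm x = 0 \<longleftrightarrow> x = 0)
     \<and> (\<forall>c x. nrm (c *s x) = cmod c * nrm x)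
     \<and> (\<forall>x y. nrm (x + y) \<le> nrm x + nrm y)"

section \<open>The ITEA interpolant\<close>

text \<open>From here on \<open>\<xi>\<close> is a single row of interpolation points.\<close>

definition node_poly :: "(nat \<Rightarrow> complex) \<Rightarrow> nat \<Rightarrow> nat \<Rightarrow> complex \<Rightarrow> complex" where
  "node_poly \<xi> m n z = (\<Prod>r=m..n. z - \<xi> r)"

text \<open>
  \<open>hermite_dd F \<xi> m d\<close> is the divided difference \<open>F[\<xi>\<^sub>m, \<dots>, \<xi>\<^bsub>m+d\<^esub>]\<close>. Since equal points are listed
  consecutively, coincidence of the first and the last point means that all of them coincide.
\<close>

primrec hermite_dd ::
  "(complex \<Rightarrow> complex ^ 'n) \<Rightarrow> (nat \<Rightarrow> complex) \<Rightarrow> nat \<Rightarrow> nat \<Rightarrow> complex ^ 'n" where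
  "hermite_dd F \<xi> m 0 = F (\<xi> m)"
| "hermite_dd F \<xi> m (Suc d) =
     (if \<xi> (m + Suc d) = \<xi> m
      then (\<chi> i. (deriv ^^ Suc d) (\<lambda>z. F z $ i) (\<xi> m) / fact (Suc d))
      else inverse (\<xi> (m + Suc d) - \<xi> m) *s (hermite_dd F \<xi> (Suc m) d - hermite_dd F \<xi> m d))"

text \<open>Meaningful for \<open>m \<le> n\<close> only.\<close>

definition div_diff ::
  "(complex \<Rightarrow> complex ^ 'n) \<Rightarrow> (nat \<Rightarrow> complex) \<Rightarrow> nat \<Rightarrow> nat \<Rightarrow> complex ^ 'n" where
  "div_diff F \<xi> m n = hermite_dd F \<xi> m (n - m)"

definition hermite_interpolant ::
  "(complex \<Rightarrow> complex ^ 'n) \<Rightarrow> (nat \<Rightarrow> complex) \<Rightarrow> nat \<Rightarrow> nat \<Rightarrow> complex \<Rightarrow> complex ^ 'n" where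
  "hermite_interpolant F \<xi> m n z = (\<Sum>i=m..n. node_poly \<xi> m (i - 1) z *s div_diff F \<xi> m i)"

definition itea_u ::
  "(complex ^ 'n \<Rightarrow> complex ^ 'n \<Rightarrow> complex) \<Rightarrow> complex ^ 'n \<Rightarrow> (complex \<Rightarrow> complex ^ 'n) \<Rightarrow>
   (nat \<Rightarrow> complex) \<Rightarrow> nat \<Rightarrow> nat \<Rightarrow> nat \<Rightarrow> complex" where
  "itea_u ip q F \<xi> p i j = ip q (div_diff F \<xi> (j + 1) (p + i))"

text \<open>
  Coefficient vectors \<open>c\<^sub>0, \<dots>, c\<^sub>k\<close> are functions vanishing beyond \<open>k\<close>, so that uniqueness of such
  a function is uniqueness of the vector.
\<close>

definition itea_coeffs ::
  "(complex ^ 'n \<Rightarrow> complex ^ 'n \<Rightarrow> complex) \<Rightarrow> complex ^ 'n \<Rightarrow> (complex \<Rightarrow> complex ^ 'n) \<Rightarrow>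
   (nat \<Rightarrow> complex) \<Rightarrow> nat \<Rightarrow> nat \<Rightarrow> (nat \<Rightarrow> complex) \<Rightarrow> bool" where
  "itea_coeffs ip q F \<xi> p k c \<longleftrightarrow>
     c k = 1 \<and> (\<forall>j>k. c j = 0)
     \<and> (\<forall>i\<in>{1..k}. (\<Sum>j<k. itea_u ip q F \<xi> p i j * c j) = - itea_u ip q F \<xi> p i k)"

definition itea_numerator ::
  "(complex \<Rightarrow> complex ^ 'n) \<Rightarrow> (nat \<Rightarrow> complex) \<Rightarrow> nat \<Rightarrow> nat \<Rightarrow> (nat \<Rightarrow> complex) \<Rightarrow>
   complex \<Rightarrow> complex ^ 'n" where
  "itea_numerator F \<xi> p k c z =
     (\<Sum>j=0..k. (c j * node_poly \<xi> 1 j z) *s hermite_interpolant F \<xi> (j + 1) p z)"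

definition itea_denominator ::
  "(nat \<Rightarrow> complex) \<Rightarrow> nat \<Rightarrow> (nat \<Rightarrow> complex) \<Rightarrow> complex \<Rightarrow> complex" where
  "itea_denominator \<xi> k c z = (\<Sum>j=0..k. c j * node_poly \<xi> 1 j z)"

definition itea ::
  "(complex ^ 'n \<Rightarrow> complex ^ 'n \<Rightarrow> complex) \<Rightarrow> complex ^ 'n \<Rightarrow> (complex \<Rightarrow> complex ^ 'n) \<Rightarrow>
   (nat \<Rightarrow> complex) \<Rightarrow> nat \<Rightarrow> nat \<Rightarrow> complex \<Rightarrow> complex ^ 'n" where
  "itea ip q F \<xi> p k z =
     (let c = (THE c. itea_coeffs ip q F \<xi> p k c)
      in inverse (itea_denominator \<xi> k c z) *s itea_numerator F \<xi> p k c z)"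

section \<open>The determinants\<close>

definition alpha ::
  "(complex ^ 'n \<Rightarrow> complex ^ 'n \<Rightarrow> complex) \<Rightarrow> complex ^ 'n \<Rightarrow> (nat \<Rightarrow> complex ^ 'n) \<Rightarrow>
   (nat \<Rightarrow> complex) \<Rightarrow> (nat \<Rightarrow> complex) \<Rightarrow> nat \<Rightarrow> nat \<Rightarrow> nat \<Rightarrow> nat \<Rightarrow> complex" where
  "alpha ip q v zs \<xi> p k i s = ip q (v s) * node_poly \<xi> (p + i + 1) (p + k) (zs s)"

text \<open>The indices are \<open>s 1, \<dots>, s k\<close>; matrix positions are counted from \<open>0\<close>.\<close>

definition itea_T ::
  "(complex ^ 'n \<Rightarrow> complex ^ 'n \<Rightarrow> complex) \<Rightarrow> complex ^ 'n \<Rightarrow> (nat \<Rightarrow> complex ^ 'n) \<Rightarrow>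
   (nat \<Rightarrow> complex) \<Rightarrow> (nat \<Rightarrow> complex) \<Rightarrow> nat \<Rightarrow> nat \<Rightarrow> (nat \<Rightarrow> nat) \<Rightarrow> complex" where
  "itea_T ip q v zs \<xi> p k s =
     Determinant.det (Matrix.mat k k (\<lambda>(i, j). alpha ip q v zs \<xi> p k (i + 1) (s (j + 1))))"

definition e_hat ::
  "(nat \<Rightarrow> complex ^ 'n) \<Rightarrow> (nat \<Rightarrow> complex) \<Rightarrow> (nat \<Rightarrow> complex) \<Rightarrow> nat \<Rightarrow> nat \<Rightarrow> nat \<Rightarrow> complex \<Rightarrow>
   complex ^ 'n" where
  "e_hat v zs \<xi> p k s z = (node_poly \<xi> (p + 1) (p + k) (zs s) / (z - zs s)) *s v s"

text \<open>
  Expansion along the vector-valued first row: the minor of the entry in column \<open>j\<close> is the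
  determinant \<open>T\<close> of the sequence \<open>s 0, \<dots>, s k\<close> with \<open>s j\<close> omitted.
\<close>

definition itea_T_hat ::
  "(complex ^ 'n \<Rightarrow> complex ^ 'n \<Rightarrow> complex) \<Rightarrow> complex ^ 'n \<Rightarrow> (nat \<Rightarrow> complex ^ 'n) \<Rightarrow>
   (nat \<Rightarrow> complex) \<Rightarrow> (nat \<Rightarrow> complex) \<Rightarrow> nat \<Rightarrow> nat \<Rightarrow> (nat \<Rightarrow> nat) \<Rightarrow> complex \<Rightarrow>
   complex ^ 'n" where
  "itea_T_hat ip q v zs \<xi> p k s z =
     (\<Sum>j=0..k. ((-1) ^ j * itea_T ip q v zs \<xi> p k (\<lambda>i. if i \<le> j then s (i - 1) else s i))
                 *s e_hat v zs \<xi> p k (s j) z)"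

definition itea_B ::
  "(complex ^ 'n \<Rightarrow> complex ^ 'n \<Rightarrow> complex) \<Rightarrow> complex ^ 'n \<Rightarrow> (nat \<Rightarrow> complex ^ 'n) \<Rightarrow>
   (nat \<Rightarrow> complex) \<Rightarrow> (nat \<Rightarrow> complex) \<Rightarrow> nat \<Rightarrow> nat \<Rightarrow> complex \<Rightarrow> complex ^ 'n" where
  "itea_B ip q v zs \<xi> p k z =
     ((-1) ^ k / itea_T ip q v zs \<xi> p k (\<lambda>j. j) * (\<Prod>i=1..k. (zs (k + 1) - zs i) / (z - zs i)))
       *s itea_T_hat ip q v zs \<xi> p k (\<lambda>j. j + 1) z"

section \<open>Uniform bounds for upper limits\<close>

text \<open>\<open>limsup\<^sub>p a p z \<le> b z\<close> uniformly for \<open>z \<in> S\<close>.\<close>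

definition limsup_le_uniformly_on ::
  "complex set \<Rightarrow> (nat \<Rightarrow> complex \<Rightarrow> real) \<Rightarrow> (complex \<Rightarrow> real) \<Rightarrow> bool" where
  "limsup_le_uniformly_on S a b \<longleftrightarrow>
     (\<forall>\<epsilon>>0. \<forall>\<^sub>F p in sequentially. \<forall>z\<in>S. a p z \<le> b z + \<epsilon>)"

end

theory Submission imports Defs
begin

text \<open>
  Cauchy's formula for \<open>\<Theta>\<close> and the partial fractions make \<open>F\<close> a Cauchy transform: \<open>F z = J (1 / (w - z))\<close>,
  where \<open>J\<close> is a functional supported near \<open>\<Gamma>\<^sub>\<rho>\<close> and at the poles. Divided differences and the error
  \<open>F - R\<close> become values of \<open>J\<close>: the equations for the \<open>c\<^sub>j\<close> say that the denominator \<open>Q\<close> is orthogonal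
  to all polynomials of degree below \<open>k\<close> with respect to \<open>(q, J) / \<Psi>\<^sub>p\<close>, and
  \<open>F z - R z = (\<psi>\<^sub>1\<^sub>,\<^sub>p z / Q z) J (Q w / ((w - z) \<psi>\<^sub>1\<^sub>,\<^sub>p w))\<close>. Testing the orthogonality with the Lagrange
  polynomials of \<open>z\<^sub>1, \<dots>, z\<^sub>k\<close> gives \<open>Q z\<^sub>i = O (\<Psi>\<^sub>p z\<^sub>i / m\<^sub>p)\<close>, where \<open>m\<^sub>p\<close> is the minimum of \<open>\<bar>\<Psi>\<^sub>p\<bar>\<close> on the
  rest of the support. Hence \<open>Q\<close> converges to \<open>\<Prod>(z - z\<^sub>i)\<close>, the point masses at \<open>z\<^sub>1, \<dots>, z\<^sub>k\<close> are
  neutralised, and \<open>F - R = O (\<psi>\<^sub>1\<^sub>,\<^sub>p / m\<^sub>p)\<close>. The leading terms of \<open>Q z\<^sub>i\<close> give the refined result for \<open>r = 1\<close>.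
\<close>

section \<open>Cauchy's formula near a compact set\<close>

text \<open>The hypothesis on the nodes controls |\<Psi>_p| only up to subexponential factors, even
  when its values at two points of one level are compared. For this reason the reference size
  \<open>M p\<close> is left abstract: it becomes the minimum over the poles on the level of z_{k+1}
  when k < \<mu>, and (\<kappa> \<sigma>)^p with \<sigma> < \<rho> arbitrarily close to \<rho> when
  k = \<mu>. Since \<Theta> need not extend to the curve of level \<rho>, the support of
  \<open>J\<close> lies strictly inside it; and since sublevel sets of \<Phi> may have several
  components and level curves may be singular, a grid contour in a shell \<sigma> < \<Phi> < \<rho>
  takes the place of the curve. The estimates use only that this contour yields a bounded functional
  on a compact set. Existence and uniqueness of the c_j come from the same estimate as the size of
  Q(z_i): it is homogeneous in the leading coefficient of Q, and leading coefficient 0 forces Q =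
  0.\<close>

lemma Cauchy_kernel_power_integrable:
  assumes "continuous_on (closed_segment a b) f" "z \<notin> closed_segment a b"
  shows "(\<lambda>w. f w / (w - z) ^ n) contour_integrable_on linepath a b"
  by (rule contour_integrable_continuous_linepath)
     (use assms in \<open>auto intro!: continuous_intros\<close>)

text \<open>Differentiation under the integral sign makes each edge integral continuous in z off the
  edge; that is how the formula, proved for points inside a square, passes to points of
  \<open>A\<close> on grid lines.\<close>

lemma Cauchy_kernel_power_derivative:
  assumes f: "continuous_on (closed_segment a b) f" and z: "z \<notin> closed_segment a b"
  shows "((\<lambda>z. contour_integral (linepath a b) (\<lambda>w. f w / (w - z) ^ Suc n)) has_field_derivative
      of_nat (Suc n) * contour_integral (linepath a b) (\<lambda>w. f w / (w - z) ^ Suc (Suc n))) (at z)"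
proof (rule Cauchy_next_derivative(2)[where S=UNIV and B="cmod (b - a)"])
  show "continuous_on (path_image (linepath a b)) f" using f by simp
  show "cmod (vector_derivative (linepath a b) (at t)) \<le> cmod (b - a)" for t
    by (simp add: vector_derivative_linepath_at)
  show "((\<lambda>u. f u / (u - w) ^ Suc n) has_contour_integral
         contour_integral (linepath a b) (\<lambda>u. f u / (u - w) ^ Suc n)) (linepath a b)"
    if "w \<in> UNIV - path_image (linepath a b)" for w
    using Cauchy_kernel_power_integrable[OF f, of w "Suc n"] that
    by (simp add: has_contour_integral_integral)
qed (use z in auto)

text \<open>The top and left edges are reversed so that every edge of the grid is run to the right
  or upwards. An edge shared by two squares is then one and the same integral, with opposite signs
  in the two boundaries.\<close>

lemma contour_integral_rectpath:
  assumes "continuous_on (path_image (rectpath a c)) f"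
  shows "contour_integral (rectpath a c) f =
    contour_integral (linepath a (Complex (Re c) (Im a))) f
    + contour_integral (linepath (Complex (Re c) (Im a)) c) f
    - contour_integral (linepath (Complex (Re a) (Im c)) c) f
    - contour_integral (linepath a (Complex (Re a) (Im c))) f"
proof -
  let ?b = "Complex (Re c) (Im a)" and ?d = "Complex (Re a) (Im c)"
  have im: "path_image (rectpath a c) =
     closed_segment a ?b \<union> closed_segment ?b c \<union> closed_segment c ?d \<union> closed_segment ?d a"
    by (simp add: rectpath_def Let_def path_image_join Un_assoc)
  have I: "f contour_integrable_on linepath a ?b" "f contour_integrable_on linepath ?b c"
    "f contour_integrable_on linepath c ?d" "f contour_integrable_on linepath ?d a"
    using assms unfolding im
    by (auto intro!: contour_integrable_continuous_linepath elim: continuous_on_subset)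
  have 1: "contour_integral (linepath c ?d) f = - contour_integral (linepath ?d c) f"
    "contour_integral (linepath ?d a) f = - contour_integral (linepath a ?d) f"
    using contour_integral_reversepath[of "linepath ?d c" f] contour_integral_reversepath[of "linepath a ?d" f]
    by (simp_all add: reversepath_linepath)
  show ?thesis
    using I 1 by (simp add: rectpath_def Let_def contour_integrable_join)
qed

text \<open>The cancellation of edges: \<open>S\<close> is the set of squares, \<open>h x\<close>
  the integral over the lower (or left) edge of the square \<open>x\<close>, and \<open>t\<close>
  the shift to the next square. What both sums contain drops out, and the sign records on which side
  of the edge the square of \<open>S\<close> lies.\<close>

lemma sum_minus_sum_image:
  fixes h :: "'a \<Rightarrow> 'b::comm_ring_1"
  assumes "finite S" "inj t"
  shows "(\<Sum>x\<in>S. h x) - (\<Sum>x\<in>S. h (t x)) =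
    (\<Sum>x\<in>{x \<in> S \<union> t ` S. (x \<in> S) \<noteq> (x \<in> t ` S)}. (if x \<in> S then 1 else -1) * h x)"
proof -
  have "(\<Sum>x\<in>S. h (t x)) = (\<Sum>x\<in>t ` S. h x)"
    using assms by (subst sum.reindex) (auto intro: inj_on_subset)
  also have "\<dots> = (\<Sum>x\<in>S \<inter> t ` S. h x) + (\<Sum>x\<in>t ` S - S. h x)"
    using assms sum.Int_Diff[of "t ` S" h S] by (simp add: Int_commute)
  finally have 1: "(\<Sum>x\<in>S. h (t x)) = (\<Sum>x\<in>S \<inter> t ` S. h x) + (\<Sum>x\<in>t ` S - S. h x)" .
  have 2: "(\<Sum>x\<in>S. h x) = (\<Sum>x\<in>S \<inter> t ` S. h x) + (\<Sum>x\<in>S - t ` S. h x)"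
    using assms sum.Int_Diff[of "S" h "t ` S"] by simp
  have 3: "{x \<in> S \<union> t ` S. (x \<in> S) \<noteq> (x \<in> t ` S)} = (S - t ` S) \<union> (t ` S - S)" by auto
  show ?thesis unfolding 1 2 3
    by (subst sum.union_disjoint) (use assms in \<open>auto simp: sum_negf\<close>)
qed

text \<open>
  A grid of squares is laid over the plane, and the Cauchy formulas of the squares that meet \<open>A\<close>
  are added up. An edge that meets \<open>A\<close> belongs to two such squares, so its contributions cancel.
  Points of \<open>A\<close> on grid lines are reached as limits from the interior of a square.
\<close>

lemma Cauchy_formula_compact_in_open:
  assumes A: "compact A" and \<Omega>: "open \<Omega>" and sub: "A \<subseteq> \<Omega>"
  obtains I :: "(bool \<times> int \<times> int) set" and a b c :: "bool \<times> int \<times> int \<Rightarrow> complex"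
  where "finite I" "\<forall>e\<in>I. closed_segment (a e) (b e) \<subseteq> \<Omega> - A"
    "\<forall>f. f holomorphic_on \<Omega> \<longrightarrow> (\<forall>z\<in>A.
       f z = (\<Sum>e\<in>I. c e * contour_integral (linepath (a e) (b e)) (\<lambda>w. f w / (w - z))))"
proof -
  obtain e where e: "e > 0" "(\<Union>x\<in>A. cball x e) \<subseteq> \<Omega>"
    using compact_subset_open_imp_cball_epsilon_subset[OF A \<Omega> sub] by blast
  \<comment> \<open>A square of side e / 2 has diameter below e, so a square that meets
    \<open>A\<close> stays within distance e of a point of \<open>A\<close> and hence in
    \<open>\<Omega>\<close>.\<close>
  define \<delta> where "\<delta> = e / 2"
  have \<delta>: "\<delta> > 0" using e by (simp add: \<delta>_def)
  define P where "P = (\<lambda>(m::int) (n::int). Complex (\<delta> * m) (\<delta> * n))"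
  define Q where "Q = (\<lambda>(m, n). cbox (P m n) (P (m + 1) (n + 1)))"
  have memQ: "z \<in> Q (m, n) \<longleftrightarrow> \<delta> * m \<le> Re z \<and> Re z \<le> \<delta> * (m + 1) \<and> \<delta> * n \<le> Im z \<and> Im z \<le> \<delta> * (n + 1)"
    for z and m n :: int by (auto simp: Q_def P_def in_cbox_complex_iff)
  define S where "S = {x. Q x \<inter> A \<noteq> {}}"
  obtain B where B: "\<And>z. z \<in> A \<Longrightarrow> cmod z \<le> B" using A compact_imp_bounded bounded_iff by metis
  have "S \<subseteq> {\<lfloor>-B/\<delta>\<rfloor>-2..\<lceil>B/\<delta>\<rceil>+2} \<times> {\<lfloor>-B/\<delta>\<rfloor>-2..\<lceil>B/\<delta>\<rceil>+2}"
  proof clarify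
    have aux: "m \<in> {\<lfloor>-B/\<delta>\<rfloor>-2..\<lceil>B/\<delta>\<rceil>+2}" if "\<delta> * m \<le> t" "t \<le> \<delta> * (m+1)" "\<bar>t\<bar> \<le> B" for t::real and m::int
    proof -
      have "real_of_int m \<le> B/\<delta>" "real_of_int m + 1 \<ge> -B/\<delta>"
        using that \<delta> by (auto simp: field_simps)
      thus ?thesis by (simp) linarith
    qed
    fix m n assume "(m,n) \<in> S"
    then obtain z where z: "z \<in> A" "z \<in> Q (m,n)" by (auto simp: S_def)
    show "m \<in> {\<lfloor>-B/\<delta>\<rfloor>-2..\<lceil>B/\<delta>\<rceil>+2} \<and> n \<in> {\<lfloor>-B/\<delta>\<rfloor>-2..\<lceil>B/\<delta>\<rceil>+2}"
      using aux[where m=m and t="Re z"] aux[where m=n and t="Im z"] z B[OF z(1)] abs_Re_le_cmod[of z] abs_Im_le_cmod[of z]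
      unfolding memQ by auto
  qed
  then have fS: "finite S" by (rule finite_subset) auto
  have Q\<Omega>: "Q x \<subseteq> \<Omega>" if xS: "x \<in> S" for x
  proof -
    obtain m n where x: "x = (m,n)" by fastforce
    obtain z0 where z0: "z0 \<in> A" "z0 \<in> Q (m,n)" using xS unfolding S_def x by blast
    have "z \<in> cball z0 e" if "z \<in> Q (m,n)" for z
    proof -
      have "\<bar>Re (z0 - z)\<bar> \<le> \<delta>" "\<bar>Im (z0 - z)\<bar> \<le> \<delta>"
        using that z0 unfolding memQ by (auto simp: algebra_simps)
      then have "cmod (z0 - z) \<le> 2 * \<delta>" using cmod_le[of "z0 - z"] by linarith
      thus ?thesis by (simp add: dist_norm \<delta>_def)
    qed
    thus ?thesis using e z0 x by blast
  qed
  \<comment> \<open>The label (True, m, n) is the lower edge of the square (m, n), the label (False,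
    m, n) its left edge; both start at \<open>P m n\<close>.\<close>
  define ta where "ta = (\<lambda>(h::bool, m::int, n::int). P m n)"
  define tb where "tb = (\<lambda>(h::bool, m::int, n::int). if h then P (m + 1) n else P m (n + 1))"
  define up where "up = (\<lambda>(m::int, n::int). (m, n + 1))"
  define rt where "rt = (\<lambda>(m::int, n::int). (m + 1, n))"
  have inj: "inj up" "inj rt" by (auto simp: inj_def up_def rt_def)
  define IH where "IH = {x \<in> S \<union> up ` S. (x \<in> S) \<noteq> (x \<in> up ` S)}"
  define IV where "IV = {x \<in> S \<union> rt ` S. (x \<in> S) \<noteq> (x \<in> rt ` S)}"
  define I where "I = Pair True ` IH \<union> Pair False ` IV"
  \<comment> \<open>A lower edge of a square in \<open>S\<close> runs with the boundary of that
    square, a left edge against it. An edge whose own square is outside \<open>S\<close> bounds the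
    neighbour below or to the left, with the opposite sign.\<close>
  define c where "c = (\<lambda>(h::bool, x). (if h = (x \<in> S) then 1 else -1) / (2 * pi * \<i>))"
  have fin: "finite IH" "finite IV" using fS by (auto simp: IH_def IV_def)
  have segH: "closed_segment (P m n) (P (m+1) n) = {z. Im z = \<delta> * n \<and> Re z \<in> {\<delta> * m..\<delta> * (m+1)}}"
   and segV: "closed_segment (P m n) (P m (n+1)) = {z. Re z = \<delta> * m \<and> Im z \<in> {\<delta> * n..\<delta> * (n+1)}}" for m n
    using \<delta> by (auto simp: P_def closed_segment_same_Im closed_segment_same_Re closed_segment_eq_real_ivl)
  have seg: "closed_segment (ta e) (tb e) \<subseteq> \<Omega> - A" if eI: "e \<in> I" for e
  proof -
    consider m n where "e = (True, m, n)" "(m,n) \<in> IH" | m n where "e = (False, m, n)" "(m,n) \<in> IV"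
      using eI unfolding I_def by (cases e) auto
    then show ?thesis
    proof cases
      case 1
      have e: "closed_segment (ta e) (tb e) \<subseteq> Q (m,n)" "closed_segment (ta e) (tb e) \<subseteq> Q (m,n-1)"
        unfolding 1 ta_def tb_def prod.case if_True segH using \<delta> by (auto simp: memQ algebra_simps)
      have "(m,n) \<in> up ` S \<longleftrightarrow> (m,n-1) \<in> S" by (force simp: up_def)
      then have "((m,n) \<in> S) \<noteq> ((m,n-1) \<in> S)" using 1 by (auto simp: IH_def)
      then show ?thesis using e Q\<Omega>[of "(m,n)"] Q\<Omega>[of "(m,n-1)"] by (auto simp: S_def)
    next
      case 2
      have e: "closed_segment (ta e) (tb e) \<subseteq> Q (m,n)" "closed_segment (ta e) (tb e) \<subseteq> Q (m-1,n)"
        unfolding 2 ta_def tb_def prod.case if_False segV using \<delta> by (auto simp: memQ algebra_simps)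
      have "(m,n) \<in> rt ` S \<longleftrightarrow> (m-1,n) \<in> S" by (force simp: rt_def)
      then have "((m,n) \<in> S) \<noteq> ((m-1,n) \<in> S)" using 2 by (auto simp: IV_def)
      then show ?thesis using e Q\<Omega>[of "(m,n)"] Q\<Omega>[of "(m-1,n)"] by (auto simp: S_def)
    qed
  qed
  have main: "f z = (\<Sum>e\<in>I. c e * contour_integral (linepath (ta e) (tb e)) (\<lambda>w. f w / (w - z)))"
    if f: "f holomorphic_on \<Omega>" and m0: "(m0, n0) \<in> S" and z: "z \<in> box (P m0 n0) (P (m0+1) (n0+1))" for f z and m0 n0 :: int
  proof -
    let ?g = "\<lambda>w. f w / (w - z)"
    define h where "h = (\<lambda>(m, n). contour_integral (linepath (P m n) (P (m+1) n)) ?g)"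
    define u where "u = (\<lambda>(m, n). contour_integral (linepath (P m n) (P m (n+1))) ?g)"
    have off: "z \<notin> Q (m,n)" if "(m,n) \<noteq> (m0,n0)" for m n
    proof
      assume *: "z \<in> Q (m,n)"
      have i: "i = j" if "\<delta> * j < t" "t < \<delta> * (j+1)" "\<delta> * i \<le> t" "t \<le> \<delta> * (i+1)" for t and i j::int
      proof -
        have "\<delta> * j < \<delta> * (i+1)" "\<delta> * i < \<delta> * (j+1)" using that by linarith+
        then have "real_of_int j < i+1" "real_of_int i < j+1" using \<delta> by simp_all
        then show ?thesis by linarith
      qed
      show False using i[where t="Re z" and j=m0 and i=m] i[where t="Im z" and j=n0 and i=n] * z that
        unfolding memQ by (auto simp: in_box_complex_iff P_def)
    qed
    have 1: "h (m,n) - h (up (m,n)) + (u (rt (m,n)) - u (m,n)) = (if (m,n) = (m0,n0) then 2 * pi * \<i> * f z else 0)"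
      if "(m,n) \<in> S" for m n
    proof -
      let ?r = "rectpath (P m n) (P (m+1) (n+1))"
      have hol: "f holomorphic_on Q (m,n)" using f Q\<Omega>[OF that] holomorphic_on_subset by blast
      have le: "Re (P m n) \<le> Re (P (m+1) (n+1))" "Im (P m n) \<le> Im (P (m+1) (n+1))"
        using \<delta> by (auto simp: P_def)
      have im: "path_image ?r \<subseteq> Q (m,n)"
        using path_image_rectpath_subset_cbox[OF le] by (simp add: Q_def)
      have zr: "z \<notin> path_image ?r"
      proof (cases "(m,n) = (m0,n0)")
        case True then show ?thesis using path_image_rectpath_inter_box[OF le] z by auto
      next
        case False then show ?thesis using off im by blast
      qed
      have cont: "continuous_on (path_image ?r) ?g"
        using hol im zr by (auto intro!: continuous_intros intro: holomorphic_on_imp_continuous_on continuous_on_subset)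
      have "contour_integral ?r ?g = (if (m,n) = (m0,n0) then 2 * pi * \<i> * f z else 0)"
      proof (cases "(m,n) = (m0,n0)")
        case True
        have "(?g has_contour_integral (2 * pi * \<i> * winding_number ?r z * f z)) ?r"
          by (rule Cauchy_integral_formula_convex_simple[of "Q (m,n)"])
             (use hol im zr z True in \<open>auto simp: Q_def interior_cbox\<close>)
        then show ?thesis using True z by (simp add: winding_number_rectpath contour_integral_unique)
      next
        case False
        have "(?g has_contour_integral 0) ?r"
          by (rule Cauchy_theorem_convex_simple[of _ "Q (m,n)"])
             (use hol im off[OF False] in \<open>auto simp: Q_def intro!: holomorphic_intros\<close>)
        then show ?thesis by (subst if_not_P) (use False in \<open>auto simp: contour_integral_unique\<close>)
      qed
      moreover have "contour_integral ?r ?g = h (m,n) - h (up (m,n)) + (u (rt (m,n)) - u (m,n))"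
        by (subst contour_integral_rectpath[OF cont]) (simp add: h_def u_def up_def rt_def P_def)
      ultimately show ?thesis by simp
    qed
    have "2 * pi * \<i> * f z = (\<Sum>x\<in>S. if x = (m0,n0) then 2 * pi * \<i> * f z else 0)"
      using m0 fS by simp
    also have "\<dots> = (\<Sum>x\<in>S. h x - h (up x) + (u (rt x) - u x))"
      by (intro sum.cong refl, subst 1[of "fst x" "snd x" for x, unfolded prod.collapse]) auto
    also have "\<dots> = ((\<Sum>x\<in>S. h x) - (\<Sum>x\<in>S. h (up x))) - ((\<Sum>x\<in>S. u x) - (\<Sum>x\<in>S. u (rt x)))"
      by (simp add: sum.distrib sum_subtractf)
    also have "\<dots> = (\<Sum>x\<in>IH. (if x \<in> S then 1 else -1) * h x) - (\<Sum>x\<in>IV. (if x \<in> S then 1 else -1) * u x)"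
      unfolding IH_def IV_def by (simp only: sum_minus_sum_image[OF fS inj(1)] sum_minus_sum_image[OF fS inj(2)])
    finally have 2: "2 * pi * \<i> * f z = \<dots>" .
    have "(\<Sum>e\<in>I. c e * contour_integral (linepath (ta e) (tb e)) ?g) =
       (\<Sum>x\<in>IH. c (True, x) * h x) + (\<Sum>x\<in>IV. c (False, x) * u x)"
      unfolding I_def using fin
      by (subst sum.union_disjoint) (auto simp: sum.reindex inj_on_def ta_def tb_def h_def u_def case_prod_beta)
    also have "\<dots> = (\<Sum>x\<in>IH. (if x \<in> S then 1 else -1) * h x / (2 * pi * \<i>)) - (\<Sum>x\<in>IV. (if x \<in> S then 1 else -1) * u x / (2 * pi * \<i>))"
      unfolding diff_conv_add_uminus sum_negf[symmetric]
      by (intro arg_cong2[where f="(+)"] sum.cong) (auto simp: c_def)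
    also have "\<dots> = (2 * pi * \<i> * f z) / (2 * pi * \<i>)"
      unfolding 2 by (simp add: sum_divide_distrib diff_divide_distrib)
    finally show ?thesis by simp
  qed
  show ?thesis
  proof (rule that[of I ta tb c]; (intro ballI allI impI)?)
    show "finite I" using fin by (simp add: I_def)
    show "closed_segment (ta e) (tb e) \<subseteq> \<Omega> - A" if "e \<in> I" for e using seg that .
    fix f z assume f: "f holomorphic_on \<Omega>" and z: "z \<in> A"
    let ?G = "\<lambda>z. \<Sum>e\<in>I. c e * contour_integral (linepath (ta e) (tb e)) (\<lambda>w. f w / (w - z))"
    define m0 n0 where "m0 = \<lfloor>Re z / \<delta>\<rfloor>" and "n0 = \<lfloor>Im z / \<delta>\<rfloor>"
    have mn: "\<delta> * m0 \<le> Re z" "Re z < \<delta> * (m0+1)" "\<delta> * n0 \<le> Im z" "Im z < \<delta> * (n0+1)"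
    proof -
      have "m0 \<le> Re z / \<delta>" "Re z / \<delta> < m0 + 1" "n0 \<le> Im z / \<delta>" "Im z / \<delta> < n0 + 1"
        unfolding m0_def n0_def by linarith+
      then show "\<delta> * m0 \<le> Re z" "Re z < \<delta> * (m0+1)" "\<delta> * n0 \<le> Im z" "Im z < \<delta> * (n0+1)"
        using \<delta> by (simp_all add: pos_le_divide_eq pos_divide_less_eq mult.commute)
    qed
    have "z \<in> Q (m0, n0)" using mn unfolding memQ by auto
    then have S0: "(m0,n0) \<in> S" using z unfolding S_def by blast
    \<comment> \<open>The floors put z at worst on the lower or left side of its square, so a small
      move along the diagonal leads into the interior.\<close>
    let ?z = "\<lambda>t. z + of_real t * (1 + \<i>)"
    have lim: "(?z \<longlongrightarrow> z) (at_right 0)" by (auto intro!: tendsto_eq_intros)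
    have contf: "isCont f z" using f \<Omega> z sub
      by (metis continuous_on_eq_continuous_at holomorphic_on_imp_continuous_on subsetD)
    have "isCont (\<lambda>z. contour_integral (linepath (ta e) (tb e)) (\<lambda>w. f w / (w - z))) z" if "e \<in> I" for e
    proof -
      have "continuous_on (closed_segment (ta e) (tb e)) f"
        using seg[OF that] f by (meson Diff_subset continuous_on_subset holomorphic_on_imp_continuous_on subset_trans)
      from Cauchy_kernel_power_derivative[OF this, of z 0] seg[OF that] z show ?thesis
        by (auto dest: DERIV_isCont)
    qed
    then have contG: "isCont ?G z" by (intro continuous_intros) auto
    have 1: "((\<lambda>t. f (?z t)) \<longlongrightarrow> f z) (at_right 0)" "((\<lambda>t. ?G (?z t)) \<longlongrightarrow> ?G z) (at_right 0)"
      using isCont_tendsto_compose[OF contf lim] isCont_tendsto_compose[OF contG lim] by auto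
    have "min (\<delta> * (m0+1) - Re z) (\<delta> * (n0+1) - Im z) > 0" using mn by auto
    then have "\<forall>\<^sub>F t in at_right 0. t < min (\<delta> * (m0+1) - Re z) (\<delta> * (n0+1) - Im z)"
      by (intro order_tendstoD(2)[OF tendsto_ident_at])
    moreover have "\<forall>\<^sub>F t::real in at_right 0. t > 0" by (simp add: eventually_at_right_less)
    ultimately have "\<forall>\<^sub>F t in at_right 0. ?G (?z t) = f (?z t)"
    proof eventually_elim
      case (elim t)
      show ?case
        by (rule main[symmetric, OF f S0]) (use mn elim in \<open>auto simp: in_box_complex_iff P_def\<close>)
    qed
    then have "((\<lambda>t. f (?z t)) \<longlongrightarrow> ?G z) (at_right 0)"
      by (rule Lim_transform_eventually[OF 1(2)])
    then show "f z = ?G z" using tendsto_unique[OF _ 1(1)] by (simp add: trivial_limit_at_right_real)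
  qed
qed

section \<open>Bounded functionals on the functions continuous on a set\<close>

text \<open>This stands in for a complex measure on \<open>L\<close>. A functional acts on all
  functions, but linearity and boundedness are asked only for functions continuous on
  \<open>L\<close>. The bound is phrased with any majorant \<open>M\<close> in place of a supremum,
  so that \<open>M = 0\<close> is allowed and an empty \<open>L\<close> needs no exception.\<close>

definition bounded_functional :: "complex set \<Rightarrow> ((complex \<Rightarrow> complex) \<Rightarrow> complex) \<Rightarrow> bool" where
  "bounded_functional L \<Lambda> \<longleftrightarrow>
     (\<forall>c g h. continuous_on L g \<longrightarrow> continuous_on L h \<longrightarrow>
        \<Lambda> (\<lambda>w. c * g w + h w) = c * \<Lambda> g + \<Lambda> h)
     \<and> (\<exists>B\<ge>0. \<forall>g M. continuous_on L g \<longrightarrow> 0 \<le> M \<longrightarrow> (\<forall>w\<in>L. cmod (g w) \<le> M) \<longrightarrow> cmod (\<Lambda> g) \<le> B * M)"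

lemma bounded_functional_linear:
  "bounded_functional L \<Lambda> \<Longrightarrow> continuous_on L g \<Longrightarrow> continuous_on L h \<Longrightarrow>
    \<Lambda> (\<lambda>w. c * g w + h w) = c * \<Lambda> g + \<Lambda> h"
  unfolding bounded_functional_def by blast

lemma bounded_functional_bound:
  "bounded_functional L \<Lambda> \<Longrightarrow>
    \<exists>B\<ge>0. \<forall>g M. continuous_on L g \<longrightarrow> 0 \<le> M \<longrightarrow> (\<forall>w\<in>L. cmod (g w) \<le> M) \<longrightarrow> cmod (\<Lambda> g) \<le> B * M"
  unfolding bounded_functional_def by (rule conjunct2)

lemma bounded_functional_zero:
  assumes "bounded_functional L \<Lambda>" shows "\<Lambda> (\<lambda>w. 0) = 0"
  using bounded_functional_linear[OF assms, of "\<lambda>w. 0" "\<lambda>w. 0" 1] by simp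

lemma bounded_functional_scale:
  assumes "bounded_functional L \<Lambda>" "continuous_on L g" shows "\<Lambda> (\<lambda>w. c * g w) = c * \<Lambda> g"
  using bounded_functional_linear[OF assms(1,2), of "\<lambda>w. 0" c] bounded_functional_zero[OF assms(1)] by simp

lemma bounded_functional_add:
  assumes "bounded_functional L \<Lambda>" "continuous_on L g" "continuous_on L h"
  shows "\<Lambda> (\<lambda>w. g w + h w) = \<Lambda> g + \<Lambda> h"
  using bounded_functional_linear[OF assms, of 1] by simp

lemma bounded_functional_diff:
  assumes "bounded_functional L \<Lambda>" "continuous_on L g" "continuous_on L h"
  shows "\<Lambda> (\<lambda>w. g w - h w) = \<Lambda> g - \<Lambda> h"
  using bounded_functional_linear[OF assms(1,3,2), of "-1"] by simp

text \<open>The functional cannot see values off \<open>L\<close>: boundedness with the majorant 0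
  kills \<open>g - h\<close>.\<close>

lemma bounded_functional_cong:
  assumes bf: "bounded_functional L \<Lambda>" and c: "continuous_on L g" "continuous_on L h"
    and eq: "\<And>w. w \<in> L \<Longrightarrow> g w = h w"
  shows "\<Lambda> g = \<Lambda> h"
proof -
  obtain B where B0: "B \<ge> 0" and B': "\<forall>g M. continuous_on L g \<longrightarrow> 0 \<le> M \<longrightarrow> (\<forall>w\<in>L. cmod (g w) \<le> M) \<longrightarrow> cmod (\<Lambda> g) \<le> B * M"
    using bounded_functional_bound[OF bf] by (elim exE conjE)
  note B = B0 B'[rule_format]
  from B(2)[of "\<lambda>w. g w - h w" 0] have "\<Lambda> (\<lambda>w. g w - h w) = 0"
    using c eq by (auto intro!: continuous_intros)
  then show ?thesis using bounded_functional_diff[OF bf c] by simp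
qed

lemma bounded_functional_sum:
  assumes "bounded_functional L \<Lambda>" "finite A" "\<And>x. x \<in> A \<Longrightarrow> continuous_on L (g x)"
  shows "\<Lambda> (\<lambda>w. \<Sum>x\<in>A. g x w) = (\<Sum>x\<in>A. \<Lambda> (g x))"
  using assms(2,3)
proof (induction A rule: finite_induct)
  case empty
  then show ?case using bounded_functional_zero[OF assms(1)] by simp
next
  case (insert x A)
  then show ?case
    by (simp, subst bounded_functional_add[OF assms(1)]) (auto intro!: continuous_intros)
qed

text \<open>Serves for the sum over the edges of the contour, for sums of point masses, and for the
  pairing with q in coordinates.\<close>

lemma bounded_functional_combination:
  assumes "finite A" and bf: "\<And>x. x \<in> A \<Longrightarrow> bounded_functional L (\<Lambda> x)"
  shows "bounded_functional L (\<lambda>g. \<Sum>x\<in>A. a x * \<Lambda> x g)"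
proof -
  have "\<exists>B\<ge>0. \<forall>g M. continuous_on L g \<longrightarrow> 0 \<le> M \<longrightarrow> (\<forall>w\<in>L. cmod (g w) \<le> M) \<longrightarrow> cmod (\<Lambda> x g) \<le> B * M"
    if "x \<in> A" for x using bf[OF that] unfolding bounded_functional_def by blast
  then obtain B where B: "\<And>x. x \<in> A \<Longrightarrow> B x \<ge> 0"
    "\<And>x g M. x \<in> A \<Longrightarrow> continuous_on L g \<Longrightarrow> 0 \<le> M \<Longrightarrow> (\<forall>w\<in>L. cmod (g w) \<le> M) \<Longrightarrow> cmod (\<Lambda> x g) \<le> B x * M"
    by metis
  show ?thesis
    unfolding bounded_functional_def
  proof (intro conjI allI impI exI)
    show "(\<Sum>x\<in>A. a x * \<Lambda> x (\<lambda>w. c * g w + h w)) = c * (\<Sum>x\<in>A. a x * \<Lambda> x g) + (\<Sum>x\<in>A. a x * \<Lambda> x h)"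
      if "continuous_on L g" "continuous_on L h" for c g h
      unfolding sum_distrib_left sum.distrib[symmetric]
      by (rule sum.cong) (use that in \<open>auto simp: bounded_functional_linear[OF bf] distrib_left\<close>)
    show "(\<Sum>x\<in>A. cmod (a x) * B x) \<ge> 0" using B by (intro sum_nonneg) auto
    show "cmod (\<Sum>x\<in>A. a x * \<Lambda> x g) \<le> (\<Sum>x\<in>A. cmod (a x) * B x) * M"
      if "continuous_on L g" "0 \<le> M" "\<forall>w\<in>L. cmod (g w) \<le> M" for g M
      unfolding sum_distrib_right
      by (rule order.trans[OF norm_sum sum_mono])
         (use B(2)[OF _ that] in \<open>auto simp: norm_mult mult.assoc intro!: mult_left_mono\<close>)
  qed
qed

lemma bounded_functional_eval: "a \<in> L \<Longrightarrow> bounded_functional L (\<lambda>g. g a)"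
  unfolding bounded_functional_def by (auto intro!: exI[of _ 1])

lemma bounded_functional_mono:
  assumes "bounded_functional L \<Lambda>" "L \<subseteq> L'" shows "bounded_functional L' \<Lambda>"
proof -
  obtain B where B0: "B \<ge> 0" and B': "\<forall>g M. continuous_on L g \<longrightarrow> 0 \<le> M \<longrightarrow> (\<forall>w\<in>L. cmod (g w) \<le> M) \<longrightarrow> cmod (\<Lambda> g) \<le> B * M"
    using bounded_functional_bound[OF assms(1)] by (elim exE conjE)
  note B = B0 B'[rule_format]
  show ?thesis
    unfolding bounded_functional_def
  proof (intro conjI allI impI exI)
    show "\<Lambda> (\<lambda>w. c * g w + h w) = c * \<Lambda> g + \<Lambda> h"
      if "continuous_on L' g" "continuous_on L' h" for c g h
      using that continuous_on_subset[OF _ assms(2)] by (intro bounded_functional_linear[OF assms(1)])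
    show "B \<ge> 0" by fact
    show "cmod (\<Lambda> g) \<le> B * M" if "continuous_on L' g" "0 \<le> M" "\<forall>w\<in>L'. cmod (g w) \<le> M" for g M
      using that assms(2) continuous_on_subset[OF _ assms(2)] by (intro B(2)) auto
  qed
qed

lemma bounded_functional_contour_integral:
  assumes f: "continuous_on (closed_segment a b) f"
  shows "bounded_functional (closed_segment a b) (\<lambda>g. contour_integral (linepath a b) (\<lambda>w. f w * g w))"
proof -
  obtain N where N: "\<And>w. w \<in> closed_segment a b \<Longrightarrow> cmod (f w) \<le> N"
    using compact_imp_bounded[OF compact_continuous_image[OF f compact_segment]]
    unfolding bounded_iff by auto
  have N0: "N \<ge> 0" using N[of a] by (smt (verit) ends_in_segment(1) norm_ge_zero)
  have I: "(\<lambda>w. f w * g w) contour_integrable_on linepath a b" if "continuous_on (closed_segment a b) g" for g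
    using f that by (intro contour_integrable_continuous_linepath continuous_intros)
  show ?thesis
    unfolding bounded_functional_def
  proof (intro conjI allI impI exI)
    show "contour_integral (linepath a b) (\<lambda>w. f w * (c * g w + h w)) =
       c * contour_integral (linepath a b) (\<lambda>w. f w * g w) + contour_integral (linepath a b) (\<lambda>w. f w * h w)"
      if "continuous_on (closed_segment a b) g" "continuous_on (closed_segment a b) h" for c g h
      using contour_integral_add[OF contour_integrable_lmul[OF I[OF that(1)], of c] I[OF that(2)]]
        contour_integral_lmul[OF I[OF that(1)], of c]
      by (simp add: algebra_simps)
    show "0 \<le> N * cmod (b - a)" using N0 by simp
    show "cmod (contour_integral (linepath a b) (\<lambda>w. f w * g w)) \<le> N * cmod (b - a) * M"
      if "continuous_on (closed_segment a b) g" "0 \<le> M" "\<forall>w\<in>closed_segment a b. cmod (g w) \<le> M" for g M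
    proof -
      have "cmod (contour_integral (linepath a b) (\<lambda>w. f w * g w)) \<le> (N * M) * cmod (b - a)"
        by (rule contour_integral_bound_linepath[OF I[OF that(1)]])
           (use N N0 that in \<open>auto simp: norm_mult intro!: mult_mono\<close>)
      then show ?thesis by (simp add: mult_ac)
    qed
  qed
qed

text \<open>\<open>L\<close> is fixed before f, so that one compact set carries the functionals of
  all components of \<Theta>.\<close>

lemma Cauchy_functional_compact_in_open:
  assumes "compact A" "open \<Omega>" "A \<subseteq> \<Omega>"
  obtains L where "compact L" "L \<subseteq> \<Omega> - A"
    "\<And>f. f holomorphic_on \<Omega> \<Longrightarrow>
       \<exists>\<Lambda>. bounded_functional L \<Lambda> \<and> (\<forall>z\<in>A. f z = \<Lambda> (\<lambda>w. 1 / (w - z)))"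
proof -
  obtain I a b c where I: "finite (I :: (bool \<times> int \<times> int) set)"
    and seg: "\<forall>e\<in>I. closed_segment (a e) (b e) \<subseteq> \<Omega> - A"
    and rep: "\<forall>f. f holomorphic_on \<Omega> \<longrightarrow> (\<forall>z\<in>A.
       f z = (\<Sum>e\<in>I. c e * contour_integral (linepath (a e) (b e)) (\<lambda>w. f w / (w - z))))"
    by (rule Cauchy_formula_compact_in_open[OF assms]) (rule that)
  let ?L = "\<Union>e\<in>I. closed_segment (a e) (b e)"
  show ?thesis
  proof (rule that[of ?L])
    show "compact ?L" using I by (intro compact_UN) auto
    show "?L \<subseteq> \<Omega> - A" using seg by blast
    fix f assume f: "f holomorphic_on \<Omega>"
    have "bounded_functional ?L (\<lambda>g. \<Sum>e\<in>I. c e * contour_integral (linepath (a e) (b e)) (\<lambda>w. f w * g w))"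
    proof (rule bounded_functional_combination[OF I])
      fix e assume e: "e \<in> I"
      have "continuous_on (closed_segment (a e) (b e)) f"
        using bspec[OF seg e] f by (intro holomorphic_on_imp_continuous_on holomorphic_on_subset[OF f]) auto
      then show "bounded_functional ?L (\<lambda>g. contour_integral (linepath (a e) (b e)) (\<lambda>w. f w * g w))"
        by (rule bounded_functional_mono[OF bounded_functional_contour_integral]) (use e in blast)
    qed
    then show "\<exists>\<Lambda>. bounded_functional ?L \<Lambda> \<and> (\<forall>z\<in>A. f z = \<Lambda> (\<lambda>w. 1 / (w - z)))"
      using rep f by (intro exI conjI) auto
  qed
qed

section \<open>Cauchy transforms\<close>

text \<open>
  The geometric series of \<open>1 / (w - u)\<close> around \<open>z\<close> converges uniformly on \<open>L\<close>, so \<open>f\<close> has a power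
  series at \<open>z\<close> with the coefficients on the right-hand side.
\<close>

lemma Cauchy_transform_higher_deriv:
  assumes bf: "bounded_functional L J" and L: "compact L" and U: "open U" "U \<inter> L = {}"
    and f: "\<And>z. z \<in> U \<Longrightarrow> f z = J (\<lambda>w. 1 / (w - z))" and z: "z \<in> U"
  shows "(deriv ^^ n) f z / fact n = J (\<lambda>w. 1 / (w - z) ^ Suc n)"
proof -
  obtain e where e: "e > 0" "ball z e \<subseteq> U" using U z openE by blast
  have far: "cmod (w - z) \<ge> e" if "w \<in> L" for w
  proof (rule ccontr)
    assume "\<not> ?thesis"
    then have "w \<in> ball z e" by (simp add: dist_norm norm_minus_commute)
    with e U that show False by blast
  qed
  then have ne: "w \<noteq> z" if "w \<in> L" for w using that e by fastforce
  obtain B where B0: "B \<ge> 0" and B': "\<forall>g M. continuous_on L g \<longrightarrow> 0 \<le> M \<longrightarrow> (\<forall>w\<in>L. cmod (g w) \<le> M) \<longrightarrow> cmod (J g) \<le> B * M"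
    using bounded_functional_bound[OF bf] by (elim exE conjE)
  note B = B0 B'[rule_format]
  define a where "a = (\<lambda>n. J (\<lambda>w. 1 / (w - z) ^ Suc n))"
  \<comment> \<open>Taking |t| below e / 2 keeps w - (z + t) at least e / 2 away from 0 and the
    ratio t / (w - z) below 1/2 in modulus.\<close>
  have sums: "(\<lambda>n. a n * t ^ n) sums f (z + t)" if t: "cmod t < e / 2" for t
  proof -
    have zt: "z + t \<in> U" using e t by (intro subsetD[OF e(2)]) (auto simp: dist_norm)
    have net: "w - (z + t) \<noteq> 0" if "w \<in> L" for w using zt U that by auto
    have fart: "cmod (w - (z + t)) \<ge> e / 2" if "w \<in> L" for w
      using far[OF that] t norm_triangle_ineq2[of "w - z" t] by (simp add: algebra_simps)
    \<comment> \<open>The finite geometric sum has an explicit remainder, so convergence is an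
      estimate on \<open>L\<close> and \<open>J\<close> is never exchanged with a limit.\<close>
    have rem: "f (z + t) - (\<Sum>j<n. a j * t ^ j) = J (\<lambda>w. (t / (w - z)) ^ n / (w - (z + t)))" for n
    proof -
      have "(\<Sum>j<n. a j * t ^ j) = (\<Sum>j<n. J (\<lambda>w. t ^ j * (1 / (w - z) ^ Suc j)))"
        unfolding a_def using ne
        by (intro sum.cong refl, subst bounded_functional_scale[OF bf]) (auto intro!: continuous_intros simp: mult.commute)
      also have "\<dots> = J (\<lambda>w. \<Sum>j<n. t ^ j * (1 / (w - z) ^ Suc j))"
        using ne by (intro bounded_functional_sum[OF bf, symmetric]) (auto intro!: continuous_intros)
      finally have "f (z + t) - (\<Sum>j<n. a j * t ^ j) = J (\<lambda>w. 1 / (w - (z + t)) - (\<Sum>j<n. t ^ j * (1 / (w - z) ^ Suc j)))"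
        unfolding f[OF zt] using ne net
        by (simp only:, intro bounded_functional_diff[OF bf, symmetric]) (auto intro!: continuous_intros)
      also have "\<dots> = J (\<lambda>w. (t / (w - z)) ^ n / (w - (z + t)))"
      proof (rule bounded_functional_cong[OF bf])
        show "1 / (w - (z + t)) - (\<Sum>j<n. t ^ j * (1 / (w - z) ^ Suc j)) = (t / (w - z)) ^ n / (w - (z + t))"
          if "w \<in> L" for w
        proof (induction n)
          case (Suc n)
          have "(t / (w - z)) ^ n / (w - (z + t)) - t ^ n * (1 / (w - z) ^ Suc n)
             = (t / (w - z)) ^ n * (1 / (w - (z + t)) - 1 / (w - z))"
            by (simp add: power_divide algebra_simps)
          also have "1 / (w - (z + t)) - 1 / (w - z) = t / (w - z) / (w - (z + t))"
            using ne[OF that] net[OF that] by (simp add: field_simps)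
          finally show ?case using Suc by (simp add: algebra_simps)
        qed simp
      qed (use ne net in \<open>auto intro!: continuous_intros\<close>)
      finally show ?thesis .
    qed
    have le: "cmod (f (z + t) - (\<Sum>j<n. a j * t ^ j)) \<le> B * ((cmod t / e) ^ n / (e / 2))" for n
      unfolding rem
    proof (rule B(2))
      fix w assume w: "w \<in> L"
      have "cmod t / cmod (w - z) \<le> cmod t / e" using far[OF w] e by (intro divide_left_mono mult_pos_pos) auto
      then show "cmod ((t / (w - z)) ^ n / (w - (z + t))) \<le> (cmod t / e) ^ n / (e / 2)"
        unfolding norm_divide norm_power using fart[OF w] far[OF w] e(1) by (intro frac_le power_mono) auto
    qed (use e ne net in \<open>auto intro!: continuous_intros\<close>)
    have "(\<lambda>n. B * ((cmod t / e) ^ n / (e / 2))) \<longlonglongrightarrow> B * (0 / (e / 2))"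
      using t e by (intro tendsto_intros LIMSEQ_realpow_zero) auto
    then have lim: "(\<lambda>n. B * ((cmod t / e) ^ n / (e / 2))) \<longlonglongrightarrow> 0" by simp
    have "(\<lambda>n. f (z + t) - (\<Sum>j<n. a j * t ^ j)) \<longlonglongrightarrow> 0"
      by (rule Lim_null_comparison[OF always_eventually lim]) (use le in blast)
    from tendsto_diff[OF tendsto_const[of "f (z + t)"] this] show ?thesis by (simp add: sums_def)
  qed
  have "(\<lambda>t. f (z + t)) has_fps_expansion Abs_fps a"
    unfolding has_fps_expansion_def
  proof
    have "ereal (norm (of_real (e/4) :: complex)) \<le> conv_radius a"
      by (intro conv_radius_geI sums_summable[OF sums]) (use e in auto)
    moreover have "0 < ereal (norm (of_real (e/4) :: complex))" using e by simp
    ultimately show "0 < fps_conv_radius (Abs_fps a)"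
      unfolding fps_conv_radius_def by (metis fps_nth_Abs_fps ext less_le_trans)
    have "\<forall>\<^sub>F t in nhds 0. t \<in> ball 0 (e / 2)" using e by (intro eventually_nhds_in_open) auto
    then show "\<forall>\<^sub>F t in nhds 0. eval_fps (Abs_fps a) t = f (z + t)"
      by eventually_elim (use sums in \<open>auto simp: eval_fps_def sums_iff\<close>)
  qed
  from fps_nth_fps_expansion[OF this, of n] show ?thesis
    by (subst higher_deriv_shift_0) (simp add: a_def o_def)
qed

section \<open>Bases of polynomial spaces\<close>

text \<open>The top coefficient of \<open>S\<close> is removed with the basis element of that
  degree. In the applications \<open>b j\<close> is the product over the last j nodes of a row;
  coincident nodes do no harm.\<close>

lemma monic_basis_span:
  fixes b :: "nat \<Rightarrow> complex poly"
  assumes b: "\<And>j. j < k \<Longrightarrow> degree (b j) = j \<and> lead_coeff (b j) = 1" and S: "\<And>i. i \<ge> k \<Longrightarrow> coeff S i = 0"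
  shows "\<exists>a. S = (\<Sum>j<k. Polynomial.smult (a j) (b j))"
  using assms
proof (induction k arbitrary: S)
  case 0
  then show ?case by (simp add: poly_eq_iff)
next
  case (Suc k)
  let ?S = "S - Polynomial.smult (coeff S k) (b k)"
  have bk: "degree (b k) = k" "coeff (b k) k = 1" using Suc.prems(1)[of k] by auto
  have c: "coeff ?S i = 0" if "i \<ge> k" for i
  proof (cases "i = k")
    case False
    then show ?thesis using that bk Suc.prems(2)[of i] by (simp add: coeff_eq_0)
  qed (use bk in simp)
  have "\<exists>a. ?S = (\<Sum>j<k. Polynomial.smult (a j) (b j))"
  proof (rule Suc.IH)
    show "degree (b j) = j \<and> lead_coeff (b j) = 1" if "j < k" for j
      by (rule Suc.prems(1)[OF less_SucI[OF that]])
  qed (rule c)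
  then obtain a where a: "?S = (\<Sum>j<k. Polynomial.smult (a j) (b j))" by (elim exE)
  have "S = (\<Sum>j<Suc k. Polynomial.smult ((a(k := coeff S k)) j) (b j))"
  proof -
    have "(\<Sum>j<k. Polynomial.smult ((a(k := coeff S k)) j) (b j)) = ?S"
      unfolding a by (intro sum.cong) auto
    then show ?thesis by (simp only: sum.lessThan_Suc fun_upd_same diff_add_cancel)
  qed
  then show ?case by (intro exI[of _ "a(k := coeff S k)"])
qed

text \<open>The degrees are distinct, so the highest coefficient vanishes first. Products over the
  first j nodes recover the c_j from the denominator; products over the last j nodes belong to the
  determinants.\<close>

lemma monic_basis_independent:
  fixes b :: "nat \<Rightarrow> complex poly"
  assumes b: "\<And>j. j < k \<Longrightarrow> degree (b j) = j \<and> lead_coeff (b j) = 1"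
    and eq: "(\<Sum>j<k. Polynomial.smult (a j) (b j)) = 0" and j: "j < k"
  shows "a j = 0"
  using assms
proof (induction k)
  case (Suc k)
  have "coeff (\<Sum>j<k. Polynomial.smult (a j) (b j)) k = 0"
    unfolding coeff_sum by (intro sum.neutral) (use Suc.prems(1) in \<open>auto simp: coeff_eq_0\<close>)
  moreover have "coeff (b k) k = 1" using Suc.prems(1)[of k] by auto
  moreover have "coeff (\<Sum>j<Suc k. Polynomial.smult (a j) (b j)) k = 0" using Suc.prems(2) by simp
  ultimately have ak: "a k = 0" by simp
  show ?case
  proof (cases "j = k")
    case False
    show ?thesis
    proof (rule Suc.IH)
      show "degree (b j) = j \<and> lead_coeff (b j) = 1" if "j < k" for j
        by (rule Suc.prems(1)[OF less_SucI[OF that]])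
    qed (use False Suc.prems ak in auto)
  qed (use ak in simp)
qed simp

definition root_poly :: "(nat \<Rightarrow> complex) \<Rightarrow> nat set \<Rightarrow> complex poly" where
  "root_poly z A = (\<Prod>r\<in>A. [:- z r, 1:])"

lemma poly_root_poly: "poly (root_poly z A) w = (\<Prod>r\<in>A. w - z r)"
  by (simp add: root_poly_def poly_prod)

lemma degree_root_poly: "finite A \<Longrightarrow> degree (root_poly z A) = card A"
  unfolding root_poly_def by (subst degree_prod_eq_sum_degree) auto

lemma lead_coeff_root_poly: "lead_coeff (root_poly z A) = 1"
  unfolding root_poly_def by (simp add: lead_coeff_prod)

lemma root_poly_monic:
  "finite A \<Longrightarrow> card A = j \<Longrightarrow> degree (root_poly z A) = j \<and> lead_coeff (root_poly z A) = 1"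
  by (intro conjI lead_coeff_root_poly) (simp add: degree_root_poly)

definition lagrange_poly :: "(nat \<Rightarrow> complex) \<Rightarrow> nat set \<Rightarrow> nat \<Rightarrow> complex poly" where
  "lagrange_poly z I i = Polynomial.smult (1 / (\<Prod>j\<in>I - {i}. z i - z j)) (root_poly z (I - {i}))"

lemma poly_lagrange_poly:
  assumes "finite I" "inj_on z I" "i \<in> I" "j \<in> I"
  shows "poly (lagrange_poly z I i) (z j) = (if i = j then 1 else 0)"
proof (cases "i = j")
  case True
  have "(\<Prod>j\<in>I - {i}. z i - z j) \<noteq> 0" using assms by (auto simp: inj_on_def)
  then show ?thesis using True by (simp add: lagrange_poly_def poly_root_poly)
next
  case False
  then show ?thesis using assms by (auto simp: lagrange_poly_def poly_root_poly)
qed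

lemma coeff_lagrange_poly:
  assumes "finite I" "i \<in> I" "n \<ge> card I" shows "coeff (lagrange_poly z I i) n = 0"
proof -
  have "card (I - {i}) < card I" using assms by (intro psubset_card_mono) auto
  then show ?thesis
    using assms by (simp add: lagrange_poly_def coeff_eq_0 degree_root_poly)
qed

text \<open>A degree below \<open>card I\<close> is expressed by vanishing coefficients, a form that
  includes the zero polynomial and the case \<open>card I = 0\<close>. The same encoding is used for
  all test polynomials below.\<close>

lemma poly_eq_0_by_roots:
  fixes S :: "complex poly" and z :: "nat \<Rightarrow> complex"
  assumes I: "finite I" "inj_on z I" and S: "\<And>n. n \<ge> card I \<Longrightarrow> coeff S n = 0"
    and z: "\<And>i. i \<in> I \<Longrightarrow> poly S (z i) = 0"
  shows "S = 0"
proof (rule ccontr)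
  assume S0: "S \<noteq> 0"
  have "card I = card (z ` I)" using I by (simp add: card_image)
  also have "\<dots> \<le> card {x. poly S x = 0}" using z poly_roots_finite[OF S0] by (intro card_mono) auto
  also have "\<dots> \<le> degree S" using S0 by (rule card_poly_roots_bound)
  finally show False using S[of "degree S"] S0 by simp
qed

text \<open>Degree \<open>card I\<close> is one more than the values on \<open>I\<close> determine;
  the multiple of the node polynomial accounts for the leading coefficient. For a monic denominator
  Q this separates its limit from terms proportional to Q(z_1), ..., Q(z_k).\<close>

lemma lagrange_interpolation:
  fixes S :: "complex poly" and z :: "nat \<Rightarrow> complex"
  assumes I: "finite I" "inj_on z I" and S: "\<And>n. n > card I \<Longrightarrow> coeff S n = 0"
  shows "poly S w = coeff S (card I) * (\<Prod>i\<in>I. w - z i) + (\<Sum>i\<in>I. poly S (z i) * poly (lagrange_poly z I i) w)"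
proof -
  let ?D = "S - Polynomial.smult (coeff S (card I)) (root_poly z I) - (\<Sum>i\<in>I. Polynomial.smult (poly S (z i)) (lagrange_poly z I i))"
  have "?D = 0"
  proof (rule poly_eq_0_by_roots[OF I])
    show "coeff ?D n = 0" if "n \<ge> card I" for n
    proof (cases "n = card I")
      case True
      have "coeff (root_poly z I) (card I) = 1"
        using lead_coeff_root_poly[of z I] degree_root_poly[OF I(1), of z] by simp
      then show ?thesis using I True by (simp add: coeff_sum coeff_lagrange_poly)
    next
      case False
      then show ?thesis using I S[of n] that
        by (simp add: coeff_sum coeff_lagrange_poly coeff_eq_0 degree_root_poly)
    qed
    show "poly ?D (z j) = 0" if "j \<in> I" for j
    proof -
      have "(\<Sum>i\<in>I. poly S (z i) * poly (lagrange_poly z I i) (z j)) = (\<Sum>i\<in>I. if i = j then poly S (z i) else 0)"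
        using I that by (intro sum.cong) (auto simp: poly_lagrange_poly)
      moreover have "(\<Prod>i\<in>I. z j - z i) = 0" using I that by (auto intro!: prod_zero bexI[of _ j])
      ultimately show ?thesis using I that by (simp add: poly_sum poly_root_poly)
    qed
  qed
  then have "poly ?D w = 0" by simp
  then show ?thesis by (simp add: poly_sum poly_root_poly algebra_simps)
qed

section \<open>Linear systems\<close>

text \<open>A square matrix with trivial kernel is invertible, so uniqueness, which the estimates
  deliver, gives existence as well.\<close>

lemma linear_system_solvable:
  fixes u :: "nat \<Rightarrow> nat \<Rightarrow> complex"
  assumes inj: "\<And>c j. (\<And>i. i \<in> {1..k} \<Longrightarrow> (\<Sum>j<k. u i j * c j) = 0) \<Longrightarrow> j < k \<Longrightarrow> c j = 0"
  shows "\<exists>c. \<forall>i\<in>{1..k}. (\<Sum>j<k. u i j * c j) = b i"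
proof -
  define A where "A = Matrix.mat k k (\<lambda>(i, j). u (i + 1) j)"
  have A: "A \<in> carrier_mat k k" by (simp add: A_def)
  have Ax: "vec_index (A *\<^sub>v x) i = (\<Sum>j<k. u (i + 1) j * vec_index x j)" if "x \<in> carrier_vec k" "i < k" for x i
    using that by (simp add: A_def scalar_prod_def atLeast0LessThan)
  have "Determinant.det A \<noteq> 0"
  proof
    assume "Determinant.det A = 0"
    then obtain x where x: "x \<in> carrier_vec k" "x \<noteq> 0\<^sub>v k" "A *\<^sub>v x = 0\<^sub>v k"
      using det_0_iff_vec_prod_zero[OF A] by blast
    have "vec_index x j = 0" if "j < k" for j
    proof (rule inj[of "\<lambda>j. vec_index x j", OF _ that])
      fix i assume "i \<in> {1..k}"
      then show "(\<Sum>j<k. u i j * vec_index x j) = 0" using Ax[OF x(1), of "i - 1"] x(3) by (cases i) auto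
    qed
    then show False using x by auto
  qed
  then obtain Ai where Ai: "Ai \<in> carrier_mat k k" "A * Ai = 1\<^sub>m k"
    using det_non_zero_imp_unit[OF A] unfolding Units_def by (auto simp: ring_mat_def)
  define x where "x = Ai *\<^sub>v Matrix.vec k (\<lambda>i. b (i + 1))"
  have x: "x \<in> carrier_vec k" using Ai by (simp add: x_def)
  have "A *\<^sub>v x = Matrix.vec k (\<lambda>i. b (i + 1))"
    unfolding x_def using A Ai by (subst assoc_mult_mat_vec[symmetric, OF A Ai(1)]) auto
  then have "\<forall>i\<in>{1..k}. (\<Sum>j<k. u i j * vec_index x j) = b i"
  proof (intro ballI)
    fix i assume "A *\<^sub>v x = Matrix.vec k (\<lambda>i. b (i + 1))" "i \<in> {1..k}"
    then show "(\<Sum>j<k. u i j * vec_index x j) = b i" using Ax[OF x, of "i - 1"] by (cases i) auto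
  qed
  then show ?thesis by blast
qed

section \<open>Node polynomials\<close>

lemma node_poly_empty [simp]: "n < m \<Longrightarrow> node_poly \<xi> m n z = 1"
  by (simp add: node_poly_def)

lemma node_poly_Suc: "m \<le> Suc n \<Longrightarrow> node_poly \<xi> m (Suc n) z = node_poly \<xi> m n z * (z - \<xi> (Suc n))"
  by (simp add: node_poly_def)

lemma node_poly_rec: "m \<le> n \<Longrightarrow> node_poly \<xi> m n z = (z - \<xi> m) * node_poly \<xi> (Suc m) n z"
  by (simp add: node_poly_def prod.atLeast_Suc_atMost)

lemma node_poly_split:
  assumes "m \<le> Suc j" "j \<le> n" shows "node_poly \<xi> m n z = node_poly \<xi> m j z * node_poly \<xi> (Suc j) n z"
  using assms(2,1)
proof (induction n rule: dec_induct)
  case (step n)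
  then show ?case by (simp add: node_poly_Suc)
qed simp

lemma node_poly_eq_0_iff: "node_poly \<xi> m n z = 0 \<longleftrightarrow> z \<in> \<xi> ` {m..n}"
  by (auto simp: node_poly_def)

lemma continuous_on_node_poly [continuous_intros]: "continuous_on S (node_poly \<xi> m n)"
  unfolding node_poly_def by (intro continuous_intros)

lemma node_poly_eq_root_poly: "node_poly \<xi> m n z = poly (root_poly \<xi> {m..n}) z"
  by (simp add: node_poly_def poly_root_poly)

section \<open>The interpolant of a Cauchy transform\<close>

text \<open>With x and y the factors of the first and the last node and P the product over the nodes
  between, this is the recursion of divided differences for the kernel 1 / (w - z).\<close>

lemma divided_difference_identity:
  fixes x y P :: complex
  assumes "x \<noteq> 0" "y \<noteq> 0" "x \<noteq> y" "P \<noteq> 0"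
  shows "inverse (x - y) * (1 / (P * y) - 1 / (x * P)) = 1 / (x * P * y)"
proof -
  have "1 / (P * y) - 1 / (x * P) = (x - y) / (x * P * y)" using assms by (simp add: field_simps)
  then show ?thesis using assms by simp
qed

text \<open>One step of Newton interpolation for the kernel: x = w - z, y is the factor of the new
  node, P the product over the earlier ones.\<close>

lemma reciprocal_difference_identity:
  fixes x y P :: complex
  assumes "x \<noteq> 0" "y \<noteq> 0" "P \<noteq> 0"
  shows "1 / (x * P) - 1 / (P * y) = (y - x) * (1 / (x * (P * y)))"
  using assms by (simp add: field_simps)

text \<open>\<open>U\<close> is the region in which the nodes will eventually lie, and
  \<open>L\<close> carries both the contour and the poles. There is one functional per component, so
  that vectors enter only through \<open>$ i\<close>.\<close>

locale cauchy_transform =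
  fixes F :: "complex \<Rightarrow> complex ^ 'n" and J :: "'n \<Rightarrow> (complex \<Rightarrow> complex) \<Rightarrow> complex" and L U :: "complex set"
  assumes functional: "\<And>i. bounded_functional L (J i)" and compact: "compact L"
    and U: "open U" "U \<inter> L = {}"
    and transform: "\<And>z i. z \<in> U \<Longrightarrow> F z $ i = J i (\<lambda>w. 1 / (w - z))"
begin

lemma off: "z \<in> U \<Longrightarrow> w \<in> L \<Longrightarrow> w \<noteq> z"
  using U by blast

lemma node_poly_nonzero:
  assumes "\<xi> ` {m..n} \<subseteq> U" "w \<in> L" shows "node_poly \<xi> m n w \<noteq> 0"
  using assms U by (auto simp: node_poly_eq_0_iff)

text \<open>As a function of z, 1 / (w - z) has the divided difference 1 / \<psi>(w), and
  \<open>J\<close> commutes with both defining rules: with difference quotients by linearity, with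
  Taylor coefficients by \<open>Cauchy_transform_higher_deriv\<close>.\<close>

lemma hermite_dd_eq:
  assumes "\<xi> ` {m..m + d} \<subseteq> U"
    and "\<And>a b c. m \<le> a \<Longrightarrow> a \<le> b \<Longrightarrow> b \<le> c \<Longrightarrow> c \<le> m + d \<Longrightarrow> \<xi> a = \<xi> c \<Longrightarrow> \<xi> b = \<xi> a"
  shows "hermite_dd F \<xi> m d $ i = J i (\<lambda>w. 1 / node_poly \<xi> m (m + d) w)"
  using assms
proof (induction d arbitrary: m)
  case 0
  then show ?case by (simp add: transform node_poly_def)
next
  case (Suc d)
  show ?case
  proof (cases "\<xi> (m + Suc d) = \<xi> m")
    case True
    \<comment> \<open>Equal end points force all nodes in between to coincide, so the node
      polynomial is a pure power.\<close>
    have same: "\<xi> r = \<xi> m" if "r \<in> {m..m + Suc d}" for r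
      using Suc.prems(2)[of m r "m + Suc d"] that True by auto
    have np: "node_poly \<xi> m (m + Suc d) w = (w - \<xi> m) ^ Suc (Suc d)" for w
    proof -
      have "node_poly \<xi> m (m + Suc d) w = (\<Prod>r\<in>{m..m + Suc d}. w - \<xi> m)"
        unfolding node_poly_def by (intro prod.cong refl) (simp only: same)
      also have "\<dots> = (w - \<xi> m) ^ card {m..m + Suc d}" by (rule prod_constant)
      also have "card {m..m + Suc d} = Suc (Suc d)" by simp
      finally show ?thesis .
    qed
    have "\<xi> m \<in> U" using Suc.prems(1) by auto
    from Cauchy_transform_higher_deriv[where J="J i" and f="\<lambda>z. F z $ i" and n="Suc d",
        OF functional compact U transform[where i=i] this]
    show ?thesis using True unfolding hermite_dd.simps np by simp
  next
    case False
    have n1: "\<xi> ` {Suc m..Suc m + d} \<subseteq> U" "\<xi> ` {m..m + d} \<subseteq> U" "\<xi> ` {m..m + Suc d} \<subseteq> U"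
      using Suc.prems(1) by auto
    have IH: "hermite_dd F \<xi> (Suc m) d $ i = J i (\<lambda>w. 1 / node_poly \<xi> (Suc m) (Suc m + d) w)"
      "hermite_dd F \<xi> m d $ i = J i (\<lambda>w. 1 / node_poly \<xi> m (m + d) w)"
      by (rule Suc.IH[OF n1(1)], rule Suc.prems(2); simp)
         (rule Suc.IH[OF n1(2)], rule Suc.prems(2); simp)
    have cont: "continuous_on L (\<lambda>w. 1 / node_poly \<xi> (Suc m) (Suc m + d) w)"
      "continuous_on L (\<lambda>w. 1 / node_poly \<xi> m (m + d) w)"
      "continuous_on L (\<lambda>w. 1 / node_poly \<xi> m (m + Suc d) w)"
      using n1[THEN node_poly_nonzero] by (auto intro!: continuous_intros simp del: add_Suc_right add_Suc)
    let ?c = "inverse (\<xi> (m + Suc d) - \<xi> m)"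
    have "hermite_dd F \<xi> m (Suc d) $ i = ?c * (J i (\<lambda>w. 1 / node_poly \<xi> (Suc m) (Suc m + d) w) - J i (\<lambda>w. 1 / node_poly \<xi> m (m + d) w))"
      using False IH by (simp add: right_diff_distrib)
    also have "\<dots> = J i (\<lambda>w. ?c * (1 / node_poly \<xi> (Suc m) (Suc m + d) w - 1 / node_poly \<xi> m (m + d) w))"
      by (subst bounded_functional_scale[OF functional], intro continuous_on_diff cont,
          subst bounded_functional_diff[OF functional cont(1,2)]) (rule refl)
    also have "\<dots> = J i (\<lambda>w. 1 / node_poly \<xi> m (m + Suc d) w)"
    proof (rule bounded_functional_cong[OF functional])
      fix w assume w: "w \<in> L"
      have nz: "node_poly \<xi> (Suc m) (m + d) w \<noteq> 0" "w \<noteq> \<xi> m" "w \<noteq> \<xi> (m + Suc d)"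
        using node_poly_nonzero[OF _ w, of \<xi> "Suc m" "m + d"] Suc.prems(1) off[OF _ w] by fastforce+
      have e: "node_poly \<xi> (Suc m) (Suc m + d) w = node_poly \<xi> (Suc m) (m + d) w * (w - \<xi> (m + Suc d))"
        "node_poly \<xi> m (m + d) w = (w - \<xi> m) * node_poly \<xi> (Suc m) (m + d) w"
        "node_poly \<xi> m (m + Suc d) w = (w - \<xi> m) * node_poly \<xi> (Suc m) (m + d) w * (w - \<xi> (m + Suc d))"
        using node_poly_Suc[of "Suc m" "m + d" \<xi> w] node_poly_rec[of m "m + d" \<xi> w] node_poly_rec[of m "m + Suc d" \<xi> w]
        by simp_all
      show "?c * (1 / node_poly \<xi> (Suc m) (Suc m + d) w - 1 / node_poly \<xi> m (m + d) w) = 1 / node_poly \<xi> m (m + Suc d) w"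
        unfolding e using divided_difference_identity[of "w - \<xi> m" "w - \<xi> (m + Suc d)"] nz False by simp
    qed (use cont in \<open>auto intro!: continuous_intros simp del: add_Suc_right add_Suc\<close>)
    finally show ?thesis .
  qed
qed

lemma div_diff_eq:
  assumes "1 \<le> m" "m \<le> n" "n \<le> N" "\<xi> ` {1..N} \<subseteq> U" "equal_points_consecutive N \<xi>"
  shows "div_diff F \<xi> m n $ i = J i (\<lambda>w. 1 / node_poly \<xi> m n w)"
proof -
  have "hermite_dd F \<xi> m (n - m) $ i = J i (\<lambda>w. 1 / node_poly \<xi> m (m + (n - m)) w)"
  proof (rule hermite_dd_eq)
    show "\<xi> ` {m..m + (n - m)} \<subseteq> U" using assms by auto
    show "\<xi> b = \<xi> a" if "m \<le> a" "a \<le> b" "b \<le> c" "c \<le> m + (n - m)" "\<xi> a = \<xi> c" for a b c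
      using assms(5)[unfolded equal_points_consecutive_def, rule_format, of a b c] that assms(1-3) by auto
  qed
  then show ?thesis using assms by (simp add: div_diff_def)
qed

lemma interpolation_error:
  assumes "1 \<le> m" "m \<le> Suc n" "n \<le> N" "\<xi> ` {1..N} \<subseteq> U" "equal_points_consecutive N \<xi>" "z \<in> U"
  shows "F z $ i - hermite_interpolant F \<xi> m n z $ i =
    node_poly \<xi> m n z * J i (\<lambda>w. 1 / ((w - z) * node_poly \<xi> m n w))"
proof -
  have "F z $ i - hermite_interpolant F \<xi> m (m + d - 1) z $ i =
    node_poly \<xi> m (m + d - 1) z * J i (\<lambda>w. 1 / ((w - z) * node_poly \<xi> m (m + d - 1) w))"
    if "m + d - 1 \<le> N" for d using that
proof (induction d)
  case 0
  then have "m - 1 < m" "{m..m - 1} = {}" using assms by auto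
  then show ?case using assms by (simp add: hermite_interpolant_def transform)
next
  case (Suc d)
  define n' where "n' = m + d - 1"
  have n': "m + d = Suc n'" "m + Suc d - 1 = Suc n'" "m \<le> Suc n'" "Suc n' \<le> N"
    using assms(1) Suc.prems by (auto simp: n'_def)
  have IH: "F z $ i - hermite_interpolant F \<xi> m n' z $ i =
    node_poly \<xi> m n' z * J i (\<lambda>w. 1 / ((w - z) * node_poly \<xi> m n' w))"
    using Suc unfolding n'_def by simp
  have ne: "w - z \<noteq> 0" "node_poly \<xi> m n' w \<noteq> 0" "node_poly \<xi> m (Suc n') w \<noteq> 0" if "w \<in> L" for w
    using off[OF assms(6) that] node_poly_nonzero[OF _ that, of \<xi> m n'] node_poly_nonzero[OF _ that, of \<xi> m "Suc n'"]
      image_mono[of "{m..n'}" "{1..N}" \<xi>] image_mono[of "{m..Suc n'}" "{1..N}" \<xi>] assms(1,4) n' by auto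
  have "hermite_interpolant F \<xi> m (Suc n') z $ i = hermite_interpolant F \<xi> m n' z $ i + node_poly \<xi> m n' z * div_diff F \<xi> m (Suc n') $ i"
    using n' by (simp add: hermite_interpolant_def)
  also have "div_diff F \<xi> m (Suc n') $ i = J i (\<lambda>w. 1 / node_poly \<xi> m (Suc n') w)"
    using assms n' by (intro div_diff_eq[where N=N]) auto
  finally have "F z $ i - hermite_interpolant F \<xi> m (Suc n') z $ i =
    node_poly \<xi> m n' z * (J i (\<lambda>w. 1 / ((w - z) * node_poly \<xi> m n' w)) - J i (\<lambda>w. 1 / node_poly \<xi> m (Suc n') w))"
    using IH by (simp add: algebra_simps)
  also have "J i (\<lambda>w. 1 / ((w - z) * node_poly \<xi> m n' w)) - J i (\<lambda>w. 1 / node_poly \<xi> m (Suc n') w)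
     = J i (\<lambda>w. 1 / ((w - z) * node_poly \<xi> m n' w) - 1 / node_poly \<xi> m (Suc n') w)"
    using ne by (subst bounded_functional_diff[OF functional]) (auto intro!: continuous_intros)
  also have "\<dots> = J i (\<lambda>w. (z - \<xi> (Suc n')) * (1 / ((w - z) * node_poly \<xi> m (Suc n') w)))"
  proof (rule bounded_functional_cong[OF functional])
    fix w assume w: "w \<in> L"
    have e: "node_poly \<xi> m (Suc n') w = node_poly \<xi> m n' w * (w - \<xi> (Suc n'))"
      using n' by (simp add: node_poly_Suc)
    show "1 / ((w - z) * node_poly \<xi> m n' w) - 1 / node_poly \<xi> m (Suc n') w = (z - \<xi> (Suc n')) * (1 / ((w - z) * node_poly \<xi> m (Suc n') w))"
      using ne[OF w] unfolding e
      using reciprocal_difference_identity[of "w - z" "w - \<xi> (Suc n')" "node_poly \<xi> m n' w"] by simp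
  qed (use ne in \<open>auto intro!: continuous_intros\<close>)
  also have "\<dots> = (z - \<xi> (Suc n')) * J i (\<lambda>w. 1 / ((w - z) * node_poly \<xi> m (Suc n') w))"
    using ne by (intro bounded_functional_scale[OF functional] continuous_intros) auto
  finally show ?case using n' by (simp add: node_poly_Suc)
qed
  from this[of "Suc n - m"] show ?thesis using assms by simp
qed

lemma continuous_on_itea_denominator [continuous_intros]: "continuous_on S (itea_denominator \<xi> k c)"
  unfolding itea_denominator_def by (intro continuous_intros)

text \<open>Each summand has an error with the factor \<psi>_{1,j}(z) \<psi>_{j+1,p}(z) =
  \<psi>_{1,p}(z), which therefore comes out of the sum, and under \<open>J\<close> the fractions
  c_j / \<psi>_{j+1,p}(w) add up to Q(w) / \<psi>_{1,p}(w). The identity holds for any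
  \<open>c\<close>.\<close>

lemma itea_error:
  assumes "k \<le> p" "p \<le> N" "\<xi> ` {1..N} \<subseteq> U" "equal_points_consecutive N \<xi>" "z \<in> U"
  shows "itea_denominator \<xi> k c z * F z $ i - itea_numerator F \<xi> p k c z $ i =
    node_poly \<xi> 1 p z * J i (\<lambda>w. itea_denominator \<xi> k c w / ((w - z) * node_poly \<xi> 1 p w))"
proof -
  have ne1: "w - z \<noteq> 0" if "w \<in> L" for w
    using off[OF assms(5) that] by simp
  have ne2: "node_poly \<xi> m n w \<noteq> 0" if "w \<in> L" "1 \<le> m" "n \<le> N" for w m n
    using node_poly_nonzero[OF _ that(1), of \<xi> m n] assms(3) that by (auto simp: image_subset_iff)
  note ne = ne1 ne2
  have "itea_denominator \<xi> k c z * F z $ i - itea_numerator F \<xi> p k c z $ i =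
    (\<Sum>j=0..k. c j * node_poly \<xi> 1 j z * (F z $ i - hermite_interpolant F \<xi> (j + 1) p z $ i))"
    by (simp add: itea_denominator_def itea_numerator_def sum_distrib_right right_diff_distrib sum_subtractf)
  also have "\<dots> = (\<Sum>j=0..k. node_poly \<xi> 1 p z * J i (\<lambda>w. c j * (1 / ((w - z) * node_poly \<xi> (j + 1) p w))))"
  proof (rule sum.cong[OF refl])
    fix j assume j: "j \<in> {0..k}"
    have "J i (\<lambda>w. c j * (1 / ((w - z) * node_poly \<xi> (j + 1) p w))) = c j * J i (\<lambda>w. 1 / ((w - z) * node_poly \<xi> (j + 1) p w))"
      using ne assms j by (intro bounded_functional_scale[OF functional] continuous_intros) auto
    moreover have "F z $ i - hermite_interpolant F \<xi> (j + 1) p z $ i =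
       node_poly \<xi> (j + 1) p z * J i (\<lambda>w. 1 / ((w - z) * node_poly \<xi> (j + 1) p w))"
      using assms j by (intro interpolation_error[where N=N]) auto
    moreover have "node_poly \<xi> 1 p z = node_poly \<xi> 1 j z * node_poly \<xi> (j + 1) p z"
      using node_poly_split[of 1 j p] assms j by simp
    ultimately show "c j * node_poly \<xi> 1 j z * (F z $ i - hermite_interpolant F \<xi> (j + 1) p z $ i)
       = node_poly \<xi> 1 p z * J i (\<lambda>w. c j * (1 / ((w - z) * node_poly \<xi> (j + 1) p w)))"
      by (simp add: mult_ac)
  qed
  also have "\<dots> = node_poly \<xi> 1 p z * J i (\<lambda>w. \<Sum>j=0..k. c j * (1 / ((w - z) * node_poly \<xi> (j + 1) p w)))"
    unfolding sum_distrib_left[symmetric] using ne assms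
    by (subst bounded_functional_sum[OF functional]) (auto intro!: continuous_intros)
  also have "J i (\<lambda>w. \<Sum>j=0..k. c j * (1 / ((w - z) * node_poly \<xi> (j + 1) p w))) =
     J i (\<lambda>w. itea_denominator \<xi> k c w / ((w - z) * node_poly \<xi> 1 p w))"
  proof (rule bounded_functional_cong[OF functional])
    fix w assume w: "w \<in> L"
    show "(\<Sum>j=0..k. c j * (1 / ((w - z) * node_poly \<xi> (j + 1) p w))) = itea_denominator \<xi> k c w / ((w - z) * node_poly \<xi> 1 p w)"
      unfolding itea_denominator_def sum_divide_distrib
    proof (rule sum.cong[OF refl])
      fix j assume j: "j \<in> {0..k}"
      have e: "node_poly \<xi> 1 p w = node_poly \<xi> 1 j w * node_poly \<xi> (j + 1) p w"
        using node_poly_split[of 1 j p] assms j by simp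
      show "c j * (1 / ((w - z) * node_poly \<xi> (j + 1) p w)) = c j * node_poly \<xi> 1 j w / ((w - z) * node_poly \<xi> 1 p w)"
        unfolding e using ne2[OF w, of 1 j] assms j by simp
    qed
  qed (use ne assms in \<open>auto intro!: continuous_intros\<close>)
  finally show ?thesis .
qed

text \<open>The factorisation \<Psi>_p = \<psi>_{1,j} \<psi>_{j+1,p+i} \<psi>_{p+i+1,p+k} puts all
  the divided differences over one denominator; what i contributes is the product over the last k -
  i nodes, a polynomial of degree k - i.\<close>

lemma itea_u_sum:
  assumes "k \<le> p" "i \<in> {1..k}" "\<xi> ` {1..p + k} \<subseteq> U" "equal_points_consecutive (p + k) \<xi>"
    and ip: "\<And>x :: complex ^ 'n. ip q x = (\<Sum>i\<in>UNIV. \<omega> i * x $ i)"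
  defines "W \<equiv> \<lambda>g. \<Sum>i\<in>UNIV. \<omega> i * J i g"
  shows "(\<Sum>j=0..k. itea_u ip q F \<xi> p i j * c j) =
    W (\<lambda>w. itea_denominator \<xi> k c w * node_poly \<xi> (p + i + 1) (p + k) w / node_poly \<xi> 1 (p + k) w)"
proof -
  have W: "bounded_functional L W"
    unfolding W_def by (rule bounded_functional_combination) (auto intro: functional)
  have ne: "node_poly \<xi> m n w \<noteq> 0" if "w \<in> L" "1 \<le> m" "n \<le> p + k" for w m n
    using node_poly_nonzero[OF _ that(1), of \<xi> m n] assms(3) that by (auto simp: image_subset_iff)
  have u: "itea_u ip q F \<xi> p i j = W (\<lambda>w. 1 / node_poly \<xi> (j + 1) (p + i) w)" if "j \<le> k" for j
    using assms that by (simp add: itea_u_def ip W_def div_diff_eq[where N="p + k"])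
  have "(\<Sum>j=0..k. itea_u ip q F \<xi> p i j * c j) = (\<Sum>j=0..k. W (\<lambda>w. c j * (1 / node_poly \<xi> (j + 1) (p + i) w)))"
    using ne assms(1,2) u
    by (intro sum.cong refl, subst bounded_functional_scale[OF W]) (auto intro!: continuous_intros)
  also have "\<dots> = W (\<lambda>w. \<Sum>j=0..k. c j * (1 / node_poly \<xi> (j + 1) (p + i) w))"
    using ne assms(1,2) by (subst bounded_functional_sum[OF W]) (auto intro!: continuous_intros)
  also have "\<dots> = W (\<lambda>w. itea_denominator \<xi> k c w * node_poly \<xi> (p + i + 1) (p + k) w / node_poly \<xi> 1 (p + k) w)"
  proof (rule bounded_functional_cong[OF W])
    fix w assume w: "w \<in> L"
    show "(\<Sum>j=0..k. c j * (1 / node_poly \<xi> (j + 1) (p + i) w)) =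
      itea_denominator \<xi> k c w * node_poly \<xi> (p + i + 1) (p + k) w / node_poly \<xi> 1 (p + k) w"
      unfolding itea_denominator_def sum_distrib_right sum_divide_distrib
    proof (rule sum.cong[OF refl])
      fix j assume j: "j \<in> {0..k}"
      have e: "node_poly \<xi> 1 (p + k) w = node_poly \<xi> 1 j w * (node_poly \<xi> (j + 1) (p + i) w * node_poly \<xi> (p + i + 1) (p + k) w)"
        using node_poly_split[of 1 j "p + k" \<xi> w] node_poly_split[of "j + 1" "p + i" "p + k" \<xi> w] assms(1,2) j by simp
      show "c j * (1 / node_poly \<xi> (j + 1) (p + i) w) =
        c j * node_poly \<xi> 1 j w * node_poly \<xi> (p + i + 1) (p + k) w / node_poly \<xi> 1 (p + k) w"
        unfolding e using ne[OF w, of 1 j] ne[OF w, of "p + i + 1" "p + k"] assms(1,2) j by simp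
    qed
  qed (use ne assms(1,2) in \<open>auto intro!: continuous_intros\<close>)
  finally show ?thesis .
qed

text \<open>
  The equations for \<open>c\<close> say that \<open>W\<close> with weight \<open>1 / \<Psi>\<close> annihilates the products of the denominator
  with the polynomials of degree below \<open>k\<close>.
\<close>

lemma itea_orthogonality:
  assumes "k \<le> p" "\<xi> ` {1..p + k} \<subseteq> U" "equal_points_consecutive (p + k) \<xi>"
    and ip: "\<And>x :: complex ^ 'n. ip q x = (\<Sum>i\<in>UNIV. \<omega> i * x $ i)"
    and eq: "\<And>i. i \<in> {1..k} \<Longrightarrow> (\<Sum>j=0..k. itea_u ip q F \<xi> p i j * c j) = 0"
    and S: "\<And>n. n \<ge> k \<Longrightarrow> coeff S n = 0"
  defines "W \<equiv> \<lambda>g. \<Sum>i\<in>UNIV. \<omega> i * J i g"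
  shows "W (\<lambda>w. itea_denominator \<xi> k c w * poly S w / node_poly \<xi> 1 (p + k) w) = 0"
proof -
  have W: "bounded_functional L W"
    unfolding W_def by (rule bounded_functional_combination) (auto intro: functional)
  define N where "N = p + k"
  have ne: "node_poly \<xi> 1 N w \<noteq> 0" if "w \<in> L" for w
    using node_poly_nonzero[OF assms(2) that] by (simp add: N_def)
  \<comment> \<open>The products over the last j nodes, j < k, supply one polynomial for each degree
    below k; the one of degree j belongs to the equation i = k - j.\<close>
  have "\<exists>a. S = (\<Sum>j<k. Polynomial.smult (a j) (root_poly \<xi> {N - j + 1..N}))"
    by (rule monic_basis_span[OF root_poly_monic S]) (auto simp: N_def)
  then obtain a where "S = (\<Sum>j<k. Polynomial.smult (a j) (root_poly \<xi> {N - j + 1..N}))"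
    by (elim exE)
  then have a: "poly S w = (\<Sum>j<k. a j * node_poly \<xi> (N - j + 1) N w)" for w
    by (simp add: poly_sum node_poly_eq_root_poly)
  have cont: "continuous_on L (\<lambda>w. itea_denominator \<xi> k c w * node_poly \<xi> m n w / node_poly \<xi> 1 N w)" for m n
    using ne by (auto intro!: continuous_intros)
  have "W (\<lambda>w. itea_denominator \<xi> k c w * poly S w / node_poly \<xi> 1 N w) =
    W (\<lambda>w. \<Sum>j<k. a j * (itea_denominator \<xi> k c w * node_poly \<xi> (N - j + 1) N w / node_poly \<xi> 1 N w))"
    by (simp add: a sum_distrib_left sum_divide_distrib mult_ac)
  also have "\<dots> = (\<Sum>j<k. a j * W (\<lambda>w. itea_denominator \<xi> k c w * node_poly \<xi> (N - j + 1) N w / node_poly \<xi> 1 N w))"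
    by (subst bounded_functional_sum[OF W]) (intro sum.cong refl bounded_functional_scale[OF W] continuous_on_mult_left cont finite_lessThan)+
  also have "\<dots> = 0"
  proof (intro sum.neutral ballI)
    fix j assume j: "j \<in> {..<k}"
    have "(\<Sum>l=0..k. itea_u ip q F \<xi> p (k - j) l * c l) =
      W (\<lambda>w. itea_denominator \<xi> k c w * node_poly \<xi> (p + (k - j) + 1) (p + k) w / node_poly \<xi> 1 (p + k) w)"
      unfolding W_def by (rule itea_u_sum) (use assms j in auto)
    moreover have "p + (k - j) + 1 = N - j + 1" "p + k = N" using j by (auto simp: N_def)
    ultimately show "a j * W (\<lambda>w. itea_denominator \<xi> k c w * node_poly \<xi> (N - j + 1) N w / node_poly \<xi> 1 N w) = 0"
      using eq[of "k - j"] j by simp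
  qed
  finally show ?thesis by (simp add: N_def)
qed

lemma itea_denominator_poly:
  "itea_denominator \<xi> k c w = poly (\<Sum>j\<le>k. Polynomial.smult (c j) (root_poly \<xi> {1..j})) w"
  by (simp add: itea_denominator_def poly_sum node_poly_eq_root_poly atMost_atLeast0)

text \<open>In the Newton form only the last term reaches degree k, so c_k is the leading
  coefficient.\<close>

lemma coeff_itea_denominator_poly:
  assumes "n \<ge> k"
  shows "coeff (\<Sum>j\<le>k. Polynomial.smult (c j) (root_poly \<xi> {1..j})) n = (if n = k then c k else 0)"
proof -
  have 1: "coeff (root_poly \<xi> {1..j}) j = 1" for j
    using lead_coeff_root_poly[of \<xi> "{1..j}"] by (simp add: degree_root_poly)
  have 2: "coeff (root_poly \<xi> {1..j}) n = 0" if "j < n" for j n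
    using that by (simp add: coeff_eq_0 degree_root_poly)
  have "coeff (\<Sum>j\<le>k. Polynomial.smult (c j) (root_poly \<xi> {1..j})) n = (\<Sum>j\<le>k. if j = n then c k else 0)"
    unfolding coeff_sum using assms 1 2 by (intro sum.cong) auto
  then show ?thesis using assms by auto
qed

text \<open>With c_k = 0 the denominator has degree below k, so k distinct zeros make it vanish
  identically, and independence of the Newton basis gives back the coefficients.\<close>

lemma itea_denominator_eq_0_imp:
  assumes I: "inj_on z {1..k}" and c: "c k = 0"
    and z: "\<And>i. i \<in> {1..k} \<Longrightarrow> itea_denominator \<xi> k c (z i) = 0" and j: "j < k"
  shows "c j = 0"
proof -
  let ?P = "\<Sum>j\<le>k. Polynomial.smult (c j) (root_poly \<xi> {1..j})"
  have "?P = 0"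
  proof (rule poly_eq_0_by_roots[of "{1..k}" z])
    show "coeff ?P n = 0" if "n \<ge> card {1..k}" for n
      using coeff_itea_denominator_poly[of k n c \<xi>] that c by simp
    show "poly ?P (z i) = 0" if "i \<in> {1..k}" for i
      using z[OF that] unfolding itea_denominator_poly .
  qed (use I in auto)
  then have "(\<Sum>j<k. Polynomial.smult (c j) (root_poly \<xi> {1..j})) = 0"
    unfolding lessThan_Suc_atMost[symmetric] sum.lessThan_Suc c by simp
  then show ?thesis
    by (intro monic_basis_independent[where k=k and b="\<lambda>j. root_poly \<xi> {1..j}" and a=c] j root_poly_monic) auto
qed

end

section \<open>Point masses, bounds on compact sets, vector norms\<close>

lemma bounded_functional_minus:
  assumes "bounded_functional L \<Lambda>1" "bounded_functional L \<Lambda>2"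
  shows "bounded_functional L (\<lambda>g. \<Lambda>1 g - \<Lambda>2 g)"
proof -
  have "bounded_functional L (\<lambda>g. \<Sum>b\<in>UNIV. (if b then 1 else -1) * (if b then \<Lambda>1 else \<Lambda>2) g)"
    by (rule bounded_functional_combination) (use assms in auto)
  then show ?thesis by (simp add: UNIV_bool)
qed

text \<open>The minus sign is that of a pole: v_s / (z - z_s) is the Cauchy transform of the mass
  -v_s at z_s.\<close>

lemma bounded_functional_minus_point_masses:
  assumes "bounded_functional L \<Lambda>" "finite S"
  shows "bounded_functional (L \<union> zs ` S) (\<lambda>g. \<Lambda> g - (\<Sum>s\<in>S. a s * g (zs s)))"
  using assms
  by (intro bounded_functional_minus bounded_functional_combination bounded_functional_eval)
     (auto intro: bounded_functional_mono)

lemma continuous_on_compact_bound: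
  fixes f :: "complex \<Rightarrow> complex"
  assumes "continuous_on C f" "compact C"
  shows "\<exists>B\<ge>0. \<forall>x\<in>C. cmod (f x) \<le> B"
proof -
  have "bounded (f ` C)" using assms compact_continuous_image compact_imp_bounded by blast
  then obtain B where "\<forall>x\<in>C. cmod (f x) \<le> B" unfolding bounded_iff by auto
  then show ?thesis by (intro exI[of _ "max B 0"]) auto
qed

lemma node_poly_bound:
  assumes "\<And>r. r \<in> {m..n} \<Longrightarrow> cmod (\<xi> r) \<le> B" "cmod w \<le> R" "B \<ge> 0"
  shows "cmod (node_poly \<xi> m n w) \<le> (R + B) ^ card {m..n}"
proof -
  have "cmod (node_poly \<xi> m n w) = (\<Prod>r=m..n. cmod (w - \<xi> r))" by (simp add: node_poly_def prod_norm)
  also have "\<dots> \<le> (\<Prod>r=m..n. R + B)"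
  proof (intro prod_mono conjI)
    fix r assume "r \<in> {m..n}"
    then show "cmod (w - \<xi> r) \<le> R + B" using assms(1)[of r] assms(2) norm_triangle_ineq4[of w "\<xi> r"] by auto
  qed auto
  finally show ?thesis by simp
qed

text \<open>Estimates are made per component; this carries them over to an arbitrary norm.\<close>

lemma vector_norm_le:
  fixes x :: "complex ^ 'n"
  assumes "is_vector_norm nrm"
  shows "nrm x \<le> (\<Sum>i\<in>UNIV. cmod (x $ i) * nrm (axis i 1))"
proof -
  have sum: "nrm (\<Sum>i\<in>A. f i) \<le> (\<Sum>i\<in>A. nrm (f i))" if "finite A" for A and f :: "'n \<Rightarrow> complex ^ 'n"
    using that
  proof (induction A rule: finite_induct)
    case empty
    have "nrm 0 = 0" using assms unfolding is_vector_norm_def by blast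
    then show ?case by simp
  next
    case (insert a A)
    have "nrm (f a + (\<Sum>i\<in>A. f i)) \<le> nrm (f a) + nrm (\<Sum>i\<in>A. f i)"
      using assms unfolding is_vector_norm_def by blast
    then show ?case using insert by simp
  qed
  have "x = (\<Sum>i\<in>UNIV. x $ i *s axis i 1)"
    by (simp add: basis_expansion)
  then have "nrm x \<le> (\<Sum>i\<in>UNIV. nrm (x $ i *s axis i 1))" using sum[of UNIV "\<lambda>i. x $ i *s axis i 1"] by simp
  then show ?thesis using assms by (simp add: is_vector_norm_def)
qed

section \<open>The determinants\<close>

lemma alpha_root_poly:
  "i \<in> {1..k} \<Longrightarrow> alpha ip q v zs \<xi> p k i s = ip q (v s) * poly (root_poly \<xi> {p + i + 1..p + k}) (zs s)"
  by (simp add: alpha_def node_poly_eq_root_poly)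

lemma coeff_tail_poly:
  "i \<in> {1..k} \<Longrightarrow> n \<ge> k \<Longrightarrow> coeff (root_poly \<xi> {p + i + 1..p + k}) n = 0"
  by (rule coeff_eq_0) (auto simp: degree_root_poly)

text \<open>A vector in the kernel of the transpose lists the coefficients of a polynomial of degree
  below k in the basis of products over the last nodes. As all (q, v_l) are nonzero, that polynomial
  vanishes at z_1, ..., z_k and hence is 0. This works for every p and every choice of
  nodes.\<close>

lemma itea_T_nonzero:
  assumes inj: "inj_on zs {1..k}" and qv: "\<And>i. i \<in> {1..k} \<Longrightarrow> ip q (v i) \<noteq> 0"
  shows "itea_T ip q v zs \<xi> p k (\<lambda>j. j) \<noteq> 0"
proof
  let ?A = "Matrix.mat k k (\<lambda>(i, j). alpha ip q v zs \<xi> p k (i + 1) (j + 1))"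
  have A: "?A \<in> carrier_mat k k" by simp
  assume "itea_T ip q v zs \<xi> p k (\<lambda>j. j) = 0"
  then have "Determinant.det (transpose_mat ?A) = 0"
    unfolding itea_T_def det_transpose[OF A] .
  then obtain x where x: "x \<in> carrier_vec k" "x \<noteq> 0\<^sub>v k" "transpose_mat ?A *\<^sub>v x = 0\<^sub>v k"
    using det_0_iff_vec_prod_zero[of "transpose_mat ?A" k] A by auto
  \<comment> \<open>Row i of the matrix, counted from 0, carries the product over the last k - 1 - i
    nodes, so sorting by degree reverses the coordinates of \<open>x\<close>.\<close>
  let ?b = "\<lambda>j. root_poly \<xi> {p + k - j + 1..p + k}"
  let ?S = "\<Sum>j<k. Polynomial.smult (vec_index x (k - 1 - j)) (?b j)"
  have "?S = 0"
  proof (rule poly_eq_0_by_roots[of "{1..k}" zs])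
    show "coeff ?S n = 0" if "n \<ge> card {1..k}" for n
    proof -
      have "coeff (?b j) n = 0" if "j < k" for j
        by (rule coeff_eq_0) (use \<open>n \<ge> card {1..k}\<close> that in \<open>auto simp: degree_root_poly\<close>)
      then show ?thesis by (simp add: coeff_sum)
    qed
    show "poly ?S (zs l) = 0" if l: "l \<in> {1..k}" for l
    proof -
      have "0 = vec_index (transpose_mat ?A *\<^sub>v x) (l - 1)" using x l by auto
      also have "\<dots> = (\<Sum>i<k. alpha ip q v zs \<xi> p k (i + 1) l * vec_index x i)"
        using l x(1) by (auto simp: scalar_prod_def atLeast0LessThan)
      also have "\<dots> = (\<Sum>j<k. alpha ip q v zs \<xi> p k (k - j) l * vec_index x (k - 1 - j))"
        by (subst sum.nat_diff_reindex[symmetric]) (intro sum.cong, auto simp: Suc_diff_Suc)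
      also have "\<dots> = ip q (v l) * poly ?S (zs l)"
        unfolding poly_sum sum_distrib_left
      proof (rule sum.cong[OF refl])
        fix j assume "j \<in> {..<k}"
        then show "alpha ip q v zs \<xi> p k (k - j) l * vec_index x (k - 1 - j) =
          ip q (v l) * poly (Polynomial.smult (vec_index x (k - 1 - j)) (?b j)) (zs l)"
          by (subst alpha_root_poly) (auto simp: mult_ac)
      qed
      finally show ?thesis using qv[OF l] by simp
    qed
  qed (use inj in auto)
  have x0: "vec_index x (k - 1 - j) = 0" if "j < k" for j
    by (rule monic_basis_independent[where b="?b" and k=k and a="\<lambda>j. vec_index x (k - 1 - j)" and j=j])
       (use \<open>?S = 0\<close> that in \<open>auto intro!: root_poly_monic simp del: One_nat_def\<close>)
  have "vec_index x i = 0" if "i < k" for i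
    using x0[of "k - 1 - i"] that by simp
  then show False using x(1,2) by auto
qed

text \<open>A row of \<open>\<alpha>\<close>'s put on top of the rows \<open>1, \<dots>, k\<close> occurs twice, so the bordered determinant vanishes.\<close>

lemma alternating_minors_annihilate:
  assumes i: "i \<in> {1..k}"
  shows "(\<Sum>j=0..k. (-1) ^ j * itea_T ip q v zs \<xi> p k (\<lambda>l. if l \<le> j then l else l + 1) * alpha ip q v zs \<xi> p k i (j + 1)) = 0"
proof -
  let ?\<alpha> = "alpha ip q v zs \<xi> p k"
  define B where "B = Matrix.mat (k + 1) (k + 1) (\<lambda>(r, c). ?\<alpha> (if r = 0 then i else r) (c + 1))"
  have B: "B \<in> carrier_mat (k + 1) (k + 1)" by (simp add: B_def)
  have "Determinant.det B = 0"
  proof (rule det_identical_rows[OF B, of 0 i])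
    show "Matrix.row B 0 = Matrix.row B i" using i by (intro Matrix.eq_vecI) (auto simp: B_def)
  qed (use i in auto)
  then have "(\<Sum>j<k + 1. B $$ (0, j) * cofactor B 0 j) = 0"
    using laplace_expansion_row[OF B, of 0] by simp
  moreover have "B $$ (0, j) * cofactor B 0 j =
      (-1) ^ j * itea_T ip q v zs \<xi> p k (\<lambda>l. if l \<le> j then l else l + 1) * ?\<alpha> i (j + 1)" if "j < k + 1" for j
  proof -
    have "mat_delete B 0 j = Matrix.mat k k (\<lambda>(r, c). ?\<alpha> (r + 1) (if c + 1 \<le> j then c + 1 else c + 1 + 1))"
      by (rule Matrix.eq_matI) (auto simp: mat_delete_def B_def)
    then have "cofactor B 0 j = (-1) ^ j * itea_T ip q v zs \<xi> p k (\<lambda>l. if l \<le> j then l else l + 1)"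
      by (simp add: cofactor_def itea_T_def)
    moreover have "B $$ (0, j) = ?\<alpha> i (j + 1)" using that by (simp add: B_def)
    ultimately show ?thesis by simp
  qed
  ultimately have "(\<Sum>j<k + 1. (-1) ^ j * itea_T ip q v zs \<xi> p k (\<lambda>l. if l \<le> j then l else l + 1) * ?\<alpha> i (j + 1)) = 0"
    by simp
  then show ?thesis unfolding atLeast0AtMost lessThan_Suc_atMost[symmetric] Suc_eq_plus1 .
qed

text \<open>The row polynomials span all polynomials of degree below k, so the relation may be
  tested with the Lagrange polynomial of z_l, which isolates y_l (q, v_l).\<close>

lemma alpha_columns_independent:
  assumes inj: "inj_on zs {1..k}" and qv: "\<And>i. i \<in> {1..k} \<Longrightarrow> ip q (v i) \<noteq> 0"
    and y: "\<And>i. i \<in> {1..k} \<Longrightarrow> (\<Sum>j=1..k. y j * alpha ip q v zs \<xi> p k i j) = 0" and l: "l \<in> {1..k}"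
  shows "y l = 0"
proof -
  let ?S = "lagrange_poly zs {1..k} l"
  have "\<exists>a. ?S = (\<Sum>j<k. Polynomial.smult (a j) (root_poly \<xi> {p + k - j + 1..p + k}))"
    by (rule monic_basis_span[OF root_poly_monic]) (use l in \<open>auto simp: coeff_lagrange_poly\<close>)
  then obtain a where a: "?S = (\<Sum>j<k. Polynomial.smult (a j) (root_poly \<xi> {p + k - j + 1..p + k}))"
    by (elim exE)
  have "(\<Sum>j=1..k. y j * (ip q (v j) * poly ?S (zs j))) =
     (\<Sum>j=1..k. \<Sum>i<k. a i * (y j * alpha ip q v zs \<xi> p k (k - i) j))"
  proof (rule sum.cong[OF refl])
    fix j
    show "y j * (ip q (v j) * poly ?S (zs j)) = (\<Sum>i<k. a i * (y j * alpha ip q v zs \<xi> p k (k - i) j))"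
      unfolding a poly_sum sum_distrib_left
      by (rule sum.cong[OF refl], subst alpha_root_poly) (auto simp: mult_ac)
  qed
  also have "\<dots> = (\<Sum>i<k. a i * (\<Sum>j=1..k. y j * alpha ip q v zs \<xi> p k (k - i) j))"
    by (subst sum.swap) (simp add: sum_distrib_left)
  also have "\<dots> = 0" by (intro sum.neutral ballI) (subst y, auto)
  finally have "(\<Sum>j=1..k. y j * (ip q (v j) * poly ?S (zs j))) = 0" .
  moreover have "(\<Sum>j=1..k. y j * (ip q (v j) * poly ?S (zs j))) = (\<Sum>j=1..k. if j = l then y l * ip q (v l) else 0)"
    using inj l by (intro sum.cong refl) (auto simp: poly_lagrange_poly)
  ultimately show ?thesis using l qv[OF l] by simp
qed

text \<open>The signed minors are orthogonal to each row of \<alpha>'s, and Lagrange interpolation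
  of the row polynomials at z_{k+1} exhibits column k + 1 as the combination of the columns 1, ...,
  k with weights b_s. As these k columns are independent, all minors are determined by the last one,
  (-1)^k T.\<close>

lemma itea_T_hat_eq:
  assumes inj: "inj_on zs {1..k}" and qv: "\<And>i. i \<in> {1..k} \<Longrightarrow> ip q (v i) \<noteq> 0"
  defines "b \<equiv> \<lambda>s. ip q (v (k + 1)) / ip q (v s) * poly (lagrange_poly zs {1..k} s) (zs (k + 1))"
  shows "itea_T_hat ip q v zs \<xi> p k (\<lambda>j. j + 1) z =
    ((-1) ^ k * itea_T ip q v zs \<xi> p k (\<lambda>j. j)) *s
      (e_hat v zs \<xi> p k (k + 1) z - (\<Sum>s=1..k. b s *s e_hat v zs \<xi> p k s z))"
proof -
  let ?\<alpha> = "alpha ip q v zs \<xi> p k" and ?e = "\<lambda>s. e_hat v zs \<xi> p k s z"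
  define T where "T = itea_T ip q v zs \<xi> p k (\<lambda>j. j)"
  \<comment> \<open>Dropping the j-th entry, counted from 0, of 1, ..., k + 1 leaves l for l \<le> j
    and l + 1 afterwards; for j = k nothing is shifted and the minor is T itself.\<close>
  define t where "t = (\<lambda>j. (-1) ^ j * itea_T ip q v zs \<xi> p k (\<lambda>l. if l \<le> j then l else l + 1))"
  have cong: "itea_T ip q v zs \<xi> p k s = itea_T ip q v zs \<xi> p k s'" if "\<And>l. l \<in> {1..k} \<Longrightarrow> s l = s' l" for s s'
    unfolding itea_T_def using that by (intro arg_cong[where f=Determinant.det] Matrix.cong_mat) auto
  have tk: "t k = (-1) ^ k * T" unfolding t_def T_def by (intro arg_cong2[where f="(*)"] refl cong) auto
  have b: "(\<Sum>s=1..k. b s * ?\<alpha> i s) = ?\<alpha> i (k + 1)" if i: "i \<in> {1..k}" for i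
  proof -
    let ?S = "root_poly \<xi> {p + i + 1..p + k}"
    have "poly ?S (zs (k + 1)) = (\<Sum>s=1..k. poly ?S (zs s) * poly (lagrange_poly zs {1..k} s) (zs (k + 1)))"
      using lagrange_interpolation[OF _ inj, of ?S "zs (k + 1)"] coeff_tail_poly[OF i] by simp
    then have "?\<alpha> i (k + 1) = (\<Sum>s=1..k. ip q (v (k + 1)) * (poly ?S (zs s) * poly (lagrange_poly zs {1..k} s) (zs (k + 1))))"
      unfolding alpha_root_poly[OF i] by (simp only: sum_distrib_left)
    also have "\<dots> = (\<Sum>s=1..k. b s * ?\<alpha> i s)"
    proof (rule sum.cong[OF refl])
      fix s assume "s \<in> {1..k}"
      then show "ip q (v (k + 1)) * (poly ?S (zs s) * poly (lagrange_poly zs {1..k} s) (zs (k + 1))) = b s * ?\<alpha> i s"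
        unfolding alpha_root_poly[OF i] b_def using qv by simp
    qed
    finally show ?thesis ..
  qed
  have t: "t (s - 1) = - ((-1) ^ k * T * b s)" if "s \<in> {1..k}" for s
  proof -
    have "t (s - 1) + t k * b s = 0"
    proof (rule alpha_columns_independent[where y="\<lambda>s. t (s - 1) + t k * b s" and l=s and k=k and zs=zs
          and ip=ip and q=q and v=v and \<xi>=\<xi> and p=p, OF inj qv _ that])
      fix i assume i: "i \<in> {1..k}"
      have "0 = (\<Sum>j=0..k. t j * ?\<alpha> i (j + 1))"
        unfolding t_def using alternating_minors_annihilate[OF i, of ip q v zs \<xi> p] by simp
      also have "\<dots> = (\<Sum>j<k. t j * ?\<alpha> i (j + 1)) + t k * ?\<alpha> i (k + 1)"
        by (simp only: sum.last_plus[OF le0] atLeast0LessThan add.commute)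
      also have "(\<Sum>j<k. t j * ?\<alpha> i (j + 1)) = (\<Sum>s=1..k. t (s - 1) * ?\<alpha> i s)"
        by (rule sum.reindex_bij_witness[of _ "\<lambda>s. s - 1" "\<lambda>j. j + 1"]) auto
      also have "t k * ?\<alpha> i (k + 1) = (\<Sum>s=1..k. t k * b s * ?\<alpha> i s)"
        unfolding b[OF i, symmetric] by (simp only: sum_distrib_left mult.assoc)
      finally show "(\<Sum>s=1..k. (t (s - 1) + t k * b s) * ?\<alpha> i s) = 0"
        by (simp only: distrib_right sum.distrib)
    qed
    then show ?thesis unfolding tk by (simp add: eq_neg_iff_add_eq_0)
  qed
  have "itea_T_hat ip q v zs \<xi> p k (\<lambda>j. j + 1) z = (\<Sum>j=0..k. t j *s ?e (j + 1))"
    unfolding itea_T_hat_def t_def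
  proof (intro sum.cong refl arg_cong2[where f="(*s)"] arg_cong2[where f="(*)"] cong)
    fix j l assume "l \<in> {1..k}"
    then show "(if l \<le> j then l - 1 + 1 else l + 1) = (if l \<le> j then l else l + 1)" by auto
  qed
  also have "\<dots> = (\<Sum>j<k. t j *s ?e (j + 1)) + t k *s ?e (k + 1)"
    by (simp only: sum.last_plus[OF le0] atLeast0LessThan add.commute)
  also have "(\<Sum>j<k. t j *s ?e (j + 1)) = (\<Sum>s=1..k. t (s - 1) *s ?e s)"
    by (rule sum.reindex_bij_witness[of _ "\<lambda>s. s - 1" "\<lambda>j. j + 1"]) auto
  also have "\<dots> = (\<Sum>s=1..k. (- ((-1) ^ k * T)) *s (b s *s ?e s))"
  proof (rule sum.cong[OF refl])
    fix s assume "s \<in> {1..k}"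
    then show "t (s - 1) *s ?e s = (- ((-1) ^ k * T)) *s (b s *s ?e s)"
      unfolding t[OF \<open>s \<in> {1..k}\<close>] by (simp add: Finite_Cartesian_Product.vec_eq_iff)
  qed
  also have "\<dots> = (- ((-1) ^ k * T)) *s (\<Sum>s=1..k. b s *s ?e s)"
    by (simp add: Finite_Cartesian_Product.vec_eq_iff sum_distrib_left sum_negf mult.assoc)
  finally show ?thesis
    unfolding tk T_def[symmetric]
    by (simp add: Finite_Cartesian_Product.vec_eq_iff algebra_simps)
qed

text \<open>The factor (-1)^k T of the bordered determinant cancels against the prefactor of B. What
  remains is the determinant-free form that the asymptotic analysis produces.\<close>

lemma itea_B_eq:
  assumes inj: "inj_on zs {1..k}" and qv: "\<And>i. i \<in> {1..k} \<Longrightarrow> ip q (v i) \<noteq> 0"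
  defines "b \<equiv> \<lambda>s. ip q (v (k + 1)) / ip q (v s) * poly (lagrange_poly zs {1..k} s) (zs (k + 1))"
  shows "itea_B ip q v zs \<xi> p k z = (\<Prod>i=1..k. (zs (k + 1) - zs i) / (z - zs i)) *s
      (e_hat v zs \<xi> p k (k + 1) z - (\<Sum>s=1..k. b s *s e_hat v zs \<xi> p k s z))"
proof -
  have e: "(- 1) ^ k * ((- 1) ^ k :: complex) = 1" by (rule minus_one_mult_self)
  moreover have "itea_T_hat ip q v zs \<xi> p k (\<lambda>j. j + 1) z =
    ((-1) ^ k * itea_T ip q v zs \<xi> p k (\<lambda>j. j)) *s
      (e_hat v zs \<xi> p k (k + 1) z - (\<Sum>s=1..k. b s *s e_hat v zs \<xi> p k s z))"
    unfolding b_def by (rule itea_T_hat_eq[where ip=ip and q=q and v=v, OF inj qv])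
  moreover have sc: "(e / T * P) * (e * T) = P" if "e * e = 1" "T \<noteq> 0" for e T P :: complex
  proof -
    have "(e / T * P) * (e * T) = (e * e) * P * (T / T)"
      by (simp only: times_divide_eq_left times_divide_eq_right mult_ac)
    then show ?thesis using that by simp
  qed
  moreover have T0: "itea_T ip q v zs \<xi> p k (\<lambda>j. j) \<noteq> 0"
    by (rule itea_T_nonzero[OF inj]) (rule qv)
  ultimately show ?thesis
    by (simp only: itea_B_def vector_smult_assoc sc[OF e T0])
qed

text \<open>Leibniz formula. An upper bound for T is what turns a lower bound for the bordered
  determinant into one for B.\<close>

lemma itea_T_bound:
  assumes "\<And>i s. i \<in> {1..k} \<Longrightarrow> s \<in> {1..k} \<Longrightarrow> cmod (alpha ip q v zs \<xi> p k i s) \<le> A"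
  shows "cmod (itea_T ip q v zs \<xi> p k (\<lambda>j. j)) \<le> (\<Sum>\<pi> \<in> {\<pi>. \<pi> permutes {0..<k}}. A ^ k)"
proof -
  let ?M = "Matrix.mat k k (\<lambda>(i, j). alpha ip q v zs \<xi> p k (i + 1) (j + 1))"
  have eq: "itea_T ip q v zs \<xi> p k (\<lambda>j. j) = (\<Sum>\<pi> \<in> {\<pi>. \<pi> permutes {0..<k}}. signof \<pi> * (\<Prod>i = 0..<k. ?M $$ (i, \<pi> i)))"
    unfolding itea_T_def by (rule det_def') simp
  have "cmod (\<Sum>\<pi> \<in> {\<pi>. \<pi> permutes {0..<k}}. signof \<pi> * (\<Prod>i = 0..<k. ?M $$ (i, \<pi> i))) \<le> (\<Sum>\<pi> \<in> {\<pi>. \<pi> permutes {0..<k}}. A ^ k)"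
  proof (intro order.trans[OF norm_sum sum_mono])
    fix \<pi> assume "\<pi> \<in> {\<pi>. \<pi> permutes {0..<k}}"
    then have p: "\<pi> permutes {0..<k}" by simp
    have \<pi>: "\<pi> i < k" if "i < k" for i 
    proof -
      have "\<pi> i \<in> {0..<k}" using permutes_in_image[OF p, of i] that by (simp only: atLeastLessThan_iff le0 simp_thms)
      then show ?thesis by simp
    qed
    have "cmod (signof \<pi> :: complex) = 1" by (simp add: sign_def)
    then have "cmod (signof \<pi> * (\<Prod>i = 0..<k. ?M $$ (i, \<pi> i))) = (\<Prod>i = 0..<k. cmod (?M $$ (i, \<pi> i)))"
      by (simp only: norm_mult prod_norm mult_1)
    moreover have "0 \<le> cmod (?M $$ (i, \<pi> i)) \<and> cmod (?M $$ (i, \<pi> i)) \<le> A" if "i \<in> {0..<k}" for i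
    proof -
      have i: "i < k" using that by simp
      show ?thesis using assms[of "i + 1" "\<pi> i + 1"] i \<pi>[OF i] by simp
    qed
    then have "(\<Prod>i\<in>{0..<k}. cmod (?M $$ (i, \<pi> i))) \<le> (\<Prod>i\<in>{0..<k}. A)"
      by (rule prod_mono)
    ultimately show "cmod (signof \<pi> * (\<Prod>i = 0..<k. ?M $$ (i, \<pi> i))) \<le> A ^ k" by simp
  qed
  then show ?thesis unfolding eq .
qed

lemma tendsto_null_times_bounded:
  fixes f g :: "nat \<Rightarrow> complex"
  assumes f: "f \<longlonglongrightarrow> 0" and g: "\<forall>\<^sub>F p in sequentially. cmod (g p) \<le> B"
  shows "(\<lambda>p. f p * g p) \<longlonglongrightarrow> 0"
proof (rule Lim_null_comparison)
  have "(\<lambda>p. cmod (f p) * B) \<longlonglongrightarrow> 0 * B"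
    by (intro tendsto_mult tendsto_const tendsto_norm_zero f)
  then show "(\<lambda>p. cmod (f p) * B) \<longlonglongrightarrow> 0" by simp
  show "\<forall>\<^sub>F p in sequentially. cmod (f p * g p) \<le> cmod (f p) * B"
    using g by eventually_elim (simp add: norm_mult mult_left_mono)
qed

section \<open>Asymptotics of the interpolants\<close>

text \<open>
  \<open>F\<close> is the Cauchy transform of \<open>J\<close>: the functionals \<open>\<Lambda> i\<close> come from the Cauchy formula for \<open>\<Theta>\<close> near
  the level curve, and every pole contributes a point mass. Dropping the point masses at
  \<open>z\<^sub>1, \<dots>, z\<^sub>k\<close> gives \<open>J\<^sub>1\<close>, on whose support \<open>\<bar>\<Psi> p\<bar>\<close> is at least \<open>M p\<close>.
\<close>

locale itea_asymptotics =
  fixes F :: "complex \<Rightarrow> complex ^ 'n" and v :: "nat \<Rightarrow> complex ^ 'n" and zs :: "nat \<Rightarrow> complex"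
    and \<mu> k :: nat and \<xi> :: "nat \<Rightarrow> nat \<Rightarrow> complex"
    and ip :: "complex ^ 'n \<Rightarrow> complex ^ 'n \<Rightarrow> complex" and q :: "complex ^ 'n" and \<omega> :: "'n \<Rightarrow> complex"
    and \<Lambda> :: "'n \<Rightarrow> (complex \<Rightarrow> complex) \<Rightarrow> complex" and L\<^sub>0 U :: "complex set"
    and M :: "nat \<Rightarrow> real" and Bd :: real
  assumes \<Lambda>: "\<And>i. bounded_functional L\<^sub>0 (\<Lambda> i)" and L0: "compact L\<^sub>0"
    and U: "open U" "U \<inter> (L\<^sub>0 \<union> zs ` {1..\<mu>}) = {}"
    and F: "\<And>z i. z \<in> U \<Longrightarrow> F z $ i = \<Lambda> i (\<lambda>w. 1 / (w - z)) - (\<Sum>s=1..\<mu>. v s $ i * (1 / (zs s - z)))"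
    and inj: "inj_on zs {1..\<mu>}" and k: "1 \<le> k" "k \<le> \<mu>"
    and ip: "\<And>x :: complex ^ 'n. ip q x = (\<Sum>i\<in>UNIV. \<omega> i * x $ i)"
    and qv: "\<And>i. i \<in> {1..k} \<Longrightarrow> ip q (v i) \<noteq> 0"
    and nodes_U: "\<forall>\<^sub>F p in sequentially. \<xi> p ` {1..p + k} \<subseteq> U"
    and consecutive: "\<forall>\<^sub>F p in sequentially. equal_points_consecutive (p + k) (\<xi> p)"
    and nodes_bounded: "\<forall>\<^sub>F p in sequentially. \<forall>i\<in>{1..p + k}. cmod (\<xi> p i) \<le> Bd"
    and M_pos: "\<forall>\<^sub>F p in sequentially. M p > 0"
    and M_le: "\<forall>\<^sub>F p in sequentially. \<forall>w\<in>L\<^sub>0 \<union> zs ` {k + 1..\<mu>}. M p \<le> cmod (node_poly (\<xi> p) 1 (p + k) w)"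
    and M_dominates: "\<And>i. i \<in> {1..k} \<Longrightarrow> (\<lambda>p. cmod (node_poly (\<xi> p) 1 (p + k) (zs i)) / M p) \<longlonglongrightarrow> 0"
begin

abbreviation "\<Psi> p \<equiv> node_poly (\<xi> p) 1 (p + k)"
abbreviation "tail p \<equiv> node_poly (\<xi> p) (p + 1) (p + k)"

definition "J i g = \<Lambda> i g - (\<Sum>s=1..\<mu>. v s $ i * g (zs s))"
definition "L = L\<^sub>0 \<union> zs ` {1..\<mu>}"
definition "L\<^sub>1 = L\<^sub>0 \<union> zs ` {k + 1..\<mu>}"
definition "J\<^sub>1 i g = \<Lambda> i g - (\<Sum>s=k + 1..\<mu>. v s $ i * g (zs s))"
text \<open>Pairing with q turns the vector-valued functionals into the scalar ones that the
  equations for the c_j speak of. The polynomial \<open>P\<^sub>0\<close> below will turn out to be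
  the limit of the denominators.\<close>

definition "W g = (\<Sum>i\<in>UNIV. \<omega> i * J i g)"
definition "W\<^sub>1 g = (\<Sum>i\<in>UNIV. \<omega> i * J\<^sub>1 i g)"
definition "P\<^sub>0 w = (\<Prod>i\<in>{1..k}. w - zs i)"
abbreviation "lag i \<equiv> poly (lagrange_poly zs {1..k} i)"

lemma J: "bounded_functional L (J i)"
  unfolding J_def[abs_def] L_def by (rule bounded_functional_minus_point_masses[OF \<Lambda>]) simp

lemma J1: "bounded_functional L\<^sub>1 (J\<^sub>1 i)"
  unfolding J\<^sub>1_def[abs_def] L\<^sub>1_def by (rule bounded_functional_minus_point_masses[OF \<Lambda>]) simp

lemma W1: "bounded_functional L\<^sub>1 W\<^sub>1"
  unfolding W\<^sub>1_def[abs_def] by (rule bounded_functional_combination[OF _ J1]) simp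

lemma compact_L: "compact L" and compact_L1: "compact L\<^sub>1"
  unfolding L_def L\<^sub>1_def by (intro compact_Un L0 finite_imp_compact; simp)+

lemma L1_subset: "L\<^sub>1 \<subseteq> L"
  unfolding L_def L\<^sub>1_def by auto

lemma J_split: "J i g = J\<^sub>1 i g - (\<Sum>s=1..k. v s $ i * g (zs s))"
proof -
  have "{1..\<mu>} = {1..k} \<union> {k + 1..\<mu>}" using k by auto
  then have "(\<Sum>s=1..\<mu>. v s $ i * g (zs s)) = (\<Sum>s=1..k. v s $ i * g (zs s)) + (\<Sum>s=k + 1..\<mu>. v s $ i * g (zs s))"
    by (simp add: sum.union_disjoint)
  then show ?thesis by (simp add: J_def J\<^sub>1_def)
qed

lemma W_split: "W g = W\<^sub>1 g - (\<Sum>s=1..k. ip q (v s) * g (zs s))"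
proof -
  have "W g = W\<^sub>1 g - (\<Sum>i\<in>UNIV. \<Sum>s=1..k. \<omega> i * (v s $ i * g (zs s)))"
    by (simp add: W_def W\<^sub>1_def J_split right_diff_distrib sum_subtractf sum_distrib_left)
  also have "(\<Sum>i\<in>UNIV. \<Sum>s=1..k. \<omega> i * (v s $ i * g (zs s))) = (\<Sum>s=1..k. ip q (v s) * g (zs s))"
    by (subst sum.swap) (simp add: ip sum_distrib_left mult_ac)
  finally show ?thesis .
qed

sublocale cauchy_transform F J L U
proof
  show "F z $ i = J i (\<lambda>w. 1 / (w - z))" if "z \<in> U" for z i
    using F[OF that] by (simp add: J_def)
qed (use J compact_L U in \<open>auto simp: L_def\<close>)

lemma injk: "inj_on zs {1..k}"
  using inj by (rule inj_on_subset) (use k in auto)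

lemma zs_in_L: "s \<in> {1..\<mu>} \<Longrightarrow> zs s \<in> L"
  by (simp add: L_def)

lemma \<Psi>_nonzero: "\<xi> p ` {1..p + k} \<subseteq> U \<Longrightarrow> w \<in> L \<Longrightarrow> \<Psi> p w \<noteq> 0"
  by (rule node_poly_nonzero)

definition "Bd' = max Bd 0"

lemma nodes_bounded': "\<forall>\<^sub>F p in sequentially. \<forall>i\<in>{1..p + k}. cmod (\<xi> p i) \<le> Bd'"
  using nodes_bounded by eventually_elim (auto simp: Bd'_def intro: max.coboundedI1)

section \<open>Denominators: values at the first k poles, unique solvability, limit\<close>

lemma Lagrange_bounds:
  assumes "compact C"
  obtains H where "H \<ge> 1" "\<And>w. w \<in> C \<Longrightarrow> cmod (P\<^sub>0 w) \<le> H" "\<And>w i. w \<in> C \<Longrightarrow> i \<in> {1..k} \<Longrightarrow> cmod (lag i w) \<le> H"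
proof -
  have "\<exists>B\<ge>0. \<forall>w\<in>C. cmod (P\<^sub>0 w) \<le> B"
    unfolding P\<^sub>0_def by (intro continuous_on_compact_bound assms continuous_intros)
  then obtain B where B: "B \<ge> 0" "\<forall>w\<in>C. cmod (P\<^sub>0 w) \<le> B" by blast
  have "\<forall>i. \<exists>B\<ge>0. \<forall>w\<in>C. cmod (lag i w) \<le> B"
    by (intro allI continuous_on_compact_bound assms continuous_intros)
  then obtain b where b: "\<forall>i. b i \<ge> 0 \<and> (\<forall>w\<in>C. cmod (lag i w) \<le> b i)" by metis
  let ?H = "1 + B + (\<Sum>i=1..k. b i)"
  have s: "b i \<le> (\<Sum>i=1..k. b i)" if "i \<in> {1..k}" for i
    using that b by (intro member_le_sum) auto
  have s0: "(\<Sum>i=1..k. b i) \<ge> 0" using b by (intro sum_nonneg) auto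
  show ?thesis
  proof (rule that[of ?H])
    show "cmod (P\<^sub>0 w) \<le> ?H" if "w \<in> C" for w using bspec[OF B(2) that] s0 by linarith
    show "cmod (lag i w) \<le> ?H" if "w \<in> C" "i \<in> {1..k}" for w i
      using s[OF that(2)] b that(1) B(1) by (smt (verit))
  qed (use s0 B in auto)
qed

text \<open>Testing orthogonality against the Lagrange polynomials gives the values of \<open>f\<close> at the first \<open>k\<close> poles.\<close>

lemma orthogonal_value:
  assumes orth: "\<And>S. (\<And>n. n \<ge> k \<Longrightarrow> coeff S n = 0) \<Longrightarrow> W (\<lambda>w. poly f w * poly S w / \<Psi> p w) = 0"
    and i: "i \<in> {1..k}"
  shows "ip q (v i) * poly f (zs i) / \<Psi> p (zs i) = W\<^sub>1 (\<lambda>w. poly f w * lag i w / \<Psi> p w)"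
proof -
  have "W (\<lambda>w. poly f w * lag i w / \<Psi> p w) = 0"
    using i by (intro orth) (simp add: coeff_lagrange_poly)
  then have "W\<^sub>1 (\<lambda>w. poly f w * lag i w / \<Psi> p w) = (\<Sum>s=1..k. ip q (v s) * (poly f (zs s) * lag i (zs s) / \<Psi> p (zs s)))"
    by (simp add: W_split)
  also have "\<dots> = (\<Sum>s=1..k. if s = i then ip q (v i) * poly f (zs i) / \<Psi> p (zs i) else 0)"
    using i injk by (intro sum.cong refl) (auto simp: poly_lagrange_poly)
  finally show ?thesis using i by simp
qed

text \<open>A bootstrap. By \<open>orthogonal_value\<close>, (q, v_i) times the value of f at z_i is
  \<Psi>_p(z_i) times a functional on the rest of the support, so the value is at most a constant
  times |\<Psi>_p(z_i)| / M p times the size of f there. That size is in turn bounded by the leading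
  coefficient and these same values. As the ratios tend to 0, the values on the right are absorbed.
  The leading coefficient is left free so that 0 is allowed.\<close>

lemma orthogonal_values_small:
  "\<exists>C\<ge>0. \<forall>\<^sub>F p in sequentially. \<forall>f. (\<forall>n>k. coeff f n = 0) \<longrightarrow>
     (\<forall>S. (\<forall>n\<ge>k. coeff S n = 0) \<longrightarrow> W (\<lambda>w. poly f w * poly S w / \<Psi> p w) = 0) \<longrightarrow>
     (\<forall>i\<in>{1..k}. cmod (poly f (zs i)) \<le> C * (cmod (\<Psi> p (zs i)) / M p) * cmod (coeff f k))"
proof -
  obtain H where H: "H \<ge> 1" "\<And>w. w \<in> L\<^sub>1 \<Longrightarrow> cmod (P\<^sub>0 w) \<le> H" "\<And>w i. w \<in> L\<^sub>1 \<Longrightarrow> i \<in> {1..k} \<Longrightarrow> cmod (lag i w) \<le> H"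
    using Lagrange_bounds[OF compact_L1] by metis
  obtain B where B: "B \<ge> 0"
    "\<And>g m. continuous_on L\<^sub>1 g \<Longrightarrow> 0 \<le> m \<Longrightarrow> (\<forall>w\<in>L\<^sub>1. cmod (g w) \<le> m) \<Longrightarrow> cmod (W\<^sub>1 g) \<le> B * m"
    using bounded_functional_bound[OF W1] by blast
  define w0 where "w0 = Min ((\<lambda>i. cmod (ip q (v i))) ` {1..k})"
  have w0: "w0 > 0" "\<And>i. i \<in> {1..k} \<Longrightarrow> w0 \<le> cmod (ip q (v i))"
    using k qv by (auto simp: w0_def)
  \<comment> \<open>\<open>B\<close> is the norm of the functional; one \<open>H\<close> comes from
    expanding f by interpolation, the other from the Lagrange polynomial tested with;
    \<open>w0\<close> is the smallest |(q, v_i)|.\<close>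
  define C where "C = B * H\<^sup>2 / w0"
  have C: "C \<ge> 0" using B w0 by (simp add: C_def)
  have "(\<lambda>p. C * (\<Sum>i=1..k. cmod (\<Psi> p (zs i)) / M p)) \<longlonglongrightarrow> C * (\<Sum>i=1..k. 0)"
    by (intro tendsto_intros M_dominates)
  then have "\<forall>\<^sub>F p in sequentially. C * (\<Sum>i=1..k. cmod (\<Psi> p (zs i)) / M p) < 1 / 2"
    by (rule order_tendstoD) auto
  with nodes_U M_pos M_le have "\<forall>\<^sub>F p in sequentially. \<forall>f. (\<forall>n>k. coeff f n = 0) \<longrightarrow>
     (\<forall>S. (\<forall>n\<ge>k. coeff S n = 0) \<longrightarrow> W (\<lambda>w. poly f w * poly S w / \<Psi> p w) = 0) \<longrightarrow>
     (\<forall>i\<in>{1..k}. cmod (poly f (zs i)) \<le> 2 * C * (cmod (\<Psi> p (zs i)) / M p) * cmod (coeff f k))"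
  proof eventually_elim
    case (elim p)
    show ?case
    proof (intro allI impI)
      fix f assume deg: "\<forall>n>k. coeff f n = 0"
        and orth: "\<forall>S. (\<forall>n\<ge>k. coeff S n = 0) \<longrightarrow> W (\<lambda>w. poly f w * poly S w / \<Psi> p w) = 0"
      define a where "a = cmod (coeff f k)"
      define X where "X = (\<Sum>i=1..k. cmod (poly f (zs i)))"
      have X0: "X \<ge> 0" by (auto simp: X_def intro: sum_nonneg)
      have a0: "a \<ge> 0" by (simp add: a_def)
      have fb: "cmod (poly f w) \<le> H * (a + X)" if w: "w \<in> L\<^sub>1" for w
      proof -
        have "poly f w = coeff f k * P\<^sub>0 w + (\<Sum>i=1..k. poly f (zs i) * lag i w)"
          using lagrange_interpolation[OF _ injk, of f w] deg by (simp add: P\<^sub>0_def)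
        also have "cmod \<dots> \<le> a * H + (\<Sum>i=1..k. cmod (poly f (zs i)) * H)"
          unfolding a_def using H w
          by (intro norm_triangle_le add_mono order.trans[OF norm_sum sum_mono]) (auto simp: norm_mult intro!: mult_left_mono)
        finally show ?thesis by (simp add: X_def sum_distrib_left algebra_simps)
      qed
      have bound: "cmod (poly f (zs i)) \<le> C * (cmod (\<Psi> p (zs i)) / M p) * (a + X)" if i: "i \<in> {1..k}" for i
      proof -
        have zi: "\<Psi> p (zs i) \<noteq> 0" using \<Psi>_nonzero[OF elim(1)] zs_in_L[of i] i k by auto
        have "cmod (W\<^sub>1 (\<lambda>w. poly f w * lag i w / \<Psi> p w)) \<le> B * (H * (a + X) * H / M p)"
        proof (rule B(2))
          show "continuous_on L\<^sub>1 (\<lambda>w. poly f w * lag i w / \<Psi> p w)"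
            using \<Psi>_nonzero[OF elim(1)] L1_subset by (intro continuous_intros) auto
          show "\<forall>w\<in>L\<^sub>1. cmod (poly f w * lag i w / \<Psi> p w) \<le> H * (a + X) * H / M p"
          proof
            fix w assume w: "w \<in> L\<^sub>1"
            show "cmod (poly f w * lag i w / \<Psi> p w) \<le> H * (a + X) * H / M p"
              unfolding norm_mult norm_divide
              using fb[OF w] H(3)[OF w i] elim(2) elim(3) w H(1) X0 a0
              by (intro frac_le mult_mono mult_nonneg_nonneg) (auto simp: L\<^sub>1_def)
          qed
        qed (use H X0 a0 elim in auto)
        also have "W\<^sub>1 (\<lambda>w. poly f w * lag i w / \<Psi> p w) = ip q (v i) * poly f (zs i) / \<Psi> p (zs i)"
          using orthogonal_value[OF _ i, of f p] orth by simp
        finally have "cmod (ip q (v i)) * cmod (poly f (zs i)) / cmod (\<Psi> p (zs i)) \<le> B * (H * (a + X) * H / M p)"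
          by (simp only: norm_mult norm_divide)
        then have "cmod (ip q (v i)) * cmod (poly f (zs i)) \<le> B * (H * (a + X) * H / M p) * cmod (\<Psi> p (zs i))"
          using zi by (subst (asm) pos_divide_le_eq) auto
        moreover have "w0 * cmod (poly f (zs i)) \<le> cmod (ip q (v i)) * cmod (poly f (zs i))"
          using w0(2)[OF i] by (rule mult_right_mono) simp
        ultimately have "w0 * cmod (poly f (zs i)) \<le> B * (H * (a + X) * H / M p) * cmod (\<Psi> p (zs i))" by linarith
        then have "cmod (poly f (zs i)) \<le> B * (H * (a + X) * H / M p) * cmod (\<Psi> p (zs i)) / w0"
          by (simp only: pos_le_divide_eq[OF w0(1)] mult.commute[of "cmod (poly f (zs i))" w0])
        also have "\<dots> = C * (cmod (\<Psi> p (zs i)) / M p) * (a + X)" by (simp add: C_def power2_eq_square mult_ac)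
        finally show ?thesis .
      qed
      have "X \<le> (\<Sum>i=1..k. C * (cmod (\<Psi> p (zs i)) / M p) * (a + X))"
        unfolding X_def by (intro sum_mono) (use bound in \<open>auto simp: X_def\<close>)
      also have "\<dots> = C * (\<Sum>i=1..k. cmod (\<Psi> p (zs i)) / M p) * (a + X)"
        by (simp add: sum_distrib_left sum_distrib_right)
      also have "\<dots> \<le> 1 / 2 * (a + X)" using elim(4) X0 a0 by (intro mult_right_mono) auto
      \<comment> \<open>The threshold 1/2 gives \<open>X \<le> (a + X) / 2\<close>, so the unknown
        values are at most the leading coefficient; this is the factor 2 of the final
        constant.\<close>
      finally have "a + X \<le> 2 * a" by simp
      then have *: "C * (cmod (\<Psi> p (zs i)) / M p) * (a + X) \<le> C * (cmod (\<Psi> p (zs i)) / M p) * (2 * a)" for i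
        using C elim(2) by (intro mult_left_mono) auto
      show "\<forall>i\<in>{1..k}. cmod (poly f (zs i)) \<le> 2 * C * (cmod (\<Psi> p (zs i)) / M p) * cmod (coeff f k)"
        using order.trans[OF bound *] by (simp add: a_def mult_ac)
    qed
  qed
  then show ?thesis using C by (intro exI[of _ "2 * C"]) auto
qed

text \<open>c_k stays a free leading coefficient: c_k = 1 gives the size of the actual denominators,
  c_k = 0 gives uniqueness.\<close>

lemma denominator_values:
  "\<exists>C\<ge>0. \<forall>\<^sub>F p in sequentially. \<forall>c. (\<forall>i\<in>{1..k}. (\<Sum>j=0..k. itea_u ip q F (\<xi> p) p i j * c j) = 0) \<longrightarrow>
     (\<forall>i\<in>{1..k}. cmod (itea_denominator (\<xi> p) k c (zs i)) \<le> C * (cmod (\<Psi> p (zs i)) / M p) * cmod (c k))"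
proof -
  obtain C where C: "C \<ge> 0" and ev: "\<forall>\<^sub>F p in sequentially. \<forall>f. (\<forall>n>k. coeff f n = 0) \<longrightarrow>
     (\<forall>S. (\<forall>n\<ge>k. coeff S n = 0) \<longrightarrow> W (\<lambda>w. poly f w * poly S w / \<Psi> p w) = 0) \<longrightarrow>
     (\<forall>i\<in>{1..k}. cmod (poly f (zs i)) \<le> C * (cmod (\<Psi> p (zs i)) / M p) * cmod (coeff f k))"
    using orthogonal_values_small by blast
  from ev nodes_U consecutive eventually_ge_at_top[of k]
  have "\<forall>\<^sub>F p in sequentially. \<forall>c. (\<forall>i\<in>{1..k}. (\<Sum>j=0..k. itea_u ip q F (\<xi> p) p i j * c j) = 0) \<longrightarrow>
     (\<forall>i\<in>{1..k}. cmod (itea_denominator (\<xi> p) k c (zs i)) \<le> C * (cmod (\<Psi> p (zs i)) / M p) * cmod (c k))"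
  proof eventually_elim
    case (elim p)
    show ?case
    proof (intro allI impI)
      fix c assume c: "\<forall>i\<in>{1..k}. (\<Sum>j=0..k. itea_u ip q F (\<xi> p) p i j * c j) = 0"
      let ?f = "\<Sum>j\<le>k. Polynomial.smult (c j) (root_poly (\<xi> p) {1..j})"
      have "W (\<lambda>w. poly ?f w * poly S w / \<Psi> p w) = 0" if "\<forall>n\<ge>k. coeff S n = 0" for S
        using itea_orthogonality[where \<omega>=\<omega> and ip=ip and q=q, OF elim(4) elim(2) elim(3) ip, of c S] c that
        unfolding W_def itea_denominator_poly by blast
      moreover have "\<forall>n>k. coeff ?f n = 0" "coeff ?f k = c k"
        using coeff_itea_denominator_poly[of k _ c "\<xi> p"] by auto
      ultimately show "\<forall>i\<in>{1..k}. cmod (itea_denominator (\<xi> p) k c (zs i)) \<le> C * (cmod (\<Psi> p (zs i)) / M p) * cmod (c k)"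
        using elim(1)[rule_format, of ?f] unfolding itea_denominator_poly by auto
    qed
  qed
  then show ?thesis using C by blast
qed

text \<open>Moving the right-hand side across makes the equations homogeneous in (c_0, ...,
  c_k).\<close>

lemma itea_coeffs_iff:
  "itea_coeffs ip q F \<xi>' p k c \<longleftrightarrow> c k = 1 \<and> (\<forall>j>k. c j = 0) \<and>
    (\<forall>i\<in>{1..k}. (\<Sum>j=0..k. itea_u ip q F \<xi>' p i j * c j) = 0)"
proof -
  have "(\<Sum>j=0..k. itea_u ip q F \<xi>' p i j * c j) = (\<Sum>j<k. itea_u ip q F \<xi>' p i j * c j) + itea_u ip q F \<xi>' p i k * c k" for i
    by (simp only: sum.last_plus[OF le0] atLeast0LessThan add.commute)
  then show ?thesis unfolding itea_coeffs_def by (cases "c k = 1") (simp_all add: eq_neg_iff_add_eq_0)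
qed

text \<open>The difference of two solutions has c_k = 0, so its polynomial vanishes at z_1, ..., z_k
  and the difference is 0. The same argument shows that the square system for c_0, ..., c_{k-1} has
  trivial kernel, hence is solvable.\<close>

lemma unique_coeffs: "\<forall>\<^sub>F p in sequentially. \<exists>!c. itea_coeffs ip q F (\<xi> p) p k c"
proof -
  obtain C where "C \<ge> 0" and ev: "\<forall>\<^sub>F p in sequentially. \<forall>c. (\<forall>i\<in>{1..k}. (\<Sum>j=0..k. itea_u ip q F (\<xi> p) p i j * c j) = 0) \<longrightarrow>
     (\<forall>i\<in>{1..k}. cmod (itea_denominator (\<xi> p) k c (zs i)) \<le> C * (cmod (\<Psi> p (zs i)) / M p) * cmod (c k))"
    using denominator_values by blast
  from ev show ?thesis
  proof eventually_elim
    case (elim p)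
    let ?u = "\<lambda>i j. itea_u ip q F (\<xi> p) p i j"
    have split: "(\<Sum>j=0..k. ?u i j * c j) = (\<Sum>j<k. ?u i j * c j) + ?u i k * c k" for i and c :: "nat \<Rightarrow> complex"
      by (simp only: sum.last_plus[OF le0] atLeast0LessThan add.commute)
    have hom: "c j = 0" if "\<And>i. i \<in> {1..k} \<Longrightarrow> (\<Sum>j=0..k. ?u i j * c j) = 0" "c k = 0" "j < k" for c j
    proof (rule itea_denominator_eq_0_imp[where z=zs and k=k and c=c and \<xi>="\<xi> p" and j=j])
      have "\<forall>i\<in>{1..k}. cmod (itea_denominator (\<xi> p) k c (zs i)) \<le> C * (cmod (\<Psi> p (zs i)) / M p) * cmod (c k)"
        using elim that(1) by blast
      then show "itea_denominator (\<xi> p) k c (zs i) = 0" if "i \<in> {1..k}" for i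
        using that unfolding \<open>c k = 0\<close> norm_zero mult_zero_right norm_le_zero_iff by blast
    qed (use injk that in auto)
    have "\<exists>c. \<forall>i\<in>{1..k}. (\<Sum>j<k. ?u i j * c j) = - ?u i k"
    proof (rule linear_system_solvable)
      fix c j assume c: "\<And>i. i \<in> {1..k} \<Longrightarrow> (\<Sum>j<k. ?u i j * c j) = 0" and j: "j < k"
      \<comment> \<open>Setting entry k to 0 makes a kernel vector of the square system a full
        coefficient vector.\<close>
      have "(\<Sum>j<k. ?u i j * (c(k := 0)) j) = (\<Sum>j<k. ?u i j * c j)" for i by (intro sum.cong) auto
      then have "(c(k := 0)) j = 0" using c j by (intro hom[where c="c(k := 0)" and j=j]) (simp_all add: split)
      then show "c j = 0" using j by simp
    qed
    then obtain c where c: "\<forall>i\<in>{1..k}. (\<Sum>j<k. ?u i j * c j) = - ?u i k" by blast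
    define c' where "c' = (\<lambda>j. if j < k then c j else if j = k then 1 else 0)"
    have c': "itea_coeffs ip q F (\<xi> p) p k c'"
      using c by (auto simp: itea_coeffs_def c'_def)
    moreover have "d = c'" if "itea_coeffs ip q F (\<xi> p) p k d" for d
    proof
      fix j
      note d = that[unfolded itea_coeffs_iff] and c'' = c'[unfolded itea_coeffs_iff]
      have "(\<lambda>j. d j - c' j) j = 0" if "j < k"
      proof (rule hom[where c="\<lambda>j. d j - c' j" and j=j])
        show "(\<Sum>j=0..k. ?u i j * (d j - c' j)) = 0" if "i \<in> {1..k}" for i
          using d c'' that by (simp only: right_diff_distrib sum_subtractf diff_self)
        show "d k - c' k = 0" using d c'' by simp
      qed (rule that)
      moreover have "d j = c' j" if "j \<ge> k" using d c'' that by (cases "j = k") auto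
      ultimately show "d j = c' j" by (cases "j < k") auto
    qed
    ultimately show ?case by blast
  qed
qed

lemma denominator_interpolation:
  assumes "itea_coeffs ip q F \<xi>' p k c"
  shows "itea_denominator \<xi>' k c w = P\<^sub>0 w + (\<Sum>i=1..k. itea_denominator \<xi>' k c (zs i) * lag i w)"
proof -
  let ?f = "\<Sum>j\<le>k. Polynomial.smult (c j) (root_poly \<xi>' {1..j})"
  have "c k = 1" using assms by (simp add: itea_coeffs_def)
  then have "coeff ?f n = (if n = k then 1 else 0)" if "n \<ge> k" for n
    using coeff_itea_denominator_poly[OF that, of c \<xi>'] by simp
  then show ?thesis
    using lagrange_interpolation[OF _ injk, of ?f w] by (simp add: itea_denominator_poly P\<^sub>0_def)
qed

lemma coeffs_values:
  "\<exists>C\<ge>0. \<forall>\<^sub>F p in sequentially. \<forall>c. itea_coeffs ip q F (\<xi> p) p k c \<longrightarrow>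
     (\<forall>i\<in>{1..k}. cmod (itea_denominator (\<xi> p) k c (zs i)) \<le> C * (cmod (\<Psi> p (zs i)) / M p))"
proof -
  obtain C where C: "C \<ge> 0" and ev: "\<forall>\<^sub>F p in sequentially. \<forall>c. (\<forall>i\<in>{1..k}. (\<Sum>j=0..k. itea_u ip q F (\<xi> p) p i j * c j) = 0) \<longrightarrow>
     (\<forall>i\<in>{1..k}. cmod (itea_denominator (\<xi> p) k c (zs i)) \<le> C * (cmod (\<Psi> p (zs i)) / M p) * cmod (c k))"
    using denominator_values by blast
  have "\<forall>\<^sub>F p in sequentially. \<forall>c. itea_coeffs ip q F (\<xi> p) p k c \<longrightarrow>
     (\<forall>i\<in>{1..k}. cmod (itea_denominator (\<xi> p) k c (zs i)) \<le> C * (cmod (\<Psi> p (zs i)) / M p))"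
    using ev
  proof eventually_elim
    case (elim p)
    show ?case
    proof (intro allI impI)
      fix c assume "itea_coeffs ip q F (\<xi> p) p k c"
      then have c: "c k = 1" "\<forall>i\<in>{1..k}. (\<Sum>j=0..k. itea_u ip q F (\<xi> p) p i j * c j) = 0"
        by (simp_all add: itea_coeffs_iff)
      show "\<forall>i\<in>{1..k}. cmod (itea_denominator (\<xi> p) k c (zs i)) \<le> C * (cmod (\<Psi> p (zs i)) / M p)"
        using elim[rule_format, of c, OF c(2)[rule_format]] unfolding c(1) by simp
    qed
  qed
  then show ?thesis using C by blast
qed

text \<open>The difference from \<open>P\<^sub>0\<close> is a combination of fixed Lagrange
  polynomials whose coefficients, the values at z_1, ..., z_k, tend to 0.\<close>

lemma denominator_uniform:
  assumes "compact C\<^sub>0" "\<epsilon> > 0"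
  shows "\<forall>\<^sub>F p in sequentially. \<forall>c. itea_coeffs ip q F (\<xi> p) p k c \<longrightarrow>
    (\<forall>w\<in>C\<^sub>0. cmod (itea_denominator (\<xi> p) k c w - P\<^sub>0 w) \<le> \<epsilon>)"
proof -
  obtain C where C: "C \<ge> 0" and ev: "\<forall>\<^sub>F p in sequentially. \<forall>c. itea_coeffs ip q F (\<xi> p) p k c \<longrightarrow>
     (\<forall>i\<in>{1..k}. cmod (itea_denominator (\<xi> p) k c (zs i)) \<le> C * (cmod (\<Psi> p (zs i)) / M p))"
    using coeffs_values by blast
  obtain H where H: "H \<ge> 1" "\<And>w i. w \<in> C\<^sub>0 \<Longrightarrow> i \<in> {1..k} \<Longrightarrow> cmod (lag i w) \<le> H"
    using Lagrange_bounds[OF assms(1)] by metis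
  have "(\<lambda>p. \<Sum>i=1..k. C * (cmod (\<Psi> p (zs i)) / M p) * H) \<longlonglongrightarrow> (\<Sum>i=1..k. C * 0 * H)"
    by (intro tendsto_intros M_dominates)
  then have "\<forall>\<^sub>F p in sequentially. (\<Sum>i=1..k. C * (cmod (\<Psi> p (zs i)) / M p) * H) < \<epsilon>"
    by (rule order_tendstoD) (use assms in simp)
  with ev show ?thesis
  proof eventually_elim
    case (elim p)
    show ?case
    proof (intro allI impI ballI)
      fix c w assume c: "itea_coeffs ip q F (\<xi> p) p k c" and w: "w \<in> C\<^sub>0"
      have "cmod (itea_denominator (\<xi> p) k c w - P\<^sub>0 w) = cmod (\<Sum>i=1..k. itea_denominator (\<xi> p) k c (zs i) * lag i w)"
        by (simp add: denominator_interpolation[OF c, of w])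
      also have "\<dots> \<le> (\<Sum>i=1..k. C * (cmod (\<Psi> p (zs i)) / M p) * H)"
      proof (intro order.trans[OF norm_sum sum_mono])
        fix i assume i: "i \<in> {1..k}"
        have "cmod (itea_denominator (\<xi> p) k c (zs i)) \<le> C * (cmod (\<Psi> p (zs i)) / M p)"
          using elim(1) c i by blast
        then show "cmod (itea_denominator (\<xi> p) k c (zs i) * lag i w) \<le> C * (cmod (\<Psi> p (zs i)) / M p) * H"
          unfolding norm_mult using H(2)[OF w i]
          by (rule mult_mono) (use order.trans[OF norm_ge_zero \<open>cmod (itea_denominator (\<xi> p) k c (zs i)) \<le> _\<close>] in auto)
      qed
      finally show "cmod (itea_denominator (\<xi> p) k c w - P\<^sub>0 w) \<le> \<epsilon>" using elim(2) by linarith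
    qed
  qed
qed

section \<open>The error on compact sets\<close>

lemma P0_away_from_0:
  assumes "compact C\<^sub>0" "C\<^sub>0 \<subseteq> U"
  obtains \<delta> where "\<delta> > 0" "\<And>z. z \<in> C\<^sub>0 \<Longrightarrow> \<delta> \<le> cmod (P\<^sub>0 z)"
proof -
  have nz: "P\<^sub>0 z \<noteq> 0" if "z \<in> C\<^sub>0" for z
    using that assms U k by (auto simp: P\<^sub>0_def L_def)
  have "continuous_on C\<^sub>0 P\<^sub>0" unfolding P\<^sub>0_def[abs_def] by (intro continuous_intros)
  then have "continuous_on C\<^sub>0 (\<lambda>z. 1 / P\<^sub>0 z)" using nz by (intro continuous_intros) auto
  then obtain B where B: "B \<ge> 0" "\<forall>z\<in>C\<^sub>0. cmod (1 / P\<^sub>0 z) \<le> B"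
    using continuous_on_compact_bound[OF _ assms(1)] by blast
  show ?thesis
  proof (rule that[of "1 / (B + 1)"])
    fix z assume z: "z \<in> C\<^sub>0"
    have "1 / cmod (P\<^sub>0 z) \<le> B + 1" using B(2) z by (auto simp: norm_divide)
    then show "1 / (B + 1) \<le> cmod (P\<^sub>0 z)"
      using nz[OF z] B(1) by (simp add: divide_simps mult.commute)
  qed (use B in auto)
qed

text \<open>The tail has exactly k factors, k is fixed, and the nodes stay bounded; replacing 1 /
  \<psi>_{1,p} by 1 / \<Psi>_p thus costs a bounded factor.\<close>

lemma tail_bounded:
  assumes "compact C\<^sub>0"
  obtains T where "T \<ge> 0" "\<forall>\<^sub>F p in sequentially. \<forall>w\<in>C\<^sub>0. cmod (tail p w) \<le> T"
proof -
  obtain R where R: "R \<ge> 0" "\<forall>w\<in>C\<^sub>0. cmod w \<le> R"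
    using continuous_on_compact_bound[OF continuous_on_id assms] by auto
  have "\<forall>\<^sub>F p in sequentially. \<forall>w\<in>C\<^sub>0. cmod (tail p w) \<le> (R + Bd') ^ k"
    using nodes_bounded'
  proof eventually_elim
    case (elim p)
    show ?case
    proof
      fix w assume "w \<in> C\<^sub>0"
      then show "cmod (tail p w) \<le> (R + Bd') ^ k"
        using node_poly_bound[of "p + 1" "p + k" "\<xi> p" Bd' w R] elim R by (auto simp: Bd'_def)
    qed
  qed
  then show ?thesis using R by (intro that[of "(R + Bd') ^ k"]) (auto simp: Bd'_def)
qed

lemma \<Psi>_split: "\<Psi> p w = node_poly (\<xi> p) 1 p w * tail p w"
  using node_poly_split[of 1 p "p + k"] by simp

lemma distance_from_L:
  assumes "compact C\<^sub>0" "C\<^sub>0 \<subseteq> U"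
  obtains d where "d > 0" "\<And>z w. z \<in> C\<^sub>0 \<Longrightarrow> w \<in> L \<Longrightarrow> d \<le> cmod (w - z)"
proof -
  have "C\<^sub>0 \<inter> L = {}" using assms(2) U by (auto simp: L_def)
  from separate_compact_closed[OF assms(1) compact_imp_closed[OF compact_L] this]
  show ?thesis using that by (metis dist_commute dist_norm)
qed

text \<open>The function inserted into \<open>J\<close>, with \<open>1 / \<psi>\<^sub>1\<^sub>,\<^sub>p\<close> written as \<open>tail / \<Psi>\<close>.\<close>

lemma error_integrand:
  assumes "\<xi> p ` {1..p + k} \<subseteq> U" "w \<in> L"
  shows "x / ((w - z) * node_poly (\<xi> p) 1 p w) = x * tail p w / (w - z) / \<Psi> p w"
proof -
  have t: "tail p w \<noteq> 0" using \<Psi>_nonzero[OF assms] unfolding \<Psi>_split by auto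
  have "x * tail p w / (w - z) / \<Psi> p w = (x * tail p w) / (((w - z) * node_poly (\<xi> p) 1 p w) * tail p w)"
    unfolding \<Psi>_split by (simp only: divide_divide_eq_left mult.assoc)
  also have "\<dots> = x / ((w - z) * node_poly (\<xi> p) 1 p w)"
    by (rule nonzero_mult_divide_mult_cancel_right[OF t])
  finally show ?thesis ..
qed

text \<open>On the support of \<open>J\<^sub>1\<close> the integrand is O(1 / M p) because
  |\<Psi>_p| is at least M p there. At z_1, ..., z_k the denominator \<Psi>_p may be far smaller,
  but the bound for Q(z_s) contains exactly the factor |\<Psi>_p(z_s)| / M p, so the masses there
  contribute O(1 / M p) too.\<close>

lemma error_functional_bound:
  assumes C0: "compact C\<^sub>0" "C\<^sub>0 \<subseteq> U"
  shows "\<exists>D\<ge>0. \<forall>\<^sub>F p in sequentially. \<forall>c. itea_coeffs ip q F (\<xi> p) p k c \<longrightarrow> (\<forall>z\<in>C\<^sub>0. \<forall>i.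
     cmod (J i (\<lambda>w. itea_denominator (\<xi> p) k c w / ((w - z) * node_poly (\<xi> p) 1 p w))) \<le> D / M p)"
proof -
  obtain C where C: "C \<ge> 0" and ev: "\<forall>\<^sub>F p in sequentially. \<forall>c. itea_coeffs ip q F (\<xi> p) p k c \<longrightarrow>
     (\<forall>i\<in>{1..k}. cmod (itea_denominator (\<xi> p) k c (zs i)) \<le> C * (cmod (\<Psi> p (zs i)) / M p))"
    using coeffs_values by blast
  obtain H where H: "H \<ge> 1" "\<And>w. w \<in> L \<Longrightarrow> cmod (P\<^sub>0 w) \<le> H"
    using Lagrange_bounds[OF compact_L] by metis
  obtain d where d: "d > 0" "\<And>z w. z \<in> C\<^sub>0 \<Longrightarrow> w \<in> L \<Longrightarrow> d \<le> cmod (w - z)"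
    using distance_from_L[OF C0] by metis
  obtain T where T: "T \<ge> 0" "\<forall>\<^sub>F p in sequentially. \<forall>w\<in>L. cmod (tail p w) \<le> T"
    by (rule tail_bounded[OF compact_L]) (rule that)
  have "\<forall>i. \<exists>B\<ge>0. \<forall>g m. continuous_on L\<^sub>1 g \<longrightarrow> 0 \<le> m \<longrightarrow> (\<forall>w\<in>L\<^sub>1. cmod (g w) \<le> m) \<longrightarrow> cmod (J\<^sub>1 i g) \<le> B * m"
    by (intro allI bounded_functional_bound J1)
  then obtain b where b': "\<forall>i. b i \<ge> 0 \<and> (\<forall>g m. continuous_on L\<^sub>1 g \<longrightarrow> 0 \<le> m \<longrightarrow> (\<forall>w\<in>L\<^sub>1. cmod (g w) \<le> m) \<longrightarrow> cmod (J\<^sub>1 i g) \<le> b i * m)"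
    by (elim exE[OF choice])
  have b0: "b i \<ge> 0" for i using spec[OF b', of i] by (rule conjunct1)
  have b: "cmod (J\<^sub>1 i g) \<le> b i * m"
    if "continuous_on L\<^sub>1 g" "0 \<le> m" "\<And>w. w \<in> L\<^sub>1 \<Longrightarrow> cmod (g w) \<le> m" for i g m
    by (rule spec[OF b', THEN conjunct2, rule_format]) (use that in \<open>simp_all only: conj_imp_eq_imp_imp\<close>)
  define B where "B = (\<Sum>i\<in>UNIV. b i)"
  have bB: "b i \<le> B" for i unfolding B_def by (intro member_le_sum b0) auto
  define V where "V = (\<Sum>i\<in>UNIV. \<Sum>s=1..k. cmod (v s $ i))"
  have vV: "(\<Sum>s=1..k. cmod (v s $ i)) \<le> V" for i
    unfolding V_def by (rule member_le_sum[where f="\<lambda>i. \<Sum>s=1..k. cmod (v s $ i)"]) (auto intro: sum_nonneg)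
  \<comment> \<open>First the share of \<open>J\<^sub>1\<close>, then that of the masses at z_1,
    ..., z_k. \<open>H + 1\<close> bounds the denominators on the support, \<open>T\<close> the
    tails, and \<open>d\<close> separates \<open>C\<^sub>0\<close> from the support.\<close>
  define D where "D = B * ((H + 1) * T / d) + V * (C * T / d)"
  have B0: "B \<ge> 0" "V \<ge> 0" unfolding B_def V_def by (intro sum_nonneg b0 norm_ge_zero)+
  have evQ: "\<forall>\<^sub>F p in sequentially. \<forall>c. itea_coeffs ip q F (\<xi> p) p k c \<longrightarrow>
    (\<forall>w\<in>L. cmod (itea_denominator (\<xi> p) k c w - P\<^sub>0 w) \<le> 1)"
    by (rule denominator_uniform[OF compact_L]) simp
  have cancel: "C * (P / m) * T / d / P = C * T / d / m" if "P \<noteq> 0" for P m :: real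
  proof -
    have "C * (P / m) * T / d / P = C * T / d / m * (P / P)" by (simp add: mult_ac)
    then show ?thesis using that by simp
  qed
  have D0: "D \<ge> 0" unfolding D_def using B0 H(1) T(1) d(1) C
    by (intro add_nonneg_nonneg mult_nonneg_nonneg divide_nonneg_pos) auto
  have "\<forall>\<^sub>F p in sequentially. \<forall>c. itea_coeffs ip q F (\<xi> p) p k c \<longrightarrow> (\<forall>z\<in>C\<^sub>0. \<forall>i.
     cmod (J i (\<lambda>w. itea_denominator (\<xi> p) k c w / ((w - z) * node_poly (\<xi> p) 1 p w))) \<le> D / M p)"
    using ev T(2) evQ nodes_U M_pos M_le
  proof eventually_elim
    case (elim p)
    show ?case
    proof (intro allI impI ballI)
      fix c z i assume c: "itea_coeffs ip q F (\<xi> p) p k c" and z: "z \<in> C\<^sub>0"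
      let ?Q = "itea_denominator (\<xi> p) k c"
      let ?g = "\<lambda>w. ?Q w / ((w - z) * node_poly (\<xi> p) 1 p w)"
      have g: "?g w = ?Q w * tail p w / (w - z) / \<Psi> p w" if "w \<in> L" for w
        by (rule error_integrand[OF elim(4) that])
      have wz: "w \<noteq> z" if "w \<in> L" for w using d(2)[OF z that] d(1) by auto
      have n0: "node_poly (\<xi> p) 1 p w \<noteq> 0" if "w \<in> L" for w
        using \<Psi>_nonzero[OF elim(4) that] \<Psi>_split[of p w] by auto
      have Q: "cmod (?Q w) \<le> H + 1" if "w \<in> L" for w
      proof -
        have "cmod (?Q w - P\<^sub>0 w) \<le> 1" using elim(3) c that by blast
        then show ?thesis using H(2)[OF that] norm_triangle_ineq2[of "?Q w" "P\<^sub>0 w"] by linarith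
      qed
      have "cmod (J\<^sub>1 i ?g) \<le> b i * ((H + 1) * T / d / M p)"
      proof (rule b)
        show "continuous_on L\<^sub>1 ?g"
          using L1_subset wz n0 by (intro continuous_intros) auto
        show "0 \<le> (H + 1) * T / d / M p" using H T d elim(5) by auto
        fix w assume w: "w \<in> L\<^sub>1"
        then have wL: "w \<in> L" using L1_subset by auto
        have "M p \<le> cmod (\<Psi> p w)" using elim(6) w by (auto simp: L\<^sub>1_def)
        then show "cmod (?g w) \<le> (H + 1) * T / d / M p"
          unfolding g[OF wL] norm_divide norm_mult
          using Q[OF wL] elim(2) wL d(2)[OF z wL] d(1) elim(5) H(1) T(1)
          by (intro frac_le mult_mono) auto
      qed
      also have "\<dots> \<le> B * ((H + 1) * T / d / M p)"
        using bB[of i] H T d elim(5) by (intro mult_right_mono) auto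
      finally have 1: "cmod (J\<^sub>1 i ?g) \<le> B * ((H + 1) * T / d / M p)" .
      have gs: "cmod (?g (zs s)) \<le> C * T / d / M p" if s: "s \<in> {1..k}" for s
      proof -
        have sL: "zs s \<in> L" using s k zs_in_L by auto
        have \<Psi>0: "cmod (\<Psi> p (zs s)) > 0" using \<Psi>_nonzero[OF elim(4) sL] by simp
        have "cmod (?g (zs s)) = cmod (?Q (zs s)) * cmod (tail p (zs s)) / cmod (zs s - z) / cmod (\<Psi> p (zs s))"
          unfolding g[OF sL] by (simp only: norm_divide norm_mult)
        also have "\<dots> \<le> (C * (cmod (\<Psi> p (zs s)) / M p)) * T / d / cmod (\<Psi> p (zs s))"
        proof (intro divide_right_mono frac_le mult_mono)
          show "cmod (?Q (zs s)) \<le> C * (cmod (\<Psi> p (zs s)) / M p)" using elim(1) c s by blast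
        qed (use elim(2,5) sL d(2)[OF z sL] d(1) C T(1) in auto)
        also have "\<dots> = C * T / d / M p" using cancel[of "cmod (\<Psi> p (zs s))" "M p"] \<Psi>0 by simp
        finally show ?thesis .
      qed
      have "cmod (\<Sum>s=1..k. v s $ i * ?g (zs s)) \<le> (\<Sum>s=1..k. cmod (v s $ i) * (C * T / d / M p))"
      proof (intro order.trans[OF norm_sum sum_mono])
        fix s assume "s \<in> {1..k}"
        from mult_left_mono[OF gs[OF this] norm_ge_zero[of "v s $ i"]]
        show "cmod (v s $ i * ?g (zs s)) \<le> cmod (v s $ i) * (C * T / d / M p)"
          by (simp only: norm_mult[of "v s $ i"])
      qed
      also have "\<dots> \<le> V * (C * T / d / M p)"
        unfolding sum_distrib_right[symmetric] using vV[of i] C T d elim(5) by (intro mult_right_mono) auto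
      finally have 2: "cmod (\<Sum>s=1..k. v s $ i * ?g (zs s)) \<le> V * (C * T / d / M p)" .
      have "cmod (J i ?g) \<le> B * ((H + 1) * T / d / M p) + V * (C * T / d / M p)"
        unfolding J_split using norm_triangle_ineq4[of "J\<^sub>1 i ?g" "\<Sum>s=1..k. v s $ i * ?g (zs s)"] 1 2 by linarith
      then show "cmod (J i ?g) \<le> D / M p" by (simp add: D_def add_divide_distrib)
    qed
  qed
  then show ?thesis using D0 by blast
qed

definition "cf p = (THE c. itea_coeffs ip q F (\<xi> p) p k c)"

lemma cf: "\<exists>!c. itea_coeffs ip q F (\<xi> p) p k c \<Longrightarrow> itea_coeffs ip q F (\<xi> p) p k (cf p)"
  using theI'[of "itea_coeffs ip q F (\<xi> p) p k"] unfolding cf_def by blast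

lemma itea_error_formula:
  assumes "\<xi> p ` {1..p + k} \<subseteq> U" "equal_points_consecutive (p + k) (\<xi> p)" "k \<le> p"
    and z: "z \<in> U" and nz: "itea_denominator (\<xi> p) k (cf p) z \<noteq> 0"
  shows "(F z - itea ip q F (\<xi> p) p k z) $ i =
    node_poly (\<xi> p) 1 p z / itea_denominator (\<xi> p) k (cf p) z *
      J i (\<lambda>w. itea_denominator (\<xi> p) k (cf p) w / ((w - z) * node_poly (\<xi> p) 1 p w))"
proof -
  have "itea_denominator (\<xi> p) k (cf p) z * (F z - itea ip q F (\<xi> p) p k z) $ i =
    itea_denominator (\<xi> p) k (cf p) z * F z $ i - itea_numerator F (\<xi> p) p k (cf p) z $ i"
    using nz by (simp add: itea_def cf_def[symmetric] right_diff_distrib Let_def)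
  also have "\<dots> = node_poly (\<xi> p) 1 p z * J i (\<lambda>w. itea_denominator (\<xi> p) k (cf p) w / ((w - z) * node_poly (\<xi> p) 1 p w))"
    by (rule itea_error[where N="p + k"]) (use assms in auto)
  finally show ?thesis using nz by (simp add: field_simps)
qed

lemma denominator_lower_bound:
  assumes "compact C\<^sub>0" "C\<^sub>0 \<subseteq> U"
  obtains \<delta> where "\<delta> > 0" "\<forall>\<^sub>F p in sequentially. \<forall>c. itea_coeffs ip q F (\<xi> p) p k c \<longrightarrow>
    (\<forall>z\<in>C\<^sub>0. \<delta> \<le> cmod (itea_denominator (\<xi> p) k c z))"
proof -
  obtain \<delta> where \<delta>: "\<delta> > 0" "\<And>z. z \<in> C\<^sub>0 \<Longrightarrow> \<delta> \<le> cmod (P\<^sub>0 z)" using P0_away_from_0[OF assms] by metis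
  have "\<forall>\<^sub>F p in sequentially. \<forall>c. itea_coeffs ip q F (\<xi> p) p k c \<longrightarrow>
    (\<forall>z\<in>C\<^sub>0. cmod (itea_denominator (\<xi> p) k c z - P\<^sub>0 z) \<le> \<delta> / 2)"
    using \<delta> assms by (intro denominator_uniform) auto
  then have "\<forall>\<^sub>F p in sequentially. \<forall>c. itea_coeffs ip q F (\<xi> p) p k c \<longrightarrow>
    (\<forall>z\<in>C\<^sub>0. \<delta> / 2 \<le> cmod (itea_denominator (\<xi> p) k c z))"
  proof eventually_elim
    case (elim p)
    show ?case
    proof (intro allI impI ballI)
      fix c z assume c: "itea_coeffs ip q F (\<xi> p) p k c" and z: "z \<in> C\<^sub>0"
      have "cmod (itea_denominator (\<xi> p) k c z - P\<^sub>0 z) \<le> \<delta> / 2" using elim c z by blast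
      then show "\<delta> / 2 \<le> cmod (itea_denominator (\<xi> p) k c z)"
        using \<delta>(2)[OF z] norm_triangle_ineq2[of "P\<^sub>0 z" "itea_denominator (\<xi> p) k c z"] by (simp add: norm_minus_commute)
    qed
  qed
  then show ?thesis using \<delta> by (intro that[of "\<delta> / 2"]) auto
qed

text \<open>Division by the denominator is harmless, since its limit \<open>P\<^sub>0\<close> has no
  zero on \<open>C\<^sub>0\<close>. The factor \<psi>_{1,p}(z) is kept as it stands, so that the
  bound is usable on E, among the nodes, as well.\<close>

lemma error_bound:
  assumes C0: "compact C\<^sub>0" "C\<^sub>0 \<subseteq> U" and nrm: "is_vector_norm nrm"
  shows "\<exists>D\<ge>0. \<forall>\<^sub>F p in sequentially. \<forall>z\<in>C\<^sub>0.
     nrm (F z - itea ip q F (\<xi> p) p k z) \<le> D * (cmod (node_poly (\<xi> p) 1 p z) / M p)"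
proof -
  obtain D where D: "D \<ge> 0" and ev: "\<forall>\<^sub>F p in sequentially. \<forall>c. itea_coeffs ip q F (\<xi> p) p k c \<longrightarrow> (\<forall>z\<in>C\<^sub>0. \<forall>i.
     cmod (J i (\<lambda>w. itea_denominator (\<xi> p) k c w / ((w - z) * node_poly (\<xi> p) 1 p w))) \<le> D / M p)"
    using error_functional_bound[OF C0] by blast
  obtain \<delta> where \<delta>: "\<delta> > 0" and ev2: "\<forall>\<^sub>F p in sequentially. \<forall>c. itea_coeffs ip q F (\<xi> p) p k c \<longrightarrow>
    (\<forall>z\<in>C\<^sub>0. \<delta> \<le> cmod (itea_denominator (\<xi> p) k c z))"
    by (rule denominator_lower_bound[OF C0]) (rule that)
  define A where "A = (\<Sum>i\<in>UNIV. nrm (axis i 1 :: complex ^ 'n))"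
  have A0: "nrm x \<ge> 0" for x using nrm unfolding is_vector_norm_def by blast
  have "\<forall>\<^sub>F p in sequentially. \<forall>z\<in>C\<^sub>0.
     nrm (F z - itea ip q F (\<xi> p) p k z) \<le> (D / \<delta> * A) * (cmod (node_poly (\<xi> p) 1 p z) / M p)"
    using ev ev2 unique_coeffs nodes_U consecutive eventually_ge_at_top[of k] M_pos
  proof eventually_elim
    case (elim p)
    note c = cf[OF elim(3)]
    show ?case
    proof
      fix z assume z: "z \<in> C\<^sub>0"
      have Q: "\<delta> \<le> cmod (itea_denominator (\<xi> p) k (cf p) z)" using elim(2) c z by blast
      have "cmod ((F z - itea ip q F (\<xi> p) p k z) $ i) \<le> cmod (node_poly (\<xi> p) 1 p z) / \<delta> * (D / M p)" for i
      proof -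
        have "(F z - itea ip q F (\<xi> p) p k z) $ i =
          node_poly (\<xi> p) 1 p z / itea_denominator (\<xi> p) k (cf p) z *
          J i (\<lambda>w. itea_denominator (\<xi> p) k (cf p) w / ((w - z) * node_poly (\<xi> p) 1 p w))"
          by (rule itea_error_formula) (use elim z C0 Q \<delta> in auto)
        then show ?thesis
          unfolding norm_mult norm_divide
          using elim(1) c z Q \<delta> elim(7) by (simp only: norm_mult norm_divide) (intro mult_mono frac_le, auto)
      qed
      then have "nrm (F z - itea ip q F (\<xi> p) p k z) \<le>
        (\<Sum>i\<in>UNIV. (cmod (node_poly (\<xi> p) 1 p z) / \<delta> * (D / M p)) * nrm (axis i 1 :: complex ^ 'n))"
        by (intro order.trans[OF vector_norm_le[OF nrm] sum_mono] mult_right_mono A0)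
      then show "nrm (F z - itea ip q F (\<xi> p) p k z) \<le> (D / \<delta> * A) * (cmod (node_poly (\<xi> p) 1 p z) / M p)"
        by (simp add: A_def sum_distrib_left sum_distrib_right sum_divide_distrib mult_ac)
    qed
  qed
  moreover have "A \<ge> 0" unfolding A_def by (intro sum_nonneg A0)
  then have "D / \<delta> * A \<ge> 0" using D \<delta> by simp
  ultimately show ?thesis by blast
qed

section \<open>Leading term of the error\<close>

lemma denominator_tendsto: "(\<lambda>p. itea_denominator (\<xi> p) k (cf p) w) \<longlonglongrightarrow> P\<^sub>0 w"
proof (rule tendstoI)
  fix e :: real assume e: "e > 0"
  have "\<forall>\<^sub>F p in sequentially. \<forall>c. itea_coeffs ip q F (\<xi> p) p k c \<longrightarrow>
    (\<forall>w\<in>{w}. cmod (itea_denominator (\<xi> p) k c w - P\<^sub>0 w) \<le> e / 2)"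
    by (rule denominator_uniform) (use e in auto)
  with unique_coeffs show "\<forall>\<^sub>F p in sequentially. dist (itea_denominator (\<xi> p) k (cf p) w) (P\<^sub>0 w) < e"
  proof eventually_elim
    case (elim p)
    have "cmod (itea_denominator (\<xi> p) k (cf p) w - P\<^sub>0 w) \<le> e / 2" using elim(2) cf[OF elim(1)] by blast
    then show ?case using e by (simp add: dist_norm)
  qed
qed

text \<open>The exact form of what \<open>orthogonal_values_small\<close> estimates; the refined
  asymptotics needs its leading term.\<close>

lemma denominator_value:
  assumes "\<xi> p ` {1..p + k} \<subseteq> U" "equal_points_consecutive (p + k) (\<xi> p)" "k \<le> p"
    "itea_coeffs ip q F (\<xi> p) p k c" "i \<in> {1..k}"
  shows "ip q (v i) * itea_denominator (\<xi> p) k c (zs i) / \<Psi> p (zs i) =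
    W\<^sub>1 (\<lambda>w. itea_denominator (\<xi> p) k c w * lag i w / \<Psi> p w)"
  unfolding itea_denominator_poly
proof (rule orthogonal_value[OF _ assms(5)])
  fix S :: "complex poly" assume S: "\<And>n. n \<ge> k \<Longrightarrow> coeff S n = 0"
  show "W (\<lambda>w. poly (\<Sum>j\<le>k. Polynomial.smult (c j) (root_poly (\<xi> p) {1..j})) w * poly S w / \<Psi> p w) = 0"
    unfolding W_def itea_denominator_poly[symmetric]
    by (rule itea_orthogonality[where ip=ip and q=q and \<omega>=\<omega> and S=S])
       (use assms S ip in \<open>auto simp: itea_coeffs_iff\<close>)
qed

text \<open>The support without z_1, ..., z_{k+1}. When z_{k+1} is the only pole on its level,
  |\<Psi>_p(z_{k+1})| is negligible against |\<Psi>_p| there.\<close>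

definition "L\<^sub>2 = L\<^sub>0 \<union> zs ` {k + 2..\<mu>}"
definition "J\<^sub>2 i g = \<Lambda> i g - (\<Sum>s=k + 2..\<mu>. v s $ i * g (zs s))"
definition "W\<^sub>2 g = (\<Sum>i\<in>UNIV. \<omega> i * J\<^sub>2 i g)"

lemma J2: "bounded_functional L\<^sub>2 (J\<^sub>2 i)"
  unfolding J\<^sub>2_def[abs_def] L\<^sub>2_def by (rule bounded_functional_minus_point_masses[OF \<Lambda>]) simp

lemma W2: "bounded_functional L\<^sub>2 W\<^sub>2"
  unfolding W\<^sub>2_def[abs_def] by (rule bounded_functional_combination[OF _ J2]) simp

lemma L2_subset: "L\<^sub>2 \<subseteq> L"
  unfolding L_def L\<^sub>2_def by auto

lemma J1_split:
  assumes "k < \<mu>" shows "J\<^sub>1 i g = J\<^sub>2 i g - v (k + 1) $ i * g (zs (k + 1))"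
proof -
  have "{k + 1..\<mu>} = insert (k + 1) {k + 2..\<mu>}" using assms by auto
  then show ?thesis by (simp add: J\<^sub>1_def J\<^sub>2_def)
qed

lemma W1_split:
  assumes "k < \<mu>" shows "W\<^sub>1 g = W\<^sub>2 g - ip q (v (k + 1)) * g (zs (k + 1))"
  unfolding W\<^sub>1_def W\<^sub>2_def J1_split[OF assms] ip
  by (simp only: right_diff_distrib sum_subtractf sum_distrib_right mult.assoc)

text \<open>Up to the factor \<open>P\<^sub>0 (zs (k + 1)) / P\<^sub>0 z\<close> this is component i
  of B in its determinant-free form. It depends on p through the tails only.\<close>

definition "leading p i z = tail p (zs (k + 1)) / (z - zs (k + 1)) * v (k + 1) $ i -
  (\<Sum>s=1..k. ip q (v (k + 1)) / ip q (v s) * lag s (zs (k + 1)) * (tail p (zs s) / (z - zs s) * v s $ i))"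

text \<open>
  The value of the denominator at \<open>z\<^sub>s\<close>, \<open>s \<le> k\<close>, is of the order \<open>\<Psi> p z\<^sub>s / \<Psi> p z\<^sub>k\<^sub>+\<^sub>1\<close>, so the masses at
  \<open>z\<^sub>1, \<dots>, z\<^sub>k\<^sub>+\<^sub>1\<close> all contribute to the leading term, and the rest of \<open>J\<close> does not.
\<close>

lemma error_functional_leading_term:
  assumes k\<mu>: "k < \<mu>" and eps: "\<epsilon> \<longlonglongrightarrow> 0" and z: "z \<in> U"
    and small: "\<forall>\<^sub>F p in sequentially. \<forall>w\<in>L\<^sub>2. cmod (\<Psi> p (zs (k + 1))) \<le> \<epsilon> p * cmod (\<Psi> p w)"
  defines "Q \<equiv> \<lambda>p. itea_denominator (\<xi> p) k (cf p)"
  shows "(\<lambda>p. \<Psi> p (zs (k + 1)) * J i (\<lambda>w. Q p w / ((w - z) * node_poly (\<xi> p) 1 p w))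
      - P\<^sub>0 (zs (k + 1)) * leading p i z) \<longlonglongrightarrow> 0"
proof -
  let ?m = "\<lambda>p. \<Psi> p (zs (k + 1))"
  have z1L: "zs (k + 1) \<in> L" using zs_in_L[of "k + 1"] k\<mu> by simp
  \<comment> \<open>Whatever is integrated against 1 / \<Psi>_p over the support without z_1, ...,
    z_{k+1} becomes negligible when multiplied by \<Psi>_p(z_{k+1}).\<close>
  have null: "(\<lambda>p. ?m p * N (\<lambda>w. h p w / \<Psi> p w)) \<longlonglongrightarrow> 0"
    if N: "bounded_functional L\<^sub>2 N" and h: "\<forall>\<^sub>F p in sequentially. \<forall>w\<in>L\<^sub>2. cmod (h p w) \<le> H" and H: "H \<ge> 0"
      and cont: "\<And>p. continuous_on L\<^sub>2 (h p)" for N h H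
  proof -
    obtain B where B': "\<forall>g m. continuous_on L\<^sub>2 g \<longrightarrow> 0 \<le> m \<longrightarrow> (\<forall>w\<in>L\<^sub>2. cmod (g w) \<le> m) \<longrightarrow> cmod (N g) \<le> B * m"
      using bounded_functional_bound[OF N] by (elim exE conjE)
    show ?thesis
    proof (rule Lim_null_comparison)
      have "(\<lambda>p. B * (H * \<bar>\<epsilon> p\<bar>)) \<longlonglongrightarrow> B * (H * 0)"
        by (intro tendsto_mult tendsto_const tendsto_rabs_zero eps)
      then show "(\<lambda>p. B * (H * \<bar>\<epsilon> p\<bar>)) \<longlonglongrightarrow> 0" by simp
      show "\<forall>\<^sub>F p in sequentially. cmod (?m p * N (\<lambda>w. h p w / \<Psi> p w)) \<le> B * (H * \<bar>\<epsilon> p\<bar>)"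
        using h small nodes_U
      proof eventually_elim
        case (elim p)
        have m0: "cmod (?m p) > 0" using \<Psi>_nonzero[OF elim(3) z1L] by simp
        have "cmod (N (\<lambda>w. h p w / \<Psi> p w)) \<le> B * (H * \<bar>\<epsilon> p\<bar> / cmod (?m p))"
        proof (rule B'[rule_format])
          show "continuous_on L\<^sub>2 (\<lambda>w. h p w / \<Psi> p w)"
            using \<Psi>_nonzero[OF elim(3)] L2_subset by (intro continuous_intros cont) auto
          show "0 \<le> H * \<bar>\<epsilon> p\<bar> / cmod (?m p)" using H by simp
          fix w assume w: "w \<in> L\<^sub>2"
          have w0: "cmod (\<Psi> p w) > 0" using \<Psi>_nonzero[OF elim(3)] L2_subset w by auto
          have "cmod (?m p) \<le> \<epsilon> p * cmod (\<Psi> p w)" using elim(2) w by blast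
          also have "\<dots> \<le> \<bar>\<epsilon> p\<bar> * cmod (\<Psi> p w)" by (intro mult_right_mono) auto
          finally have "1 / cmod (\<Psi> p w) \<le> \<bar>\<epsilon> p\<bar> / cmod (?m p)"
            using w0 m0 by (simp add: pos_divide_le_eq pos_le_divide_eq)
          then have "cmod (h p w) * (1 / cmod (\<Psi> p w)) \<le> H * (\<bar>\<epsilon> p\<bar> / cmod (?m p))"
            using elim(1) w H by (intro mult_mono) auto
          then show "cmod (h p w / \<Psi> p w) \<le> H * \<bar>\<epsilon> p\<bar> / cmod (?m p)" by (simp add: norm_divide)
        qed
        then have "cmod (?m p) * cmod (N (\<lambda>w. h p w / \<Psi> p w)) \<le> cmod (?m p) * (B * (H * \<bar>\<epsilon> p\<bar> / cmod (?m p)))"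
          by (intro mult_left_mono) auto
        then show ?case using m0 by (simp add: norm_mult)
      qed
    qed
  qed
  obtain H where H: "H \<ge> 1" "\<And>w. w \<in> L \<Longrightarrow> cmod (P\<^sub>0 w) \<le> H" "\<And>w i. w \<in> L \<Longrightarrow> i \<in> {1..k} \<Longrightarrow> cmod (lag i w) \<le> H"
    using Lagrange_bounds[OF compact_L] by metis
  obtain T where T: "T \<ge> 0" "\<forall>\<^sub>F p in sequentially. \<forall>w\<in>L. cmod (tail p w) \<le> T"
    by (rule tail_bounded[OF compact_L]) (rule that)
  have zU: "compact {z}" "{z} \<subseteq> U" using z by auto
  obtain d where d: "d > 0" "\<And>w. w \<in> L \<Longrightarrow> d \<le> cmod (w - z)"
    using distance_from_L[OF zU] by (metis singletonI)
  have wz: "w \<noteq> z" if "w \<in> L" for w using d that by fastforce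
  have evQ: "\<forall>\<^sub>F p in sequentially. \<forall>c. itea_coeffs ip q F (\<xi> p) p k c \<longrightarrow>
    (\<forall>w\<in>L. cmod (itea_denominator (\<xi> p) k c w - P\<^sub>0 w) \<le> 1)"
    by (rule denominator_uniform[OF compact_L]) simp
  have Qb: "\<forall>\<^sub>F p in sequentially. \<forall>w\<in>L. cmod (Q p w) \<le> H + 1"
    using evQ unique_coeffs
  proof eventually_elim
    case (elim p)
    show ?case
    proof
      fix w assume w: "w \<in> L"
      have "cmod (Q p w - P\<^sub>0 w) \<le> 1" unfolding Q_def using elim(1) cf[OF elim(2)] w by blast
      then show "cmod (Q p w) \<le> H + 1" using H(2)[OF w] norm_triangle_ineq2[of "Q p w" "P\<^sub>0 w"] by linarith
    qed
  qed
  have Qlim: "(\<lambda>p. Q p w) \<longlonglongrightarrow> P\<^sub>0 w" for w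
    unfolding Q_def by (rule denominator_tendsto)
  define b where "b = (\<lambda>s. ip q (v (k + 1)) / ip q (v s) * lag s (zs (k + 1)))"
  \<comment> \<open>Q(z_s) rescaled by \<Psi>_p(z_{k+1}) / \<Psi>_p(z_s): the amplitude with which
    the mass at z_s enters the leading term.\<close>
  define y where "y = (\<lambda>p s. Q p (zs s) * ?m p / \<Psi> p (zs s))"
  \<comment> \<open>Orthogonality to the Lagrange polynomial of z_s: the rest of the support is
    negligible, so the mass at z_{k+1} has to balance the one at z_s, and this fixes the limit of
    the amplitude.\<close>
  have ylim: "(\<lambda>p. y p s + P\<^sub>0 (zs (k + 1)) * b s) \<longlonglongrightarrow> 0" if s: "s \<in> {1..k}" for s
  proof -
    have "\<forall>\<^sub>F p in sequentially. \<forall>w\<in>L\<^sub>2. cmod (Q p w * lag s w) \<le> (H + 1) * H"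
      using Qb
    proof eventually_elim
      case (elim p)
      show ?case
        unfolding norm_mult using elim H(1) H(3)[OF _ s] L2_subset by (intro ballI mult_mono) auto
    qed
    then have A: "(\<lambda>p. ?m p * W\<^sub>2 (\<lambda>w. Q p w * lag s w / \<Psi> p w)) \<longlonglongrightarrow> 0"
      by (rule null[OF W2]) (use H in \<open>auto simp: Q_def intro!: continuous_intros\<close>)
    have "(\<lambda>p. (?m p * W\<^sub>2 (\<lambda>w. Q p w * lag s w / \<Psi> p w) - ip q (v (k + 1)) * (Q p (zs (k + 1)) * lag s (zs (k + 1)))) / ip q (v s))
       \<longlonglongrightarrow> (0 - ip q (v (k + 1)) * (P\<^sub>0 (zs (k + 1)) * lag s (zs (k + 1)))) / ip q (v s)"
      using qv[OF s] by (intro tendsto_intros A Qlim) auto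
    moreover have "\<forall>\<^sub>F p in sequentially. (?m p * W\<^sub>2 (\<lambda>w. Q p w * lag s w / \<Psi> p w) - ip q (v (k + 1)) * (Q p (zs (k + 1)) * lag s (zs (k + 1)))) / ip q (v s) = y p s"
      using nodes_U consecutive eventually_ge_at_top[of k] unique_coeffs
    proof eventually_elim
      case (elim p)
      have m0: "?m p \<noteq> 0" using \<Psi>_nonzero[OF elim(1) z1L] .
      have "ip q (v s) * Q p (zs s) / \<Psi> p (zs s) = W\<^sub>1 (\<lambda>w. Q p w * lag s w / \<Psi> p w)"
        unfolding Q_def by (rule denominator_value[OF elim(1-3) cf[OF elim(4)] s])
      also have "\<dots> = W\<^sub>2 (\<lambda>w. Q p w * lag s w / \<Psi> p w) - ip q (v (k + 1)) * (Q p (zs (k + 1)) * lag s (zs (k + 1)) / ?m p)"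
        by (rule W1_split[OF k\<mu>])
      finally have "?m p * (ip q (v s) * Q p (zs s) / \<Psi> p (zs s)) = ?m p * (\<dots>)" by (rule arg_cong)
      also have "\<dots> = ?m p * W\<^sub>2 (\<lambda>w. Q p w * lag s w / \<Psi> p w) - ip q (v (k + 1)) * (Q p (zs (k + 1)) * lag s (zs (k + 1)))"
        using m0 by (simp add: right_diff_distrib)
      finally have e: "\<dots> = ip q (v s) * y p s" by (simp add: y_def mult_ac)
      show ?case unfolding e using qv[OF s] by simp
    qed
    ultimately have "(\<lambda>p. y p s) \<longlonglongrightarrow> (0 - ip q (v (k + 1)) * (P\<^sub>0 (zs (k + 1)) * lag s (zs (k + 1)))) / ip q (v s)"
      by (rule Lim_transform_eventually)
    then have "(\<lambda>p. y p s + P\<^sub>0 (zs (k + 1)) * b s) \<longlonglongrightarrow>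
      (0 - ip q (v (k + 1)) * (P\<^sub>0 (zs (k + 1)) * lag s (zs (k + 1)))) / ip q (v s) + P\<^sub>0 (zs (k + 1)) * b s"
      by (intro tendsto_add tendsto_const)
    then show ?thesis by (simp add: b_def mult_ac)
  qed
  have "\<forall>\<^sub>F p in sequentially. \<forall>w\<in>L\<^sub>2. cmod (Q p w * tail p w / (w - z)) \<le> (H + 1) * T / d"
    using Qb T(2)
  proof eventually_elim
    case (elim p)
    show ?case
      unfolding norm_mult norm_divide using elim H(1) T(1) d L2_subset by (intro ballI mult_mono frac_le) auto
  qed
  then have A: "(\<lambda>p. ?m p * J\<^sub>2 i (\<lambda>w. Q p w * tail p w / (w - z) / \<Psi> p w)) \<longlonglongrightarrow> 0"
    by (rule null[OF J2]) (use H T d wz L2_subset in \<open>auto simp: Q_def intro!: continuous_intros\<close>)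
  have tl: "\<forall>\<^sub>F p in sequentially. cmod (tail p (zs s) / (z - zs s) * v s $ i) \<le> T / cmod (z - zs s) * cmod (v s $ i)"
    if "s \<in> {1..\<mu>}" for s
    using T(2)
  proof eventually_elim
    case (elim p)
    then show ?case using zs_in_L[OF that] by (simp add: norm_mult norm_divide mult_right_mono divide_right_mono)
  qed
  have B: "(\<lambda>p. (Q p (zs (k + 1)) - P\<^sub>0 (zs (k + 1))) * (tail p (zs (k + 1)) / (z - zs (k + 1)) * v (k + 1) $ i)) \<longlonglongrightarrow> 0"
    using k\<mu> by (intro tendsto_null_times_bounded[OF _ tl] LIM_zero Qlim) auto
  have C: "(\<lambda>p. \<Sum>s=1..k. (y p s + P\<^sub>0 (zs (k + 1)) * b s) * (tail p (zs s) / (z - zs s) * v s $ i)) \<longlonglongrightarrow> (\<Sum>s=1..k. 0)"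
    using k by (intro tendsto_sum tendsto_null_times_bounded[OF ylim tl]) auto
  \<comment> \<open>The rest of the support, the mass at z_{k+1}, and the masses at z_1, ..., z_k,
    the last two minus their shares of the leading term.\<close>
  have ABC: "(\<lambda>p. ?m p * J\<^sub>2 i (\<lambda>w. Q p w * tail p w / (w - z) / \<Psi> p w) +
      (Q p (zs (k + 1)) - P\<^sub>0 (zs (k + 1))) * (tail p (zs (k + 1)) / (z - zs (k + 1)) * v (k + 1) $ i) +
      (\<Sum>s=1..k. (y p s + P\<^sub>0 (zs (k + 1)) * b s) * (tail p (zs s) / (z - zs s) * v s $ i))) \<longlonglongrightarrow> 0"
    using tendsto_add[OF tendsto_add[OF A B] C] by simp
  show ?thesis
  proof (rule Lim_transform_eventually[OF ABC])
    show "\<forall>\<^sub>F p in sequentially. ?m p * J\<^sub>2 i (\<lambda>w. Q p w * tail p w / (w - z) / \<Psi> p w) +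
      (Q p (zs (k + 1)) - P\<^sub>0 (zs (k + 1))) * (tail p (zs (k + 1)) / (z - zs (k + 1)) * v (k + 1) $ i) +
      (\<Sum>s=1..k. (y p s + P\<^sub>0 (zs (k + 1)) * b s) * (tail p (zs s) / (z - zs s) * v s $ i))
      = ?m p * J i (\<lambda>w. Q p w / ((w - z) * node_poly (\<xi> p) 1 p w)) - P\<^sub>0 (zs (k + 1)) * leading p i z"
      using nodes_U
    proof eventually_elim
      case (elim p)
      have m0: "?m p \<noteq> 0" using \<Psi>_nonzero[OF elim z1L] .
      let ?g = "\<lambda>w. Q p w * tail p w / (w - z) / \<Psi> p w"
      have n0: "node_poly (\<xi> p) 1 p w \<noteq> 0" if "w \<in> L" for w
        using \<Psi>_nonzero[OF elim that] \<Psi>_split[of p w] by auto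
      have "J i (\<lambda>w. Q p w / ((w - z) * node_poly (\<xi> p) 1 p w)) = J i ?g"
      proof (rule bounded_functional_cong[OF J])
        show "continuous_on L (\<lambda>w. Q p w / ((w - z) * node_poly (\<xi> p) 1 p w))"
          using wz n0 by (auto simp: Q_def intro!: continuous_intros)
        show "continuous_on L ?g"
          using wz \<Psi>_nonzero[OF elim] by (auto simp: Q_def intro!: continuous_intros)
      qed (rule error_integrand[OF elim])
      also have "\<dots> = J\<^sub>2 i ?g - v (k + 1) $ i * ?g (zs (k + 1)) - (\<Sum>s=1..k. v s $ i * ?g (zs s))"
        unfolding J_split J1_split[OF k\<mu>] ..
      finally have J: "J i (\<lambda>w. Q p w / ((w - z) * node_poly (\<xi> p) 1 p w)) = \<dots>" .
      \<comment> \<open>The kernel contains z_s - z, the leading term z - z_s; this sign cancels the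
        minus of the point masses.\<close>
      have g1: "?m p * (v (k + 1) $ i * ?g (zs (k + 1))) = - (Q p (zs (k + 1)) * (tail p (zs (k + 1)) / (z - zs (k + 1)) * v (k + 1) $ i))"
      proof -
        have "tail p (zs (k + 1)) / (z - zs (k + 1)) = - (tail p (zs (k + 1)) / (zs (k + 1) - z))"
          by (metis minus_diff_eq minus_divide_right)
        then show ?thesis using m0 by (simp add: mult_ac)
      qed
      have gs: "?m p * (v s $ i * ?g (zs s)) = - (y p s * (tail p (zs s) / (z - zs s) * v s $ i))" for s
      proof -
        have "tail p (zs s) / (z - zs s) = - (tail p (zs s) / (zs s - z))"
          by (metis minus_diff_eq minus_divide_right)
        then show ?thesis by (simp add: y_def mult_ac)
      qed
      have l: "P\<^sub>0 (zs (k + 1)) * leading p i z = P\<^sub>0 (zs (k + 1)) * (tail p (zs (k + 1)) / (z - zs (k + 1)) * v (k + 1) $ i)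
         - (\<Sum>s=1..k. P\<^sub>0 (zs (k + 1)) * b s * (tail p (zs s) / (z - zs s) * v s $ i))"
        unfolding leading_def b_def right_diff_distrib sum_distrib_left by (simp only: mult.assoc)
      have "?m p * J i (\<lambda>w. Q p w / ((w - z) * node_poly (\<xi> p) 1 p w)) =
        ?m p * J\<^sub>2 i ?g - ?m p * (v (k + 1) $ i * ?g (zs (k + 1))) - (\<Sum>s=1..k. ?m p * (v s $ i * ?g (zs s)))"
        unfolding J by (simp only: right_diff_distrib sum_distrib_left)
      also have "\<dots> = ?m p * J\<^sub>2 i ?g + Q p (zs (k + 1)) * (tail p (zs (k + 1)) / (z - zs (k + 1)) * v (k + 1) $ i)
          + (\<Sum>s=1..k. y p s * (tail p (zs s) / (z - zs s) * v s $ i))"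
        unfolding g1 unfolding gs sum_negf by simp
      finally show ?case
        unfolding l by (simp only: left_diff_distrib distrib_right sum.distrib) simp
    qed
  qed
qed

text \<open>The tails need not converge, as the last k nodes of a row may move with p; they are only
  bounded. This is why the coefficient in the asymptotics depends on p.\<close>

lemma leading_bounded:
  assumes "k < \<mu>" "z \<in> U"
  shows "\<exists>A. \<forall>\<^sub>F p in sequentially. cmod (leading p i z) \<le> A"
proof -
  obtain T where T: "T \<ge> 0" "\<forall>\<^sub>F p in sequentially. \<forall>w\<in>L. cmod (tail p w) \<le> T"
    by (rule tail_bounded[OF compact_L]) (rule that)
  let ?t = "\<lambda>s. T / cmod (z - zs s) * cmod (v s $ i)"
  have "\<forall>\<^sub>F p in sequentially. cmod (leading p i z) \<le> ?t (k + 1) + (\<Sum>s=1..k. cmod (ip q (v (k + 1)) / ip q (v s) * lag s (zs (k + 1))) * ?t s)"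
    using T(2)
  proof eventually_elim
    case (elim p)
    have t: "cmod (tail p (zs s) / (z - zs s) * v s $ i) \<le> ?t s" if "s \<in> {1..\<mu>}" for s
      using elim zs_in_L[OF that] by (simp add: norm_mult norm_divide mult_right_mono divide_right_mono)
    have "cmod (\<Sum>s=1..k. ip q (v (k + 1)) / ip q (v s) * lag s (zs (k + 1)) * (tail p (zs s) / (z - zs s) * v s $ i))
       \<le> (\<Sum>s=1..k. cmod (ip q (v (k + 1)) / ip q (v s) * lag s (zs (k + 1))) * ?t s)"
    proof (intro order.trans[OF norm_sum sum_mono])
      fix s assume "s \<in> {1..k}"
      then have s: "s \<in> {1..\<mu>}" using k by simp
      show "cmod (ip q (v (k + 1)) / ip q (v s) * lag s (zs (k + 1)) * (tail p (zs s) / (z - zs s) * v s $ i))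
        \<le> cmod (ip q (v (k + 1)) / ip q (v s) * lag s (zs (k + 1))) * ?t s"
        unfolding norm_mult[of "ip q (v (k + 1)) / ip q (v s) * lag s (zs (k + 1))"]
        by (intro mult_left_mono t s norm_ge_zero)
    qed
    moreover have "cmod (tail p (zs (k + 1)) / (z - zs (k + 1)) * v (k + 1) $ i) \<le> ?t (k + 1)"
      using assms by (intro t) simp
    ultimately show ?case unfolding leading_def by (intro norm_triangle_le_diff add_mono)
  qed
  then show ?thesis by (rule exI)
qed

lemma itea_B_component:
  "itea_B ip q v zs (\<xi> p) p k z $ i = P\<^sub>0 (zs (k + 1)) / P\<^sub>0 z * leading p i z"
proof -
  have "itea_B ip q v zs (\<xi> p) p k z = (\<Prod>i=1..k. (zs (k + 1) - zs i) / (z - zs i)) *s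
      (e_hat v zs (\<xi> p) p k (k + 1) z - (\<Sum>s=1..k. (ip q (v (k + 1)) / ip q (v s) * lag s (zs (k + 1))) *s e_hat v zs (\<xi> p) p k s z))"
    by (rule itea_B_eq[OF injk]) (rule qv)
  then show ?thesis
    by (simp only: vector_smult_component vector_minus_component sum_component e_hat_def P\<^sub>0_def leading_def prod_dividef)
qed

text \<open>The remainder \<eta> has two sources: the functional deviates from its leading term, and
  \<open>1 / Q p z\<close> from \<open>1 / P\<^sub>0 z\<close>. The second is harmless since the
  leading term stays bounded.\<close>

lemma refined_error:
  assumes k\<mu>: "k < \<mu>" and eps: "\<epsilon> \<longlonglongrightarrow> 0" and z: "z \<in> U"
    and small: "\<forall>\<^sub>F p in sequentially. \<forall>w\<in>L\<^sub>2. cmod (\<Psi> p (zs (k + 1))) \<le> \<epsilon> p * cmod (\<Psi> p w)"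
  obtains \<eta> where "\<And>i. \<eta> i \<longlonglongrightarrow> 0"
    "\<forall>\<^sub>F p in sequentially. \<forall>i. (F z - itea ip q F (\<xi> p) p k z) $ i =
       node_poly (\<xi> p) 1 p z / \<Psi> p (zs (k + 1)) * (itea_B ip q v zs (\<xi> p) p k z $ i + \<eta> i p)"
proof -
  define Q where "Q = (\<lambda>p. itea_denominator (\<xi> p) k (cf p))"
  define G where "G = (\<lambda>i p. \<Psi> p (zs (k + 1)) * J i (\<lambda>w. Q p w / ((w - z) * node_poly (\<xi> p) 1 p w)))"
  let ?P1 = "P\<^sub>0 (zs (k + 1))"
  define \<eta> where "\<eta> = (\<lambda>i p. G i p / Q p z - ?P1 / P\<^sub>0 z * leading p i z)"
  have P0z: "P\<^sub>0 z \<noteq> 0" using z U k by (auto simp: P\<^sub>0_def L_def)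
  have Qlim: "(\<lambda>p. Q p z) \<longlonglongrightarrow> P\<^sub>0 z" unfolding Q_def by (rule denominator_tendsto)
  have Qne: "\<forall>\<^sub>F p in sequentially. Q p z \<noteq> 0" by (rule tendsto_imp_eventually_ne[OF Qlim P0z])
  have iQ: "(\<lambda>p. 1 / Q p z - 1 / P\<^sub>0 z) \<longlonglongrightarrow> 0"
    by (rule LIM_zero) (intro tendsto_divide tendsto_const Qlim P0z)
  have "\<eta> i \<longlonglongrightarrow> 0" for i
  proof -
    obtain A where A: "\<forall>\<^sub>F p in sequentially. cmod (leading p i z) \<le> A"
      using leading_bounded[OF k\<mu> z, of i] by blast
    have "(\<lambda>p. G i p - ?P1 * leading p i z) \<longlonglongrightarrow> 0"
      unfolding G_def Q_def by (rule error_functional_leading_term[OF k\<mu> eps z small])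
    then have 1: "(\<lambda>p. (G i p - ?P1 * leading p i z) / Q p z) \<longlonglongrightarrow> 0 / P\<^sub>0 z"
      by (intro tendsto_divide Qlim P0z)
    have 2: "(\<lambda>p. ?P1 * ((1 / Q p z - 1 / P\<^sub>0 z) * leading p i z)) \<longlonglongrightarrow> ?P1 * 0"
      by (intro tendsto_mult tendsto_const tendsto_null_times_bounded[OF iQ A])
    have "(\<lambda>p. (G i p - ?P1 * leading p i z) / Q p z + ?P1 * ((1 / Q p z - 1 / P\<^sub>0 z) * leading p i z)) \<longlonglongrightarrow> 0"
      using tendsto_add[OF 1 2] by simp
    then show ?thesis unfolding \<eta>_def by (simp add: diff_divide_distrib left_diff_distrib right_diff_distrib)
  qed
  moreover have "\<forall>\<^sub>F p in sequentially. \<forall>i. (F z - itea ip q F (\<xi> p) p k z) $ i =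
       node_poly (\<xi> p) 1 p z / \<Psi> p (zs (k + 1)) * (itea_B ip q v zs (\<xi> p) p k z $ i + \<eta> i p)"
    using nodes_U consecutive eventually_ge_at_top[of k] Qne
  proof eventually_elim
    case (elim p)
    have m0: "\<Psi> p (zs (k + 1)) \<noteq> 0" using \<Psi>_nonzero[OF elim(1)] zs_in_L[of "k + 1"] k\<mu> by simp
    show ?case
    proof
      fix i
      have "(F z - itea ip q F (\<xi> p) p k z) $ i = node_poly (\<xi> p) 1 p z / Q p z *
        J i (\<lambda>w. Q p w / ((w - z) * node_poly (\<xi> p) 1 p w))"
        unfolding Q_def by (rule itea_error_formula) (use elim z in \<open>auto simp: Q_def\<close>)
      also have "\<dots> = node_poly (\<xi> p) 1 p z / \<Psi> p (zs (k + 1)) * (G i p / Q p z)"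
        using m0 by (simp add: G_def)
      finally show "(F z - itea ip q F (\<xi> p) p k z) $ i =
         node_poly (\<xi> p) 1 p z / \<Psi> p (zs (k + 1)) * (itea_B ip q v zs (\<xi> p) p k z $ i + \<eta> i p)"
        unfolding itea_B_component \<eta>_def by simp
    qed
  qed
  ultimately show ?thesis by (rule that)
qed

end

section \<open>Growth of the node polynomials\<close>

text \<open>\<kappa> stands for the capacity; its positivity is derived from the node asymptotics in
  \<open>\<kappa>_pos\<close>.\<close>

locale green_nodes =
  fixes E :: "complex set" and g :: "complex \<Rightarrow> real" and \<xi> :: "nat \<Rightarrow> nat \<Rightarrow> complex" and k :: nat and \<kappa> :: real
  assumes compact_E: "compact E" and green: "greens_function E g"
    and no_limit: "\<And>\<zeta>. \<zeta> \<in> - E \<Longrightarrow> \<not> finite_limit_point k \<xi> \<zeta>" "\<not> infinite_limit_point k \<xi>"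
    and nodes: "\<And>C. compact C \<Longrightarrow> C \<subseteq> - E \<Longrightarrow>
      uniform_limit C (\<lambda>p z. root p (cmod (\<Prod>i=1..p + k. z - \<xi> p i))) (\<lambda>z. \<kappa> * green_exp E g z) sequentially"
begin

abbreviation "\<Phi> \<equiv> green_exp E g"
abbreviation "\<Psi> p \<equiv> node_poly (\<xi> p) 1 (p + k)"
abbreviation "tail p \<equiv> node_poly (\<xi> p) (p + 1) (p + k)"

lemma nodes_bounded: "\<exists>B. \<forall>\<^sub>F p in sequentially. \<forall>i\<in>{1..p + k}. cmod (\<xi> p i) \<le> B"
proof -
  obtain B where "\<not> (\<exists>\<^sub>F p in sequentially. \<exists>i\<in>{1..p + k}. cmod (\<xi> p i) > B)"
    using no_limit(2) unfolding infinite_limit_point_def by blast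
  then have "\<forall>\<^sub>F p in sequentially. \<not> (\<exists>i\<in>{1..p + k}. cmod (\<xi> p i) > B)"
    by (simp only: not_frequently)
  then have "\<forall>\<^sub>F p in sequentially. \<forall>i\<in>{1..p + k}. cmod (\<xi> p i) \<le> B"
    by eventually_elim (auto simp: not_less)
  then show ?thesis by (rule exI)
qed

text \<open>Compactness: a large disc without \<open>V\<close> is covered by finitely many discs
  that eventually contain no node, and eventually no node lies outside the large disc.\<close>

lemma nodes_eventually_near:
  assumes V: "open V" "E \<subseteq> V"
  shows "\<forall>\<^sub>F p in sequentially. \<xi> p ` {1..p + k} \<subseteq> V"
proof -
  obtain B where B: "\<forall>\<^sub>F p in sequentially. \<forall>i\<in>{1..p + k}. cmod (\<xi> p i) \<le> B"
    using nodes_bounded by blast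
  let ?K = "cball 0 B - V"
  have K: "compact ?K" using V by (intro compact_diff) auto
  have "\<forall>\<zeta>\<in>?K. \<exists>e. e > 0 \<and> (\<forall>\<^sub>F p in sequentially. \<forall>i\<in>{1..p + k}. \<not> dist (\<xi> p i) \<zeta> < e)"
  proof
    fix \<zeta> assume "\<zeta> \<in> ?K"
    then have "\<zeta> \<in> - E" using V by auto
    then obtain e where "e > 0" "\<not> (\<exists>\<^sub>F p in sequentially. \<exists>i\<in>{1..p + k}. dist (\<xi> p i) \<zeta> < e)"
      using no_limit(1) unfolding finite_limit_point_def by blast
    then show "\<exists>e. e > 0 \<and> (\<forall>\<^sub>F p in sequentially. \<forall>i\<in>{1..p + k}. \<not> dist (\<xi> p i) \<zeta> < e)"
      by (auto simp: not_frequently)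
  qed
  from bchoice[OF this] obtain e where e': "\<forall>\<zeta>\<in>?K. e \<zeta> > 0 \<and> (\<forall>\<^sub>F p in sequentially. \<forall>i\<in>{1..p + k}. \<not> dist (\<xi> p i) \<zeta> < e \<zeta>)"
    by blast
  have e: "e \<zeta> > 0" "\<forall>\<^sub>F p in sequentially. \<forall>i\<in>{1..p + k}. \<not> dist (\<xi> p i) \<zeta> < e \<zeta>" if "\<zeta> \<in> ?K" for \<zeta>
    using bspec[OF e' that] by (rule conjunct1, rule conjunct2)
  have "?K \<subseteq> (\<Union>\<zeta>\<in>?K. ball \<zeta> (e \<zeta>))" using e(1) by force
  then obtain D where D: "D \<subseteq> ?K" "finite D" "?K \<subseteq> (\<Union>\<zeta>\<in>D. ball \<zeta> (e \<zeta>))"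
    using compactE_image[OF K, of ?K "\<lambda>\<zeta>. ball \<zeta> (e \<zeta>)"] by auto
  have "\<forall>\<^sub>F p in sequentially. \<forall>\<zeta>\<in>D. \<forall>i\<in>{1..p + k}. \<not> dist (\<xi> p i) \<zeta> < e \<zeta>"
    using D e(2) by (intro eventually_ball_finite) auto
  with B show ?thesis
  proof eventually_elim
    case (elim p)
    show ?case
    proof
      fix x assume "x \<in> \<xi> p ` {1..p + k}"
      then obtain i where i: "i \<in> {1..p + k}" "x = \<xi> p i" by blast
      show "x \<in> V"
      proof (rule ccontr)
        assume "x \<notin> V"
        then have "x \<in> ?K" using elim(1) i by auto
        then obtain \<zeta> where "\<zeta> \<in> D" "dist x \<zeta> < e \<zeta>" using D(3) by (auto simp: dist_commute)
        then show False using elim(2) i by blast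
      qed
    qed
  qed
qed

section \<open>Continuity and sublevel sets of \<Phi>\<close>

lemma open_complement: "open (- E)"
  using compact_E by (simp add: compact_imp_closed open_Compl)

lemma isCont_g: "z \<notin> E \<Longrightarrow> isCont g z"
  using green unfolding greens_function_def harmonic_on_def
  by (auto intro: differentiable_imp_continuous_within)

lemma \<Phi>_E: "z \<in> E \<Longrightarrow> \<Phi> z = 1"
  by (simp add: green_exp_def)

lemma \<Phi>_gt_1: "z \<notin> E \<Longrightarrow> \<Phi> z > 1"
  using green by (simp add: green_exp_def greens_function_def)

lemma \<Phi>_ge_1: "\<Phi> z \<ge> 1"
  using \<Phi>_E[of z] \<Phi>_gt_1[of z] by (cases "z \<in> E") auto

text \<open>At the boundary the value 1 on E meets the limit exp 0 from outside. Continuity on the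
  whole plane is what makes sublevel sets open or compact without reference to E.\<close>

lemma isCont_\<Phi>: "isCont \<Phi> z"
proof (cases "z \<in> frontier E")
  case True
  have zE: "z \<in> E" using True frontier_subset_closed[OF compact_imp_closed[OF compact_E]] by blast
  have "(g \<longlongrightarrow> 0) (at z within - E)" using green True unfolding greens_function_def by blast
  then have "((\<lambda>w. exp (g w)) \<longlongrightarrow> exp 0) (at z within - E)" by (rule tendsto_exp)
  moreover have "\<forall>\<^sub>F w in at z within - E. exp (g w) = \<Phi> w"
    by (auto simp: eventually_at_filter green_exp_def)
  ultimately have 1: "(\<Phi> \<longlongrightarrow> 1) (at z within - E)"
    using Lim_transform_eventually by fastforce
  have "\<forall>\<^sub>F w in at z within E. 1 = \<Phi> w" by (auto simp: eventually_at_filter green_exp_def)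
  then have 2: "(\<Phi> \<longlongrightarrow> 1) (at z within E)" by (rule Lim_transform_eventually[OF tendsto_const])
  have "(\<Phi> \<longlongrightarrow> 1) (at z within E \<union> - E)" using 1 2 by (rule Lim_Un[rotated])
  then show ?thesis using zE by (simp add: isCont_def \<Phi>_E)
next
  case False
  then consider "z \<in> interior E" | "z \<notin> E"
    using compact_E by (auto simp: frontier_def compact_imp_closed closure_closed)
  then show ?thesis
  proof cases
    case 1
    then have "\<forall>\<^sub>F w in nhds z. w \<in> interior E" by (intro eventually_nhds_in_open) auto
    then have "\<forall>\<^sub>F w in nhds z. \<Phi> w = 1" by eventually_elim (use interior_subset \<Phi>_E in blast)
    then show ?thesis by (subst isCont_cong) auto
  next
    case 2
    then have "\<forall>\<^sub>F w in nhds z. w \<in> - E" using open_complement by (intro eventually_nhds_in_open) auto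
    then have "\<forall>\<^sub>F w in nhds z. \<Phi> w = exp (g w)" by eventually_elim (simp add: green_exp_def)
    moreover have "isCont (\<lambda>w. exp (g w)) z" by (intro continuous_intros isCont_g[OF 2])
    ultimately show ?thesis by (simp only: isCont_cong)
  qed
qed

lemma continuous_\<Phi> [continuous_intros]: "continuous_on S \<Phi>"
  by (simp add: continuous_at_imp_continuous_on isCont_\<Phi>)

lemma bounded_sublevel: "bounded {z. \<Phi> z \<le> \<sigma>}"
proof -
  obtain \<gamma> where "((\<lambda>z. g z - ln (cmod z)) \<longlongrightarrow> \<gamma>) at_infinity"
    using green unfolding greens_function_def by blast
  then have "\<forall>\<^sub>F z in at_infinity. dist (g z - ln (cmod z)) \<gamma> < 1" by (rule tendstoD) simp
  then obtain b where b: "\<And>z. cmod z \<ge> b \<Longrightarrow> dist (g z - ln (cmod z)) \<gamma> < 1"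
    unfolding eventually_at_infinity by blast
  obtain e where e: "\<And>z. z \<in> E \<Longrightarrow> cmod z \<le> e" using compact_imp_bounded[OF compact_E] unfolding bounded_iff by blast
  \<comment> \<open>Beyond the radius b, g exceeds ln |z| + \<gamma> - 1, so \<Phi>(z) \<le>
    \<sigma> forces |z| \<le> \<sigma> exp (1 - \<gamma>); b and 1 take care of small z, and e of
    the points of E.\<close>
  have "cmod z \<le> max (max b 1) (max e (\<sigma> * exp (1 - \<gamma>)))" if "\<Phi> z \<le> \<sigma>" for z
  proof (rule ccontr)
    assume "\<not> ?thesis"
    then have z: "cmod z \<ge> b" "cmod z > 1" "cmod z > e" "cmod z > \<sigma> * exp (1 - \<gamma>)" by auto
    have "z \<notin> E" using e z by fastforce
    have "\<gamma> - 1 + ln (cmod z) < g z" using b[OF z(1)] by (simp add: dist_real_def abs_less_iff)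
    then have "exp (\<gamma> - 1 + ln (cmod z)) < exp (g z)" by (simp only: exp_less_cancel_iff)
    moreover have "cmod z > 0" using z(2) by linarith
    ultimately have "exp (\<gamma> - 1) * cmod z < exp (g z)" by (simp only: exp_add exp_ln)
    also have "exp (g z) \<le> \<sigma>" using that \<open>z \<notin> E\<close> by (simp add: green_exp_def)
    finally have "exp (1 - \<gamma>) * (exp (\<gamma> - 1) * cmod z) < exp (1 - \<gamma>) * \<sigma>"
      by (rule mult_strict_left_mono) simp
    moreover have "exp (1 - \<gamma>) * exp (\<gamma> - 1) = 1" by (subst exp_add[symmetric]) simp
    ultimately have "cmod z < exp (1 - \<gamma>) * \<sigma>" by (simp only: mult.assoc[symmetric] mult_1)
    then show False using z(4) by (simp add: mult.commute)
  qed
  then show ?thesis unfolding bounded_iff by blast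
qed

lemma compact_sublevel: "compact {z. \<Phi> z \<le> \<sigma>}"
  unfolding compact_eq_bounded_closed
  using bounded_sublevel closed_Collect_le[OF continuous_\<Phi> continuous_on_const] by auto

lemma open_sublevel: "open {z. \<Phi> z < \<sigma>}"
  by (rule open_Collect_less[OF continuous_\<Phi> continuous_on_const])

lemma compact_shell: "compact {z. \<tau> \<le> \<Phi> z \<and> \<Phi> z \<le> \<sigma>}"
proof -
  have "closed {z. \<tau> \<le> \<Phi> z}" by (rule closed_Collect_le[OF continuous_on_const continuous_\<Phi>])
  from closed_Int_compact[OF this compact_sublevel[of \<sigma>]] show ?thesis by (simp add: Collect_conj_eq)
qed

section \<open>Exponential bounds from the root asymptotics\<close>

lemma \<Psi>_eq: "(\<Prod>i=1..p + k. z - \<xi> p i) = \<Psi> p z"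
  by (simp add: node_poly_def)

text \<open>At a point with distance at least 1 from all nodes every factor has modulus at least 1,
  so the limit \<kappa> \<Phi>(z) of the roots is at least 1 as well.\<close>

lemma \<kappa>_pos: "\<kappa> > 0"
proof -
  obtain B where B: "\<forall>\<^sub>F p in sequentially. \<forall>i\<in>{1..p + k}. cmod (\<xi> p i) \<le> B"
    using nodes_bounded by blast
  obtain e where e: "\<And>z. z \<in> E \<Longrightarrow> cmod z \<le> e" using compact_imp_bounded[OF compact_E] unfolding bounded_iff by blast
  define z :: complex where "z = of_real (\<bar>e\<bar> + \<bar>B\<bar> + 1)"
  have z: "cmod z = \<bar>e\<bar> + \<bar>B\<bar> + 1" unfolding z_def norm_of_real by simp
  have zE: "z \<notin> E" using e z by fastforce
  have "uniform_limit {z} (\<lambda>p z. root p (cmod (\<Prod>i=1..p + k. z - \<xi> p i))) (\<lambda>z. \<kappa> * \<Phi> z) sequentially"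
    by (rule nodes) (use zE in auto)
  then have lim: "(\<lambda>p. root p (cmod (\<Psi> p z))) \<longlonglongrightarrow> \<kappa> * \<Phi> z"
    unfolding \<Psi>_eq by (rule tendsto_uniform_limitI) simp
  have "\<forall>\<^sub>F p in sequentially. 1 \<le> root p (cmod (\<Psi> p z))"
    using B eventually_gt_at_top[of 0]
  proof eventually_elim
    case (elim p)
    have "1 \<le> (\<Prod>r\<in>{1..p + k}. cmod (z - \<xi> p r))"
    proof (rule prod_ge_1)
      fix r assume "r \<in> {1..p + k}"
      then have "cmod (\<xi> p r) \<le> B" using elim by blast
      then show "1 \<le> cmod (z - \<xi> p r)" using z norm_triangle_ineq2[of z "\<xi> p r"] by linarith
    qed
    then show ?case using elim(2) by (simp add: node_poly_def prod_norm)
  qed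
  from tendsto_lowerbound[OF lim this] have "1 \<le> \<kappa> * \<Phi> z" by simp
  then have "0 < \<kappa> * \<Phi> z" by linarith
  then show ?thesis using \<Phi>_ge_1[of z] by (simp add: zero_less_mult_iff)
qed

text \<open>On a compact set the strict inequality \<tau> < \<Phi> has a positive margin, and
  uniform convergence of the roots fits into it.\<close>

lemma growth_lower:
  assumes C: "compact C" and \<tau>: "\<tau> \<ge> 1" "\<And>w. w \<in> C \<Longrightarrow> \<tau> < \<Phi> w"
  shows "\<forall>\<^sub>F p in sequentially. \<forall>w\<in>C. (\<kappa> * \<tau>) ^ p \<le> cmod (\<Psi> p w)"
proof (cases "C = {}")
  case False
  obtain w0 where w0: "w0 \<in> C" "\<And>w. w \<in> C \<Longrightarrow> \<Phi> w0 \<le> \<Phi> w"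
    using continuous_attains_inf[OF C False continuous_\<Phi>] by blast
  have CE: "C \<subseteq> - E" using \<tau> \<Phi>_E by fastforce
  have "\<kappa> * (\<Phi> w0 - \<tau>) > 0" using \<kappa>_pos \<tau>(2)[OF w0(1)] by simp
  from uniform_limitD[OF nodes[OF C CE] this] eventually_gt_at_top[of 0] show ?thesis
  proof eventually_elim
    case (elim p)
    show ?case
    proof
      fix w assume w: "w \<in> C"
      have "\<bar>root p (cmod (\<Psi> p w)) - \<kappa> * \<Phi> w\<bar> < \<kappa> * (\<Phi> w0 - \<tau>)"
        using elim(1) w unfolding \<Psi>_eq dist_real_def by blast
      moreover have "\<kappa> * \<Phi> w0 \<le> \<kappa> * \<Phi> w" using w0(2)[OF w] \<kappa>_pos by simp
      ultimately have "\<kappa> * \<tau> \<le> root p (cmod (\<Psi> p w))" by (simp add: right_diff_distrib abs_less_iff)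
      then have "(\<kappa> * \<tau>) ^ p \<le> root p (cmod (\<Psi> p w)) ^ p" using \<kappa>_pos \<tau>(1) by (intro power_mono) auto
      then show "(\<kappa> * \<tau>) ^ p \<le> cmod (\<Psi> p w)" using elim(2) by (simp add: real_root_pow_pos2)
    qed
  qed
qed simp

text \<open>The additive error \<kappa> (\<eta> - 1) of uniform convergence turns into the factor
  \<eta> because \<Phi> \<ge> 1.\<close>

lemma growth_upper_\<Psi>:
  assumes C: "compact C" "C \<subseteq> - E" and \<eta>: "\<eta> > 1"
  shows "\<forall>\<^sub>F p in sequentially. \<forall>w\<in>C. cmod (\<Psi> p w) \<le> (\<eta> * \<kappa> * \<Phi> w) ^ p"
proof -
  have "\<kappa> * (\<eta> - 1) > 0" using \<kappa>_pos \<eta> by simp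
  from uniform_limitD[OF nodes[OF C] this] eventually_gt_at_top[of 0] show ?thesis
  proof eventually_elim
    case (elim p)
    show ?case
    proof
      fix w assume w: "w \<in> C"
      have "\<bar>root p (cmod (\<Psi> p w)) - \<kappa> * \<Phi> w\<bar> < \<kappa> * (\<eta> - 1)"
        using elim(1) w unfolding \<Psi>_eq dist_real_def by blast
      moreover have "\<kappa> * (\<eta> - 1) \<le> \<kappa> * (\<eta> - 1) * \<Phi> w"
        using \<Phi>_ge_1[of w] \<kappa>_pos \<eta> by (intro mult_left_mono[of 1 "\<Phi> w", simplified]) auto
      ultimately have "root p (cmod (\<Psi> p w)) \<le> \<kappa> * \<Phi> w + \<kappa> * (\<eta> - 1) * \<Phi> w" by linarith
      also have "\<dots> = \<eta> * \<kappa> * \<Phi> w" by (simp add: algebra_simps)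
      finally have "root p (cmod (\<Psi> p w)) ^ p \<le> (\<eta> * \<kappa> * \<Phi> w) ^ p"
        by (intro power_mono real_root_ge_zero) auto
      then show "cmod (\<Psi> p w) \<le> (\<eta> * \<kappa> * \<Phi> w) ^ p" using elim(2) by (simp add: real_root_pow_pos2)
    qed
  qed
qed

text \<open>If d separates \<open>D\<close> from E, the nodes eventually lie within d / 2 of E, so
  each of the k factors is at least d / 2.\<close>

lemma tail_lower:
  assumes D: "compact D" "D \<subseteq> - E"
  obtains \<delta> where "\<delta> > 0" "\<forall>\<^sub>F p in sequentially. \<forall>z\<in>D. \<delta> \<le> cmod (tail p z)"
proof -
  have "E \<inter> D = {}" using D(2) by blast
  then obtain d where d0: "d > 0" and d': "\<forall>x\<in>E. \<forall>y\<in>D. d \<le> dist x y"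
    using separate_compact_closed[OF compact_E compact_imp_closed[OF D(1)]] by blast
  note d = d0 d'[rule_format]
  let ?V = "\<Union>x\<in>E. ball x (d / 2)"
  have "\<forall>\<^sub>F p in sequentially. \<xi> p ` {1..p + k} \<subseteq> ?V"
    using d by (intro nodes_eventually_near) auto
  then have "\<forall>\<^sub>F p in sequentially. \<forall>z\<in>D. (d / 2) ^ k \<le> cmod (tail p z)"
  proof eventually_elim
    case (elim p)
    show ?case
    proof
      fix z assume z: "z \<in> D"
      have "(d / 2) ^ k = (\<Prod>r\<in>{p + 1..p + k}. d / 2)" by simp
      also have "\<dots> \<le> (\<Prod>r\<in>{p + 1..p + k}. cmod (z - \<xi> p r))"
      proof (intro prod_mono conjI)
        fix r assume "r \<in> {p + 1..p + k}"
        then have "\<xi> p r \<in> ?V" by (intro subsetD[OF elim]) simp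
        then obtain x where x: "x \<in> E" "dist x (\<xi> p r) < d / 2" by auto
        have "dist x z \<le> dist x (\<xi> p r) + dist (\<xi> p r) z" by (rule dist_triangle)
        then show "d / 2 \<le> cmod (z - \<xi> p r)" using x d(2)[OF x(1) z] by (simp add: dist_norm norm_minus_commute)
      qed (use d in auto)
      finally show "(d / 2) ^ k \<le> cmod (tail p z)" by (simp add: node_poly_def prod_norm)
    qed
  qed
  then show ?thesis using d by (intro that[of "(d / 2) ^ k"]) auto
qed

lemma \<Psi>_split: "\<Psi> p w = node_poly (\<xi> p) 1 p w * tail p w"
  using node_poly_split[of 1 p "p + k"] by simp

lemma power_dominates:
  fixes \<eta> c :: real
  assumes "\<eta> > 1" shows "\<forall>\<^sub>F p in sequentially. c \<le> \<eta> ^ p"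
proof -
  have "\<forall>\<^sub>F p in sequentially. c / \<eta> ^ p < 1"
    by (rule order_tendstoD(2)[OF LIMSEQ_divide_realpow_zero[OF assms]]) simp
  then show ?thesis by eventually_elim (use assms in \<open>simp add: divide_less_eq\<close>)
qed

lemma frontier_sublevel: "frontier {z. \<Phi> z \<le> \<tau>} \<subseteq> {z. \<Phi> z = \<tau>}"
proof
  fix x assume x: "x \<in> frontier {z. \<Phi> z \<le> \<tau>}"
  have "closed {z. \<Phi> z \<le> \<tau>}" using compact_sublevel by (rule compact_imp_closed)
  then have x1: "x \<in> {z. \<Phi> z \<le> \<tau>}" "x \<notin> interior {z. \<Phi> z \<le> \<tau>}"
    using x by (auto simp: frontier_def closure_closed)
  have "{z. \<Phi> z < \<tau>} \<subseteq> interior {z. \<Phi> z \<le> \<tau>}"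
    by (rule interior_maximal) (auto intro: open_sublevel)
  then show "x \<in> {z. \<Phi> z = \<tau>}" using x1 by force
qed

lemma growth_upper_away:
  assumes D: "compact D" "D \<subseteq> - E" and \<eta>: "\<eta> > 1"
  shows "\<forall>\<^sub>F p in sequentially. \<forall>z\<in>D. cmod (node_poly (\<xi> p) 1 p z) \<le> (\<eta> * \<kappa> * \<Phi> z) ^ p"
proof -
  \<comment> \<open>One factor \<eta>1 is spent on \<Psi>_p, the other absorbs the constant 1 /
    \<delta> from the tail.\<close>
  define \<eta>1 where "\<eta>1 = sqrt \<eta>"
  have \<eta>1: "\<eta>1 > 1" "\<eta>1 * \<eta>1 = \<eta>" using \<eta> by (auto simp: \<eta>1_def)
  obtain \<delta> where \<delta>: "\<delta> > 0" "\<forall>\<^sub>F p in sequentially. \<forall>z\<in>D. \<delta> \<le> cmod (tail p z)"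
    by (rule tail_lower[OF D]) (rule that)
  show ?thesis
    using growth_upper_\<Psi>[OF D \<eta>1(1)] \<delta>(2) power_dominates[OF \<eta>1(1), of "1 / \<delta>"]
  proof eventually_elim
    case (elim p)
    show ?case
    proof
      fix z assume z: "z \<in> D"
      have nn: "0 \<le> (\<eta>1 * \<kappa> * \<Phi> z) ^ p" using \<eta>1 \<kappa>_pos \<Phi>_ge_1[of z] by (intro zero_le_power mult_nonneg_nonneg) auto
      have "cmod (node_poly (\<xi> p) 1 p z) * \<delta> \<le> cmod (node_poly (\<xi> p) 1 p z) * cmod (tail p z)"
        using elim(2) z by (intro mult_left_mono) auto
      also have "\<dots> = cmod (\<Psi> p z)" by (simp only: \<Psi>_split norm_mult)
      also have "\<dots> \<le> (\<eta>1 * \<kappa> * \<Phi> z) ^ p" using elim(1) z by blast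
      finally have "cmod (node_poly (\<xi> p) 1 p z) \<le> (\<eta>1 * \<kappa> * \<Phi> z) ^ p * (1 / \<delta>)"
        using \<delta>(1) by (simp add: field_simps)
      also have "\<dots> \<le> (\<eta>1 * \<kappa> * \<Phi> z) ^ p * \<eta>1 ^ p" using elim(3) nn by (rule mult_left_mono)
      also have "\<dots> = (\<eta> * \<kappa> * \<Phi> z) ^ p"
        unfolding power_mult_distrib[symmetric] \<eta>1(2)[symmetric] by (simp only: mult_ac)
      finally show "cmod (node_poly (\<xi> p) 1 p z) \<le> (\<eta> * \<kappa> * \<Phi> z) ^ p" .
    qed
  qed
qed

lemma compact_\<Phi>_bound:
  assumes "compact C" obtains S where "S \<ge> 1" "\<And>z. z \<in> C \<Longrightarrow> \<Phi> z \<le> S"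
proof -
  have "bounded (\<Phi> ` C)" by (intro compact_imp_bounded compact_continuous_image continuous_\<Phi> assms)
  then obtain S where S: "\<forall>z\<in>C. \<bar>\<Phi> z\<bar> \<le> S" unfolding bounded_iff by auto
  show ?thesis by (rule that[of "max 1 S"]) (use S in force)+
qed

text \<open>On \<open>E\<close> itself the growth of the node polynomials is controlled by the maximum modulus principle.\<close>

lemma growth_upper:
  assumes C: "compact C" and \<eta>: "\<eta> > 1"
  shows "\<forall>\<^sub>F p in sequentially. \<forall>z\<in>C. cmod (node_poly (\<xi> p) 1 p z) \<le> (\<eta> * \<kappa> * \<Phi> z) ^ p"
proof -
  \<comment> \<open>On the level \<eta>1 the bound (\<eta>1 \<kappa> \<Phi>)^p equals (\<eta>
    \<kappa>)^p; carried inside, it is good enough because \<Phi> \<ge> 1.\<close>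
  define \<eta>1 where "\<eta>1 = sqrt \<eta>"
  have \<eta>1: "\<eta>1 > 1" "\<eta>1 * \<eta>1 = \<eta>" using \<eta> by (auto simp: \<eta>1_def)
  have \<eta>1_le: "\<eta>1 \<le> \<eta>" using \<eta>1 mult_left_mono[of 1 \<eta>1 \<eta>1] by simp
  obtain S where S: "S \<ge> 1" "\<And>z. z \<in> C \<Longrightarrow> \<Phi> z \<le> S" using compact_\<Phi>_bound[OF C] by blast
  \<comment> \<open>The shell reaches up to \<open>max S \<eta>1\<close>, so that it contains the
    level curve \<eta>1 even if \<open>C\<close> lies below it.\<close>
  let ?D = "{z. \<eta>1 \<le> \<Phi> z \<and> \<Phi> z \<le> max S \<eta>1}"
  have DE: "?D \<subseteq> - E" using \<Phi>_E \<eta>1(1) by fastforce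
  show ?thesis
    using growth_upper_away[OF compact_shell DE \<eta>1(1)]
  proof eventually_elim
    case (elim p)
    show ?case
    proof
      fix z assume z: "z \<in> C"
      show "cmod (node_poly (\<xi> p) 1 p z) \<le> (\<eta> * \<kappa> * \<Phi> z) ^ p"
      proof (cases "\<eta>1 \<le> \<Phi> z")
        case True
        then have "cmod (node_poly (\<xi> p) 1 p z) \<le> (\<eta>1 * \<kappa> * \<Phi> z) ^ p"
          using elim S(2)[OF z] by auto
        also have "\<dots> \<le> (\<eta> * \<kappa> * \<Phi> z) ^ p"
          using \<eta>1 \<eta>1_le \<kappa>_pos \<Phi>_ge_1[of z] by (intro power_mono mult_right_mono mult_nonneg_nonneg) auto
        finally show ?thesis .
      next
        case False
        have "cmod (node_poly (\<xi> p) 1 p z) \<le> (\<eta> * \<kappa>) ^ p"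
        proof (rule maximum_modulus_frontier[of "node_poly (\<xi> p) 1 p" "{z. \<Phi> z \<le> \<eta>1}"])
          show "node_poly (\<xi> p) 1 p holomorphic_on interior {z. \<Phi> z \<le> \<eta>1}"
            unfolding node_poly_def by (intro holomorphic_intros)
          show "continuous_on (closure {z. \<Phi> z \<le> \<eta>1}) (node_poly (\<xi> p) 1 p)"
            by (rule continuous_on_node_poly)
          show "bounded {z. \<Phi> z \<le> \<eta>1}" by (rule bounded_sublevel)
          show "z \<in> {z. \<Phi> z \<le> \<eta>1}" using False by simp
          fix w assume "w \<in> frontier {z. \<Phi> z \<le> \<eta>1}"
          then have w: "\<Phi> w = \<eta>1" using frontier_sublevel by blast
          then have "cmod (node_poly (\<xi> p) 1 p w) \<le> (\<eta>1 * \<kappa> * \<Phi> w) ^ p"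
            using bspec[OF elim, of w] by simp
          also have "\<eta>1 * \<kappa> * \<Phi> w = \<eta> * \<kappa>" unfolding w \<eta>1(2)[symmetric] by (simp only: mult_ac)
          finally show "cmod (node_poly (\<xi> p) 1 p w) \<le> (\<eta> * \<kappa>) ^ p" .
        qed
        also have "\<dots> \<le> (\<eta> * \<kappa> * \<Phi> z) ^ p"
          using \<eta> \<kappa>_pos \<Phi>_ge_1[of z] mult_left_mono[of 1 "\<Phi> z" "\<eta> * \<kappa>"] by (intro power_mono) auto
        finally show ?thesis .
      qed
    qed
  qed
qed

text \<open>
  A bounded component of \<open>{\<Phi> > \<rho>}\<close> would contradict the maximum modulus principle for the polynomials
  \<open>\<Psi> p\<close>, whose moduli behave like \<open>(\<kappa> \<Phi>)\<^sup>p\<close>.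
\<close>

lemma inside_level_curve:
  assumes \<rho>: "\<rho> > 1"
  shows "inside (level_curve \<Phi> \<rho>) = {z. \<Phi> z < \<rho>}"
proof -
  let ?S = "level_curve \<Phi> \<rho>"
  have S: "?S = {z. \<Phi> z = \<rho>}" by (simp add: level_curve_def)
  \<comment> \<open>By the intermediate value property a component off the level curve stays on one
    side of it.\<close>
  have ivt: "\<Phi> y \<noteq> \<rho> \<and> (\<Phi> x < \<rho> \<longleftrightarrow> \<Phi> y < \<rho>)" if "y \<in> connected_component_set (- ?S) x" for x y
  proof -
    let ?U = "connected_component_set (- ?S) x"
    have "x \<in> - ?S" using that connected_component_in[of "- ?S" x y] by blast
    then have x: "x \<in> ?U" using connected_component_refl[of x "- ?S"] by blast
    have con: "connected (\<Phi> ` ?U)" by (intro connected_continuous_image continuous_\<Phi> connected_connected_component)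
    have "?U \<subseteq> - ?S" by (rule connected_component_subset)
    then have "\<rho> \<notin> \<Phi> ` ?U" by (auto simp: S)
    then have "\<not> (\<Phi> x \<le> \<rho> \<and> \<rho> \<le> \<Phi> y)" "\<not> (\<Phi> y \<le> \<rho> \<and> \<rho> \<le> \<Phi> x)"
      using connectedD_interval[OF con] x that by blast+
    then show ?thesis by linarith
  qed
  have "z \<in> inside ?S" if "\<Phi> z < \<rho>" for z
  proof -
    have "connected_component_set (- ?S) z \<subseteq> {z. \<Phi> z \<le> \<rho>}"
    proof
      fix y assume "y \<in> connected_component_set (- ?S) z"
      from ivt[OF this] that show "y \<in> {z. \<Phi> z \<le> \<rho>}" by simp
    qed
    then have "bounded (connected_component_set (- ?S) z)" by (rule bounded_subset[OF bounded_sublevel])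
    then show ?thesis using that by (auto simp: inside_def S)
  qed
  moreover have "\<Phi> z < \<rho>" if "z \<in> inside ?S" for z
  proof (rule ccontr)
    assume "\<not> \<Phi> z < \<rho>"
    let ?U = "connected_component_set (- ?S) z"
    have zS: "z \<notin> ?S" "bounded ?U" using that by (auto simp: inside_def)
    then have z: "\<Phi> z > \<rho>" "z \<in> ?U" using \<open>\<not> \<Phi> z < \<rho>\<close> by (auto simp: S)
    have closedS: "closed ?S" unfolding S by (rule closed_Collect_eq[OF continuous_\<Phi> continuous_on_const])
    have opU: "open ?U" by (intro open_connected_component open_Compl closedS)
    have big: "\<Phi> y \<ge> \<rho>" if "y \<in> closure ?U" for y
    proof -
      have "closed {y. \<rho> \<le> \<Phi> y}" by (rule closed_Collect_le[OF continuous_on_const continuous_\<Phi>])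
      moreover have "?U \<subseteq> {y. \<rho> \<le> \<Phi> y}"
      proof
        fix x assume "x \<in> ?U"
        from ivt[OF this] z(1) show "x \<in> {y. \<rho> \<le> \<Phi> y}" by simp
      qed
      ultimately have "closure ?U \<subseteq> {y. \<rho> \<le> \<Phi> y}" by (intro closure_minimal)
      then show ?thesis using that by blast
    qed
    \<comment> \<open>A boundary point off the curve would have an open component meeting
      \<open>?U\<close>, hence equal to it, and would be an interior point.\<close>
    have fr: "\<Phi> y = \<rho>" if "y \<in> frontier ?U" for y
    proof (rule ccontr)
      assume y: "\<Phi> y \<noteq> \<rho>"
      let ?V = "connected_component_set (- ?S) y"
      have yV: "y \<in> ?V" using y by (simp add: S)
      have opV: "open ?V" by (intro open_connected_component open_Compl closedS)
      have "y \<in> closure ?U" using that by (simp add: frontier_def)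
      then have "?V \<inter> closure ?U \<noteq> {}" using yV by blast
      then have "?V \<inter> ?U \<noteq> {}" using open_Int_closure_eq_empty[OF opV, of ?U] by blast
      then obtain x where "x \<in> ?V" "x \<in> ?U" by blast
      then have "?V = ?U" using connected_component_eq[of x "- ?S" y] connected_component_eq[of x "- ?S" z] by blast
      then have "y \<in> interior ?U" using yV opU by (simp add: interior_open)
      then show False using that by (simp add: frontier_def)
    qed
    have cU: "compact (closure ?U)" using zS(2) by (simp add: compact_closure)
    have "closure ?U \<subseteq> - E"
    proof
      fix y assume "y \<in> closure ?U"
      from big[OF this] \<rho> \<Phi>_E[of y] show "y \<in> - E" by (cases "y \<in> E") simp_all
    qed
    from uniform_limitD[OF nodes[OF cU this], of "\<kappa> * (\<Phi> z - \<rho>) / 2"] \<kappa>_pos z(1)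
    have "\<forall>\<^sub>F p in sequentially. \<forall>w\<in>closure ?U. dist (root p (cmod (\<Prod>i=1..p + k. w - \<xi> p i))) (\<kappa> * \<Phi> w) < \<kappa> * (\<Phi> z - \<rho>) / 2"
      by simp
    then have "\<forall>\<^sub>F p :: nat in sequentially. False"
      using eventually_gt_at_top[of 0]
    proof eventually_elim
      case (elim p)
      have d: "\<bar>root p (cmod (\<Psi> p w)) - \<kappa> * \<Phi> w\<bar> < \<kappa> * (\<Phi> z - \<rho>) / 2" if "w \<in> closure ?U" for w
        using elim(1) that unfolding \<Psi>_eq dist_real_def by blast
      \<comment> \<open>The midpoint of \<kappa> \<rho> and \<kappa> \<Phi>(z): the p-th roots stay
        below it on the boundary and exceed it at z.\<close>
      let ?m = "\<kappa> * \<rho> + \<kappa> * (\<Phi> z - \<rho>) / 2"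
      have m0: "?m \<ge> 0" using \<kappa>_pos \<rho> z(1) by (intro add_nonneg_nonneg) simp_all
      have "cmod (\<Psi> p z) \<le> ?m ^ p"
      proof (rule maximum_modulus_frontier[of "\<Psi> p" ?U])
        show "\<Psi> p holomorphic_on interior ?U" unfolding node_poly_def by (intro holomorphic_intros)
        show "continuous_on (closure ?U) (\<Psi> p)" by (rule continuous_on_node_poly)
        fix w assume w: "w \<in> frontier ?U"
        have "w \<in> closure ?U" using w by (simp add: frontier_def)
        from d[OF this] have "root p (cmod (\<Psi> p w)) \<le> ?m" unfolding fr[OF w] abs_less_iff by linarith
        then have "root p (cmod (\<Psi> p w)) ^ p \<le> ?m ^ p" by (intro power_mono real_root_ge_zero) auto
        then show "cmod (\<Psi> p w) \<le> ?m ^ p" using elim(2) by (simp add: real_root_pow_pos2)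
      qed (use zS z in auto)
      then have "root p (cmod (\<Psi> p z)) \<le> root p (?m ^ p)" by (rule real_root_le_mono[OF elim(2)])
      moreover have "root p (?m ^ p) = ?m"
        by (rule real_root_power_cancel[OF elim(2) m0])
      ultimately have le: "root p (cmod (\<Psi> p z)) \<le> ?m" by (simp only:)
      have "z \<in> closure ?U" using z(2) closure_subset by blast
      from d[OF this] have "\<kappa> * \<Phi> z - \<kappa> * (\<Phi> z - \<rho>) / 2 < root p (cmod (\<Psi> p z))"
        by (simp only: abs_less_iff) linarith
      moreover have "\<kappa> * \<Phi> z = \<kappa> * \<rho> + \<kappa> * (\<Phi> z - \<rho>)" by (simp only: right_diff_distrib)
      ultimately show False using le by linarith
    qed
    then show False by simp
  qed
  ultimately show ?thesis by blast
qed

section \<open>From error bounds to upper limits of roots\<close>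

lemma error_growth:
  assumes C: "compact C" and \<eta>: "\<eta> > 1" and \<tau>: "\<tau> \<ge> 1" and D: "D \<ge> 0"
    and M: "\<forall>\<^sub>F p in sequentially. (\<kappa> * \<tau>) ^ p \<le> M p"
    and err: "\<forall>\<^sub>F p in sequentially. \<forall>z\<in>C. err p z \<le> D * (cmod (node_poly (\<xi> p) 1 p z) / M p)"
  shows "\<forall>\<^sub>F p in sequentially. \<forall>z\<in>C. err p z \<le> (\<eta> * \<Phi> z / \<tau>) ^ p"
proof -
  \<comment> \<open>One factor for the growth of \<psi>_{1,p}, the other to swallow the constant
    \<open>D\<close>.\<close>
  define \<eta>1 where "\<eta>1 = sqrt \<eta>"
  have \<eta>1: "\<eta>1 > 1" "\<eta>1 * \<eta>1 = \<eta>" using \<eta> by (auto simp: \<eta>1_def)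
  show ?thesis
    using growth_upper[OF C \<eta>1(1)] power_dominates[OF \<eta>1(1), of D] M err
  proof eventually_elim
    case (elim p)
    show ?case
    proof
      fix z assume z: "z \<in> C"
      have pos: "(\<kappa> * \<tau>) ^ p > 0" using \<kappa>_pos \<tau> by simp
      have "err p z \<le> D * (cmod (node_poly (\<xi> p) 1 p z) / M p)" using elim(4) z by blast
      also have "\<dots> \<le> \<eta>1 ^ p * ((\<eta>1 * \<kappa> * \<Phi> z) ^ p / (\<kappa> * \<tau>) ^ p)"
      proof (intro mult_mono frac_le)
        show "cmod (node_poly (\<xi> p) 1 p z) \<le> (\<eta>1 * \<kappa> * \<Phi> z) ^ p" using elim(1) z by blast
        have "0 < M p" using elim(3) pos by linarith
        then show "0 \<le> cmod (node_poly (\<xi> p) 1 p z) / M p" by simp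
        show "0 \<le> (\<eta>1 * \<kappa> * \<Phi> z) ^ p"
          using \<eta>1(1) \<kappa>_pos \<Phi>_ge_1[of z] by (intro zero_le_power mult_nonneg_nonneg) auto
        show "0 \<le> \<eta>1 ^ p" using \<eta>1(1) by simp
      qed (use elim(2,3) pos in auto)
      also have "\<dots> = ((\<eta>1 * (\<eta>1 * \<kappa> * \<Phi> z)) / (\<kappa> * \<tau>)) ^ p"
        by (simp only: power_mult_distrib power_divide times_divide_eq_right)
      also have "(\<eta>1 * (\<eta>1 * \<kappa> * \<Phi> z)) / (\<kappa> * \<tau>) = (\<kappa> * (\<eta> * \<Phi> z)) / (\<kappa> * \<tau>)"
        by (simp only: \<eta>1(2)[symmetric] mult_ac)
      also have "\<dots> = \<eta> * \<Phi> z / \<tau>"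
        using \<kappa>_pos by (intro nonzero_mult_divide_mult_cancel_left) simp
      finally show "err p z \<le> (\<eta> * \<Phi> z / \<tau>) ^ p" .
    qed
  qed
qed

text \<open>Lower bounds for |\<Psi>_p| lose an exponential factor, however small, so an error bound
  is available only for each \<tau> < \<tau>0, with a majorant \<open>M\<close> of its own. Choosing
  \<tau> close to \<tau>0 depending on \<epsilon> removes the loss.\<close>

lemma limsup_uniform:
  assumes C: "compact C" and \<tau>0: "\<tau>0 > 1"
    and bound: "\<And>\<tau>. 1 \<le> \<tau> \<Longrightarrow> \<tau> < \<tau>0 \<Longrightarrow> \<exists>D M. D \<ge> 0 \<and> (\<forall>\<^sub>F p in sequentially. (\<kappa> * \<tau>) ^ p \<le> M p) \<and>
       (\<forall>\<^sub>F p in sequentially. \<forall>z\<in>C. err p z \<le> D * (cmod (node_poly (\<xi> p) 1 p z) / M p))"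
  shows "limsup_le_uniformly_on C (\<lambda>p z. root p (err p z)) (\<lambda>z. \<Phi> z / \<tau>0)"
  unfolding limsup_le_uniformly_on_def
proof (intro allI impI)
  fix \<epsilon> :: real assume \<epsilon>: "\<epsilon> > 0"
  obtain S where S: "S \<ge> 1" "\<And>z. z \<in> C \<Longrightarrow> \<Phi> z \<le> S" using compact_\<Phi>_bound[OF C] by blast
  \<comment> \<open>t \<Phi> stays below \<Phi> / \<tau>0 + \<epsilon> on \<open>C\<close>, as
    \<Phi> \<le> S there; and t > 1 / \<tau>0 leaves room for some \<tau> < \<tau>0 with \<tau> t >
    1, the product serving as \<eta>.\<close>
  define t where "t = 1 / \<tau>0 + \<epsilon> / S"
  have "\<epsilon> / S > 0" "1 / \<tau>0 > 0" using \<epsilon> S(1) \<tau>0 by simp_all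
  then have t: "t > 1 / \<tau>0" "t > 0" unfolding t_def by linarith+
  have "\<tau>0 > 0" using \<tau>0 by linarith
  then have "1 < t * \<tau>0" using t(1) by (simp only: pos_divide_less_eq)
  then have "1 / t < \<tau>0" using t(2) by (simp only: pos_divide_less_eq mult.commute[of t])
  then have "max 1 (1 / t) < \<tau>0" using \<tau>0 by (simp only: max_less_iff_conj simp_thms)
  from dense[OF this] obtain \<tau> where \<tau>: "max 1 (1 / t) < \<tau>" "\<tau> < \<tau>0" by (elim exE conjE)
  have "1 / t < \<tau>" using \<tau>(1) by (simp only: max_less_iff_conj)
  then have \<eta>: "\<tau> * t > 1" using t(2) by (simp only: pos_divide_less_eq)
  have \<tau>1: "\<tau> \<ge> 1" using \<tau> by simp
  obtain D M where DM: "D \<ge> 0" "\<forall>\<^sub>F p in sequentially. (\<kappa> * \<tau>) ^ p \<le> M p"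
    "\<forall>\<^sub>F p in sequentially. \<forall>z\<in>C. err p z \<le> D * (cmod (node_poly (\<xi> p) 1 p z) / M p)"
    using bound[OF \<tau>1 \<tau>(2)] by (elim exE conjE)
  show "\<forall>\<^sub>F p in sequentially. \<forall>z\<in>C. root p (err p z) \<le> \<Phi> z / \<tau>0 + \<epsilon>"
    using error_growth[OF C \<eta> \<tau>1 DM] eventually_gt_at_top[of 0]
  proof eventually_elim
    case (elim p)
    show ?case
    proof
      fix z assume z: "z \<in> C"
      have "\<tau> \<noteq> 0" using \<tau>1 by linarith
      then have e: "\<tau> * t * \<Phi> z / \<tau> = t * \<Phi> z"
        by (simp only: mult.assoc nonzero_mult_div_cancel_left simp_thms)
      have "err p z \<le> (t * \<Phi> z) ^ p" using bspec[OF elim(1) z] by (simp only: e)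
      then have 1: "root p (err p z) \<le> root p ((t * \<Phi> z) ^ p)"
        by (rule real_root_le_mono[OF elim(2)])
      have 2: "root p ((t * \<Phi> z) ^ p) = t * \<Phi> z"
      proof (rule real_root_power_cancel[OF elim(2)])
        show "0 \<le> t * \<Phi> z" using t(2) order.trans[OF zero_le_one \<Phi>_ge_1[of z]] by (intro mult_nonneg_nonneg) auto
      qed
      have 3: "t * \<Phi> z = \<Phi> z / \<tau>0 + \<epsilon> * (\<Phi> z / S)" unfolding t_def distrib_right by simp
      have "S > 0" using S(1) by linarith
      then have "\<Phi> z / S \<le> 1" using S(2)[OF z] by (simp only: divide_le_eq_1_pos)
      then have 4: "\<epsilon> * (\<Phi> z / S) \<le> \<epsilon> * 1" by (rule mult_left_mono) (rule less_imp_le[OF \<epsilon>])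
      show "root p (err p z) \<le> \<Phi> z / \<tau>0 + \<epsilon>" using 1 2 3 4 by linarith
    qed
  qed
qed

end

lemma limsup_from_uniform:
  assumes "limsup_le_uniformly_on C (\<lambda>p z. root p (err p z)) b" "z \<in> C"
  shows "limsup (\<lambda>p. ereal (root p (err p z))) \<le> ereal (b z)"
proof -
  have "limsup (\<lambda>p. ereal (root p (err p z))) \<le> ereal (b z) + ereal e" if e: "e > 0" for e
  proof -
    have "\<forall>\<^sub>F p in sequentially. \<forall>z\<in>C. root p (err p z) \<le> b z + e"
      using assms(1) e unfolding limsup_le_uniformly_on_def by blast
    then have "\<forall>\<^sub>F p in sequentially. ereal (root p (err p z)) \<le> ereal (b z + e)"
      by (rule eventually_mono) (use assms(2) in simp)
    then have "limsup (\<lambda>p. ereal (root p (err p z))) \<le> ereal (b z + e)" by (rule Limsup_bounded)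
    then show ?thesis by simp
  qed
  then show ?thesis by (rule ereal_le_epsilon2)
qed

lemma uniform_limit_from_limsup:
  assumes lim: "limsup_le_uniformly_on C (\<lambda>p z. root p (err p z)) b" and b: "\<And>z. z \<in> C \<Longrightarrow> b z \<le> \<theta>" "\<theta> < 1"
    and err: "\<And>p z. err p z \<ge> 0"
  shows "uniform_limit C err (\<lambda>z. 0) sequentially"
proof (rule uniform_limitI)
  fix e :: real assume e: "e > 0"
  \<comment> \<open>The midpoint of \<theta> and 1 gives geometric decay; the maximum with 0 keeps
    the base nonnegative.\<close>
  define \<theta>1 where "\<theta>1 = max ((1 + \<theta>) / 2) 0"
  have "(1 + \<theta>) / 2 \<le> \<theta>1" unfolding \<theta>1_def by (rule max.cobounded1)
  moreover have "\<theta> + (1 - \<theta>) / 2 = (1 + \<theta>) / 2" by (simp add: field_simps)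
  ultimately have "\<theta> + (1 - \<theta>) / 2 \<le> \<theta>1" by (simp only:)
  moreover have "0 \<le> \<theta>1" "\<theta>1 < 1" using b(2) by (auto simp: \<theta>1_def)
  ultimately have \<theta>1: "0 \<le> \<theta>1" "\<theta>1 < 1" "\<theta> + (1 - \<theta>) / 2 \<le> \<theta>1" by blast+
  have ev1: "\<forall>\<^sub>F p in sequentially. \<forall>z\<in>C. root p (err p z) \<le> b z + (1 - \<theta>) / 2"
    by (rule lim[unfolded limsup_le_uniformly_on_def, THEN spec, THEN mp]) (use b(2) in simp)
  have "(\<lambda>p. \<theta>1 ^ p) \<longlonglongrightarrow> 0" by (rule LIMSEQ_realpow_zero[OF \<theta>1(1,2)])
  then have ev2: "\<forall>\<^sub>F p in sequentially. \<theta>1 ^ p < e"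
    by (rule order_tendstoD(2)) (rule e)
  have ev3: "\<forall>\<^sub>F p::nat in sequentially. 0 < p" by (rule eventually_gt_at_top)
  show "\<forall>\<^sub>F p in sequentially. \<forall>z\<in>C. dist (err p z) 0 < e"
  proof (rule eventually_mono[OF eventually_conj[OF ev1 eventually_conj[OF ev2 ev3]]])
    fix p assume "(\<forall>z\<in>C. root p (err p z) \<le> b z + (1 - \<theta>) / 2) \<and> \<theta>1 ^ p < e \<and> 0 < p"
    then have elim: "\<forall>z\<in>C. root p (err p z) \<le> b z + (1 - \<theta>) / 2" "\<theta>1 ^ p < e" "0 < p" by blast+
    show "\<forall>z\<in>C. dist (err p z) 0 < e"
    proof
      fix z assume z: "z \<in> C"
      have "root p (err p z) \<le> b z + (1 - \<theta>) / 2" using elim(1) z by (rule bspec)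
      then have "root p (err p z) \<le> \<theta>1" using b(1)[OF z] \<theta>1(3) by linarith
      then have "root p (err p z) ^ p \<le> \<theta>1 ^ p" by (rule power_mono) (rule real_root_ge_zero[OF err])
      then have "err p z \<le> \<theta>1 ^ p" using real_root_pow_pos2[OF elim(3) err] by (simp only:)
      then have "err p z < e" using elim(2) by linarith
      then show "dist (err p z) 0 < e" using err[of p z] by (simp only: dist_real_def diff_0_right abs_of_nonneg)
    qed
  qed
qed

section \<open>Error bounds\<close>

lemma inner_product_expansion:
  fixes ip :: "complex ^ 'n \<Rightarrow> complex ^ 'n \<Rightarrow> complex"
  assumes "is_inner_product ip"
  shows "ip q x = (\<Sum>i\<in>UNIV. ip q (axis i 1) * x $ i)"
proof -
  have add: "ip q (y + w) = ip q y + ip q w" and scale: "ip q (c *s y) = c * ip q y" for y w c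
    using assms unfolding is_inner_product_def by blast+
  have zero: "ip q 0 = 0" using scale[of 0 0] by simp
  have sum: "ip q (\<Sum>i\<in>A. f i) = (\<Sum>i\<in>A. ip q (f i))" if "finite A" for A and f :: "'n \<Rightarrow> complex ^ 'n"
    using that by (induction A rule: finite_induct) (simp_all add: zero add)
  have "x = (\<Sum>i\<in>UNIV. x $ i *s axis i 1)" by (simp add: basis_expansion)
  then have "ip q x = (\<Sum>i\<in>UNIV. ip q (x $ i *s axis i 1))" using sum[of UNIV "\<lambda>i. x $ i *s axis i 1"] by simp
  then show ?thesis by (simp add: scale mult.commute)
qed

section \<open>The setting shared by the cases k < \<mu> and k = \<mu>\<close>

locale itea_setting = green_nodes E g \<xi> k \<kappa>
  for E :: "complex set" and g :: "complex \<Rightarrow> real" and \<xi> :: "nat \<Rightarrow> nat \<Rightarrow> complex" and k :: nat and \<kappa> :: real +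
  fixes ip :: "complex ^ 'n \<Rightarrow> complex ^ 'n \<Rightarrow> complex" and nrm :: "complex ^ 'n \<Rightarrow> real"
    and q :: "complex ^ 'n" and F \<Theta> :: "complex \<Rightarrow> complex ^ 'n"
    and \<mu> :: nat and zs :: "nat \<Rightarrow> complex" and v :: "nat \<Rightarrow> complex ^ 'n" and \<rho> :: real
  assumes consecutive: "\<And>p. p \<ge> 1 \<Longrightarrow> equal_points_consecutive (p + k) (\<xi> p)"
    and ip: "is_inner_product ip" and nrm: "is_vector_norm nrm"
    and rho: "\<rho> > 1" and inj: "inj_on zs {1..\<mu>}"
    and poles: "\<And>s. s \<in> {1..\<mu>} \<Longrightarrow> zs s \<notin> E" "\<And>s. s \<in> {1..\<mu>} \<Longrightarrow> \<Phi> (zs s) < \<rho>"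
    and Theta: "\<And>i. (\<lambda>z. \<Theta> z $ i) holomorphic_on {z. \<Phi> z < \<rho>}"
    and F: "\<And>z. \<Phi> z < \<rho> \<Longrightarrow> z \<notin> zs ` {1..\<mu>} \<Longrightarrow> F z = (\<Sum>s=1..\<mu>. (1 / (z - zs s)) *s v s) + \<Theta> z"
    and k: "1 \<le> k" "k \<le> \<mu>"
    and qv: "\<And>i. i \<in> {1..k} \<Longrightarrow> ip q (v i) \<noteq> 0"
begin

definition "U \<sigma> = {z. \<Phi> z < \<sigma>} - zs ` {1..\<mu>}"

lemma open_U: "open (U \<sigma>)"
  unfolding U_def by (intro open_Diff open_sublevel finite_imp_closed) simp

lemma E_subset_U: "\<sigma> > 1 \<Longrightarrow> E \<subseteq> U \<sigma>"
  using poles(1) \<Phi>_E by (auto simp: U_def)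

text \<open>\<Theta> is analytic only below the level \<rho>, so its Cauchy formula is taken for the
  compact set \<Phi> \<le> \<sigma>, with the contour in the shell \<sigma> < \<Phi> < \<rho>. All
  poles are below \<sigma>, so contour and poles stay apart.\<close>

lemma representing_functional:
  assumes \<sigma>: "\<sigma> < \<rho>" "\<And>s. s \<in> {1..\<mu>} \<Longrightarrow> \<Phi> (zs s) < \<sigma>"
  obtains L\<^sub>0 \<Lambda> where "compact L\<^sub>0" "\<forall>w\<in>L\<^sub>0. \<sigma> < \<Phi> w" "\<forall>i. bounded_functional L\<^sub>0 (\<Lambda> i)"
    "\<forall>z\<in>U \<sigma>. \<forall>i. F z $ i = \<Lambda> i (\<lambda>w. 1 / (w - z)) - (\<Sum>s=1..\<mu>. v s $ i * (1 / (zs s - z)))"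
proof -
  have sub: "{z. \<Phi> z \<le> \<sigma>} \<subseteq> {z. \<Phi> z < \<rho>}" using \<sigma> by auto
  obtain L\<^sub>0 where L0: "compact L\<^sub>0" "L\<^sub>0 \<subseteq> {z. \<Phi> z < \<rho>} - {z. \<Phi> z \<le> \<sigma>}"
    and rep: "\<And>f. f holomorphic_on {z. \<Phi> z < \<rho>} \<Longrightarrow>
       \<exists>\<Lambda>. bounded_functional L\<^sub>0 \<Lambda> \<and> (\<forall>z\<in>{z. \<Phi> z \<le> \<sigma>}. f z = \<Lambda> (\<lambda>w. 1 / (w - z)))"
    using Cauchy_functional_compact_in_open[OF compact_sublevel open_sublevel sub] by blast
  have "\<forall>i. \<exists>\<Lambda>. bounded_functional L\<^sub>0 \<Lambda> \<and> (\<forall>z\<in>{z. \<Phi> z \<le> \<sigma>}. \<Theta> z $ i = \<Lambda> (\<lambda>w. 1 / (w - z)))"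
    by (intro allI rep Theta)
  from choice[OF this] obtain \<Lambda> where \<Lambda>: "\<forall>i. bounded_functional L\<^sub>0 (\<Lambda> i) \<and> (\<forall>z\<in>{z. \<Phi> z \<le> \<sigma>}. \<Theta> z $ i = \<Lambda> i (\<lambda>w. 1 / (w - z)))"
    by (elim exE)
  show ?thesis
  proof (rule that[OF L0(1)])
    show "\<forall>w\<in>L\<^sub>0. \<sigma> < \<Phi> w" using L0(2) by force
    show "\<forall>i. bounded_functional L\<^sub>0 (\<Lambda> i)" using \<Lambda> by blast
    show "\<forall>z\<in>U \<sigma>. \<forall>i. F z $ i = \<Lambda> i (\<lambda>w. 1 / (w - z)) - (\<Sum>s=1..\<mu>. v s $ i * (1 / (zs s - z)))"
    proof (intro ballI allI)
      fix z i assume z: "z \<in> U \<sigma>"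
      then have z': "\<Phi> z < \<rho>" "z \<notin> zs ` {1..\<mu>}" "\<Phi> z \<le> \<sigma>" using \<sigma> by (auto simp: U_def)
      have "F z $ i = (\<Sum>s=1..\<mu>. 1 / (z - zs s) * v s $ i) + \<Theta> z $ i"
        unfolding F[OF z'(1,2)] by simp
      also have "(\<Sum>s=1..\<mu>. 1 / (z - zs s) * v s $ i) = - (\<Sum>s=1..\<mu>. v s $ i * (1 / (zs s - z)))"
        unfolding sum_negf[symmetric]
      proof (rule sum.cong[OF refl])
        fix s
        have "1 / (z - zs s) = - (1 / (zs s - z))" by (metis minus_diff_eq minus_divide_right)
        then show "1 / (z - zs s) * v s $ i = - (v s $ i * (1 / (zs s - z)))" by simp
      qed
      also have "\<Theta> z $ i = \<Lambda> i (\<lambda>w. 1 / (w - z))" using \<Lambda> z'(3) by blast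
      finally show "F z $ i = \<Lambda> i (\<lambda>w. 1 / (w - z)) - (\<Sum>s=1..\<mu>. v s $ i * (1 / (zs s - z)))" by simp
    qed
  qed
qed

text \<open>The contour comes into being only inside the proof, so the lower bound by
  \<open>M\<close> is demanded for every compact set above the level \<sigma>. The contour and its
  location are handed back, for the estimates of the refined case.\<close>

lemma asymptotics_instance:
  assumes \<sigma>: "1 < \<sigma>" "\<sigma> < \<rho>" "\<And>s. s \<in> {1..\<mu>} \<Longrightarrow> \<Phi> (zs s) < \<sigma>"
    and M_pos: "\<forall>\<^sub>F p in sequentially. M p > 0"
    and M_le: "\<And>L\<^sub>0. compact L\<^sub>0 \<Longrightarrow> (\<And>w. w \<in> L\<^sub>0 \<Longrightarrow> \<sigma> < \<Phi> w) \<Longrightarrow>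
       \<forall>\<^sub>F p in sequentially. \<forall>w\<in>L\<^sub>0 \<union> zs ` {k + 1..\<mu>}. M p \<le> cmod (\<Psi> p w)"
    and M_dominates: "\<And>i. i \<in> {1..k} \<Longrightarrow> (\<lambda>p. cmod (\<Psi> p (zs i)) / M p) \<longlonglongrightarrow> 0"
  obtains L\<^sub>0 \<Lambda> Bd where "compact L\<^sub>0" "\<forall>w\<in>L\<^sub>0. \<sigma> < \<Phi> w"
    "itea_asymptotics F v zs \<mu> k \<xi> ip q (\<lambda>i. ip q (axis i 1)) \<Lambda> L\<^sub>0 (U \<sigma>) M Bd"
proof -
  obtain L\<^sub>0 \<Lambda> where L0: "compact L\<^sub>0" "\<forall>w\<in>L\<^sub>0. \<sigma> < \<Phi> w" and \<Lambda>: "\<forall>i. bounded_functional L\<^sub>0 (\<Lambda> i)"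
    and rep: "\<forall>z\<in>U \<sigma>. \<forall>i. F z $ i = \<Lambda> i (\<lambda>w. 1 / (w - z)) - (\<Sum>s=1..\<mu>. v s $ i * (1 / (zs s - z)))"
    by (rule representing_functional[OF \<sigma>(2,3)]) (assumption, rule that, assumption+)
  obtain Bd where Bd: "\<forall>\<^sub>F p in sequentially. \<forall>i\<in>{1..p + k}. cmod (\<xi> p i) \<le> Bd"
    using nodes_bounded by (elim exE)
  show ?thesis
  proof (rule that[OF L0])
    show "itea_asymptotics F v zs \<mu> k \<xi> ip q (\<lambda>i. ip q (axis i 1)) \<Lambda> L\<^sub>0 (U \<sigma>) M Bd"
    proof unfold_locales
      show "bounded_functional L\<^sub>0 (\<Lambda> i)" for i using \<Lambda> by (rule spec)
      show "U \<sigma> \<inter> (L\<^sub>0 \<union> zs ` {1..\<mu>}) = {}" using L0(2) by (force simp: U_def)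
      show "F z $ i = \<Lambda> i (\<lambda>w. 1 / (w - z)) - (\<Sum>s=1..\<mu>. v s $ i * (1 / (zs s - z)))" if "z \<in> U \<sigma>" for z i
        using bspec[OF rep that] by (rule spec)
      show "ip q x = (\<Sum>i\<in>UNIV. ip q (axis i 1) * x $ i)" for x by (rule inner_product_expansion[OF ip])
      show "\<forall>\<^sub>F p in sequentially. \<xi> p ` {1..p + k} \<subseteq> U \<sigma>"
        by (rule nodes_eventually_near[OF open_U E_subset_U[OF \<sigma>(1)]])
      show "\<forall>\<^sub>F p in sequentially. equal_points_consecutive (p + k) (\<xi> p)"
        using eventually_ge_at_top[of 1] by (rule eventually_mono) (rule consecutive)
      show "\<forall>\<^sub>F p in sequentially. \<forall>w\<in>L\<^sub>0 \<union> zs ` {k + 1..\<mu>}. M p \<le> cmod (\<Psi> p w)"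
        by (rule M_le[OF L0(1)]) (rule L0(2)[rule_format])
    qed (fact L0 open_U inj k qv Bd M_pos M_dominates)+
  qed
qed

lemma main_bounds:
  assumes \<sigma>: "1 < \<sigma>" "\<sigma> < \<rho>" "\<And>s. s \<in> {1..\<mu>} \<Longrightarrow> \<Phi> (zs s) < \<sigma>"
    and M: "\<forall>\<^sub>F p in sequentially. M p > 0"
     "\<And>L\<^sub>0. compact L\<^sub>0 \<Longrightarrow> (\<And>w. w \<in> L\<^sub>0 \<Longrightarrow> \<sigma> < \<Phi> w) \<Longrightarrow>
       \<forall>\<^sub>F p in sequentially. \<forall>w\<in>L\<^sub>0 \<union> zs ` {k + 1..\<mu>}. M p \<le> cmod (\<Psi> p w)"
     "\<And>i. i \<in> {1..k} \<Longrightarrow> (\<lambda>p. cmod (\<Psi> p (zs i)) / M p) \<longlonglongrightarrow> 0"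
    and C: "compact C" "C \<subseteq> U \<sigma>"
  shows "\<forall>\<^sub>F p in sequentially. \<exists>!c. itea_coeffs ip q F (\<xi> p) p k c" (is ?A)
    and "\<forall>\<^sub>F p in sequentially. \<forall>c. itea_coeffs ip q F (\<xi> p) p k c \<longrightarrow>
       (\<forall>z\<in>C. itea_denominator (\<xi> p) k c z \<noteq> 0)" (is ?B)
    and "\<exists>D\<ge>0. \<forall>\<^sub>F p in sequentially. \<forall>z\<in>C.
       nrm (F z - itea ip q F (\<xi> p) p k z) \<le> D * (cmod (node_poly (\<xi> p) 1 p z) / M p)" (is ?D)
proof -
  have "\<exists>L\<^sub>0 \<Lambda> Bd. itea_asymptotics F v zs \<mu> k \<xi> ip q (\<lambda>i. ip q (axis i 1)) \<Lambda> L\<^sub>0 (U \<sigma>) M Bd"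
  proof (rule asymptotics_instance[where \<sigma>=\<sigma> and M=M])
    fix L\<^sub>0 \<Lambda> Bd assume "itea_asymptotics F v zs \<mu> k \<xi> ip q (\<lambda>i. ip q (axis i 1)) \<Lambda> L\<^sub>0 (U \<sigma>) M Bd"
    then show ?thesis by (intro exI)
  qed (fact \<sigma> M)+
  then obtain L\<^sub>0 \<Lambda> Bd where "itea_asymptotics F v zs \<mu> k \<xi> ip q (\<lambda>i. ip q (axis i 1)) \<Lambda> L\<^sub>0 (U \<sigma>) M Bd"
    by (elim exE)
  then interpret A: itea_asymptotics F v zs \<mu> k \<xi> ip q "\<lambda>i. ip q (axis i 1)" \<Lambda> L\<^sub>0 "U \<sigma>" M Bd .
  show ?A by (rule A.unique_coeffs)
  obtain \<delta> where \<delta>: "\<delta> > 0" and ev: "\<forall>\<^sub>F p in sequentially. \<forall>c. itea_coeffs ip q F (\<xi> p) p k c \<longrightarrow>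
    (\<forall>z\<in>C. \<delta> \<le> cmod (itea_denominator (\<xi> p) k c z))"
    by (rule A.denominator_lower_bound[OF C]) (rule that)
  from ev show ?B
  proof (rule eventually_mono, intro allI impI ballI)
    fix p c z assume "\<forall>c. itea_coeffs ip q F (\<xi> p) p k c \<longrightarrow> (\<forall>z\<in>C. \<delta> \<le> cmod (itea_denominator (\<xi> p) k c z))"
      "itea_coeffs ip q F (\<xi> p) p k c" "z \<in> C"
    then have "\<delta> \<le> cmod (itea_denominator (\<xi> p) k c z)" by blast
    then show "itea_denominator (\<xi> p) k c z \<noteq> 0" using \<delta> by auto
  qed
  show ?D by (rule A.error_bound[OF C nrm])
qed

text \<open>Any \<eta> strictly between 1 and \<tau> / \<Phi>(a) gives the geometric majorant
  (\<eta> \<Phi>(a) / \<tau>)^p.\<close>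

lemma ratio_tendsto_0:
  assumes a: "a \<notin> E" and \<tau>: "\<Phi> a < \<tau>" and M: "\<forall>\<^sub>F p in sequentially. (\<kappa> * \<tau>) ^ p \<le> M p"
  obtains \<epsilon> where "\<epsilon> \<longlonglongrightarrow> (0::real)" "\<forall>\<^sub>F p in sequentially. cmod (\<Psi> p a) \<le> \<epsilon> p * M p"
    "(\<lambda>p. cmod (\<Psi> p a) / M p) \<longlonglongrightarrow> 0"
proof -
  have \<Phi>a: "\<Phi> a > 0" using \<Phi>_ge_1[of a] by linarith
  have "1 < \<tau> / \<Phi> a" using \<tau> \<Phi>a by simp
  from dense[OF this] obtain \<eta> where \<eta>: "1 < \<eta>" "\<eta> < \<tau> / \<Phi> a" by (elim exE conjE)
  have \<eta>2: "\<eta> * \<Phi> a < \<tau>" using \<eta>(2) \<Phi>a by (simp only: pos_less_divide_eq)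
  have \<tau>0: "\<tau> > 0" using \<tau> \<Phi>a by linarith
  have lim: "(\<lambda>p. (\<eta> * \<Phi> a / \<tau>) ^ p) \<longlonglongrightarrow> 0"
    using \<eta> \<eta>2 \<tau>0 \<Phi>a by (intro LIMSEQ_realpow_zero) auto
  have up: "\<forall>\<^sub>F p in sequentially. \<forall>w\<in>{a}. cmod (\<Psi> p w) \<le> (\<eta> * \<kappa> * \<Phi> w) ^ p"
    by (rule growth_upper_\<Psi>) (use a \<eta> in auto)
  have le: "\<forall>\<^sub>F p in sequentially. cmod (\<Psi> p a) \<le> (\<eta> * \<Phi> a / \<tau>) ^ p * M p \<and> M p > 0"
    using up M
  proof eventually_elim
    case (elim p)
    have pos: "(\<kappa> * \<tau>) ^ p > 0" using \<kappa>_pos \<tau>0 by simp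
    have eq: "\<eta> * \<kappa> * \<Phi> a = (\<eta> * \<Phi> a / \<tau>) * (\<kappa> * \<tau>)" using \<tau>0 by simp
    have "cmod (\<Psi> p a) \<le> (\<eta> * \<kappa> * \<Phi> a) ^ p" using elim(1) by blast
    then have "cmod (\<Psi> p a) \<le> (\<eta> * \<Phi> a / \<tau>) ^ p * (\<kappa> * \<tau>) ^ p"
      unfolding eq power_mult_distrib[of "\<eta> * \<Phi> a / \<tau>" "\<kappa> * \<tau>" p] .
    also have "\<dots> \<le> (\<eta> * \<Phi> a / \<tau>) ^ p * M p"
      using elim(2) \<eta> \<Phi>a \<tau>0 by (intro mult_left_mono zero_le_power) auto
    finally show ?case using pos elim(2) by linarith
  qed
  have "(\<lambda>p. cmod (\<Psi> p a) / M p) \<longlonglongrightarrow> 0"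
  proof (rule Lim_null_comparison[OF _ lim])
    show "\<forall>\<^sub>F p in sequentially. norm (cmod (\<Psi> p a) / M p) \<le> (\<eta> * \<Phi> a / \<tau>) ^ p"
      using le by eventually_elim (simp add: pos_divide_le_eq)
  qed
  moreover have "\<forall>\<^sub>F p in sequentially. cmod (\<Psi> p a) \<le> (\<eta> * \<Phi> a / \<tau>) ^ p * M p"
    using le by (rule eventually_mono) (rule conjunct1)
  ultimately show ?thesis by (intro that[OF lim])
qed

lemma sublevel_radius:
  assumes C: "compact C" "C \<subseteq> {z. \<Phi> z < \<rho>}" and \<tau>: "\<tau> < \<rho>"
  obtains \<sigma> where "1 < \<sigma>" "\<tau> < \<sigma>" "\<sigma> < \<rho>" "\<And>s. s \<in> {1..\<mu>} \<Longrightarrow> \<Phi> (zs s) < \<sigma>" "\<And>z. z \<in> C \<Longrightarrow> \<Phi> z < \<sigma>"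
proof -
  \<comment> \<open>On \<open>C\<close> together with the poles \<Phi> attains a maximum, which lies
    below \<rho>; inserting z_1 makes the set visibly nonempty.\<close>
  let ?C = "insert (zs 1) (C \<union> zs ` {1..\<mu>})"
  have "compact ?C" by (intro compact_insert compact_Un C(1) finite_imp_compact) auto
  then obtain x where x: "x \<in> ?C" "\<And>y. y \<in> ?C \<Longrightarrow> \<Phi> y \<le> \<Phi> x"
    using continuous_attains_sup[of ?C \<Phi>, OF _ _ continuous_\<Phi>] by blast
  have "1 \<in> {1..\<mu>}" using k by simp
  then have "\<Phi> x < \<rho>" using x(1) C(2) poles(2) by auto
  then have "max (max 1 \<tau>) (\<Phi> x) < \<rho>" using rho \<tau> by (simp only: max_less_iff_conj simp_thms)
  from dense[OF this] obtain \<sigma> where \<sigma>: "max (max 1 \<tau>) (\<Phi> x) < \<sigma>" "\<sigma> < \<rho>" by (elim exE conjE)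
  show ?thesis
  proof (rule that[of \<sigma>])
    show "\<Phi> (zs s) < \<sigma>" if "s \<in> {1..\<mu>}" for s using x(2)[of "zs s"] that \<sigma>(1) by simp
    show "\<Phi> z < \<sigma>" if "z \<in> C" for z using x(2)[of z] that \<sigma>(1) by simp
  qed (use \<sigma> in auto)
qed

text \<open>A level strictly between \<Phi>(a) and the minimum of \<Phi> on \<open>C\<close>
  separates the two growth rates.\<close>

lemma dominated_on_compact:
  assumes C: "compact C" "\<And>w. w \<in> C \<Longrightarrow> \<Phi> a < \<Phi> w" and a: "a \<notin> E"
  obtains \<epsilon> where "\<epsilon> \<longlonglongrightarrow> (0::real)" "\<forall>\<^sub>F p in sequentially. \<forall>w\<in>C. cmod (\<Psi> p a) \<le> \<epsilon> p * cmod (\<Psi> p w)"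
proof (cases "C = {}")
  case True
  show ?thesis by (rule that[OF tendsto_const]) (simp add: True)
next
  case False
  obtain w0 where w0: "w0 \<in> C" "\<And>w. w \<in> C \<Longrightarrow> \<Phi> w0 \<le> \<Phi> w"
    using continuous_attains_inf[OF C(1) False continuous_\<Phi>] by blast
  from dense[OF C(2)[OF w0(1)]] obtain \<tau> where \<tau>: "\<Phi> a < \<tau>" "\<tau> < \<Phi> w0" by (elim exE conjE)
  have \<tau>1: "1 \<le> \<tau>" using \<tau>(1) \<Phi>_ge_1[of a] by linarith
  have low: "\<forall>\<^sub>F p in sequentially. \<forall>w\<in>C. (\<kappa> * \<tau>) ^ p \<le> cmod (\<Psi> p w)"
  proof (rule growth_lower[OF C(1) \<tau>1])
    show "\<tau> < \<Phi> w" if "w \<in> C" for w using w0(2)[OF that] \<tau>(2) by linarith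
  qed
  obtain \<epsilon> where \<epsilon>: "\<epsilon> \<longlonglongrightarrow> 0" "\<forall>\<^sub>F p in sequentially. cmod (\<Psi> p a) \<le> \<epsilon> p * (\<kappa> * \<tau>) ^ p"
    by (rule ratio_tendsto_0[OF a \<tau>(1), of "\<lambda>p. (\<kappa> * \<tau>) ^ p"]) (simp, rule that)
  show ?thesis
  proof (rule that[OF tendsto_rabs_zero[OF \<epsilon>(1)]])
    show "\<forall>\<^sub>F p in sequentially. \<forall>w\<in>C. cmod (\<Psi> p a) \<le> \<bar>\<epsilon> p\<bar> * cmod (\<Psi> p w)"
      using low \<epsilon>(2)
    proof eventually_elim
      case (elim p)
      show ?case
      proof
        fix w assume "w \<in> C"
        then have w: "(\<kappa> * \<tau>) ^ p \<le> cmod (\<Psi> p w)" using elim(1) by blast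
        have pos: "(\<kappa> * \<tau>) ^ p \<ge> 0" using \<kappa>_pos \<tau>1 by simp
        have "cmod (\<Psi> p a) \<le> \<bar>\<epsilon> p\<bar> * (\<kappa> * \<tau>) ^ p"
          using elim(2) mult_right_mono[OF abs_ge_self[of "\<epsilon> p"] pos] by linarith
        also have "\<dots> \<le> \<bar>\<epsilon> p\<bar> * cmod (\<Psi> p w)" using w by (intro mult_left_mono) auto
        finally show "cmod (\<Psi> p a) \<le> \<bar>\<epsilon> p\<bar> * cmod (\<Psi> p w)" .
      qed
    qed
  qed
qed

text \<open>With no pole beyond z_k, all that is left of the support is the contour above the level
  \<sigma>, so (\<kappa> \<sigma>)^p can serve as \<open>M\<close>. Here \<sigma> depends on
  \<open>C\<close> and \<tau>, hence a separate bound for each \<tau> < \<rho>.\<close>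

lemma bounds_without_further_poles:
  assumes k\<mu>: "k = \<mu>" and C: "compact C" "C \<subseteq> {z. \<Phi> z < \<rho>} - zs ` {1..\<mu>}" and \<tau>: "1 \<le> \<tau>" "\<tau> < \<rho>"
  shows "\<forall>\<^sub>F p in sequentially. \<exists>!c. itea_coeffs ip q F (\<xi> p) p k c"
    and "\<forall>\<^sub>F p in sequentially. \<forall>c. itea_coeffs ip q F (\<xi> p) p k c \<longrightarrow>
       (\<forall>z\<in>C. itea_denominator (\<xi> p) k c z \<noteq> 0)"
    and "\<exists>D M. D \<ge> 0 \<and> (\<forall>\<^sub>F p in sequentially. (\<kappa> * \<tau>) ^ p \<le> M p) \<and> (\<forall>\<^sub>F p in sequentially. \<forall>z\<in>C.
       nrm (F z - itea ip q F (\<xi> p) p k z) \<le> D * (cmod (node_poly (\<xi> p) 1 p z) / M p))"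
proof -
  have "C \<subseteq> {z. \<Phi> z < \<rho>}" using C(2) by blast
  then obtain \<sigma> where \<sigma>: "1 < \<sigma>" "\<tau> < \<sigma>" "\<sigma> < \<rho>" "\<And>s. s \<in> {1..\<mu>} \<Longrightarrow> \<Phi> (zs s) < \<sigma>" "\<And>z. z \<in> C \<Longrightarrow> \<Phi> z < \<sigma>"
    using sublevel_radius[OF C(1) _ \<tau>(2)] by metis
  have CU: "C \<subseteq> U \<sigma>" using C(2) \<sigma>(5) by (auto simp: U_def)
  let ?M = "\<lambda>p. (\<kappa> * \<sigma>) ^ p"
  have M1: "\<forall>\<^sub>F p in sequentially. ?M p > 0" using \<kappa>_pos \<sigma>(1) by simp
  have M2: "\<forall>\<^sub>F p in sequentially. \<forall>w\<in>L\<^sub>0 \<union> zs ` {k + 1..\<mu>}. ?M p \<le> cmod (\<Psi> p w)"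
    if "compact L\<^sub>0" "\<And>w. w \<in> L\<^sub>0 \<Longrightarrow> \<sigma> < \<Phi> w" for L\<^sub>0
    using growth_lower[OF that(1) less_imp_le[OF \<sigma>(1)] that(2)] by (simp add: k\<mu>)
  have M3: "(\<lambda>p. cmod (\<Psi> p (zs i)) / ?M p) \<longlonglongrightarrow> 0" if "i \<in> {1..k}" for i
  proof -
    have i: "i \<in> {1..\<mu>}" using that k\<mu> by simp
    show ?thesis by (rule ratio_tendsto_0[OF poles(1)[OF i] \<sigma>(4)[OF i], of ?M]) simp_all
  qed
  note b = main_bounds[OF \<sigma>(1,3,4) M1 M2 M3 C(1) CU]
  show "\<forall>\<^sub>F p in sequentially. \<exists>!c. itea_coeffs ip q F (\<xi> p) p k c"
    by (rule b(1)) assumption+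
  show "\<forall>\<^sub>F p in sequentially. \<forall>c. itea_coeffs ip q F (\<xi> p) p k c \<longrightarrow>
       (\<forall>z\<in>C. itea_denominator (\<xi> p) k c z \<noteq> 0)"
    by (rule b(2)) assumption+
  have "\<exists>D\<ge>0. \<forall>\<^sub>F p in sequentially. \<forall>z\<in>C.
       nrm (F z - itea ip q F (\<xi> p) p k z) \<le> D * (cmod (node_poly (\<xi> p) 1 p z) / ?M p)"
    by (rule b(3)) assumption+
  moreover have "\<forall>\<^sub>F p in sequentially. (\<kappa> * \<tau>) ^ p \<le> ?M p"
    using \<kappa>_pos \<tau>(1) \<sigma>(2) by (intro always_eventually allI power_mono mult_left_mono) auto
  ultimately show "\<exists>D M. D \<ge> 0 \<and> (\<forall>\<^sub>F p in sequentially. (\<kappa> * \<tau>) ^ p \<le> M p) \<and> (\<forall>\<^sub>F p in sequentially. \<forall>z\<in>C.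
       nrm (F z - itea ip q F (\<xi> p) p k z) \<le> D * (cmod (node_poly (\<xi> p) 1 p z) / M p))"
    by blast
qed

lemma nrm_nonneg: "nrm x \<ge> 0"
  using nrm by (simp add: is_vector_norm_def)

text \<open>\<tau>0 will be \<Phi>(z_{k+1}) if k < \<mu> and \<rho> if k = \<mu>. As E is itself a
  compact set without poles on which \<Phi> = 1, the estimates on E are special cases.\<close>

lemma limsup_bounds:
  assumes \<tau>0: "\<tau>0 > 1"
    and bound: "\<And>C \<tau>. compact C \<Longrightarrow> C \<subseteq> {z. \<Phi> z < \<rho>} - zs ` {1..\<mu>} \<Longrightarrow> 1 \<le> \<tau> \<Longrightarrow> \<tau> < \<tau>0 \<Longrightarrow>
      \<exists>D M. D \<ge> 0 \<and> (\<forall>\<^sub>F p in sequentially. (\<kappa> * \<tau>) ^ p \<le> M p) \<and> (\<forall>\<^sub>F p in sequentially. \<forall>z\<in>C.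
        nrm (F z - itea ip q F (\<xi> p) p k z) \<le> D * (cmod (node_poly (\<xi> p) 1 p z) / M p))"
  shows "\<forall>z\<in>{z. \<Phi> z < \<rho>} - zs ` {1..\<mu>}.
      limsup (\<lambda>p. ereal (root p (nrm (F z - itea ip q F (\<xi> p) p k z)))) \<le> ereal (\<Phi> z / \<tau>0)"
    and "\<forall>C. compact C \<longrightarrow> C \<subseteq> {z. \<Phi> z < \<rho>} - zs ` {1..\<mu>} \<longrightarrow>
      limsup_le_uniformly_on C (\<lambda>p z. root p (nrm (F z - itea ip q F (\<xi> p) p k z))) (\<lambda>z. \<Phi> z / \<tau>0)"
    and "\<forall>z\<in>E. limsup (\<lambda>p. ereal (root p (nrm (F z - itea ip q F (\<xi> p) p k z)))) \<le> ereal (1 / \<tau>0)"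
    and "limsup_le_uniformly_on E (\<lambda>p z. root p (nrm (F z - itea ip q F (\<xi> p) p k z))) (\<lambda>z. 1 / \<tau>0)"
proof -
  have uni: "limsup_le_uniformly_on C (\<lambda>p z. root p (nrm (F z - itea ip q F (\<xi> p) p k z))) (\<lambda>z. \<Phi> z / \<tau>0)"
    if C: "compact C" "C \<subseteq> {z. \<Phi> z < \<rho>} - zs ` {1..\<mu>}" for C
    by (rule limsup_uniform[OF C(1) \<tau>0]) (rule bound[OF C])
  then show "\<forall>C. compact C \<longrightarrow> C \<subseteq> {z. \<Phi> z < \<rho>} - zs ` {1..\<mu>} \<longrightarrow>
      limsup_le_uniformly_on C (\<lambda>p z. root p (nrm (F z - itea ip q F (\<xi> p) p k z))) (\<lambda>z. \<Phi> z / \<tau>0)"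
    by (intro allI impI)
  show "\<forall>z\<in>{z. \<Phi> z < \<rho>} - zs ` {1..\<mu>}.
      limsup (\<lambda>p. ereal (root p (nrm (F z - itea ip q F (\<xi> p) p k z)))) \<le> ereal (\<Phi> z / \<tau>0)"
  proof
    fix z assume "z \<in> {z. \<Phi> z < \<rho>} - zs ` {1..\<mu>}"
    then show "limsup (\<lambda>p. ereal (root p (nrm (F z - itea ip q F (\<xi> p) p k z)))) \<le> ereal (\<Phi> z / \<tau>0)"
      by (intro limsup_from_uniform[OF uni[of "{z}"]]) auto
  qed
  have "E \<subseteq> {z. \<Phi> z < \<rho>} - zs ` {1..\<mu>}" using E_subset_U[OF rho] by (simp add: U_def)
  from uni[OF compact_E this]
  show E: "limsup_le_uniformly_on E (\<lambda>p z. root p (nrm (F z - itea ip q F (\<xi> p) p k z))) (\<lambda>z. 1 / \<tau>0)"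
    by (simp add: limsup_le_uniformly_on_def \<Phi>_E)
  show "\<forall>z\<in>E. limsup (\<lambda>p. ereal (root p (nrm (F z - itea ip q F (\<xi> p) p k z)))) \<le> ereal (1 / \<tau>0)"
    by (intro ballI limsup_from_uniform[OF E])
qed

end

section \<open>The case k < \<mu>\<close>

locale itea_setting_gap = itea_setting E g \<xi> k \<kappa> ip nrm q F \<Theta> \<mu> zs v \<rho>
  for E :: "complex set" and g :: "complex \<Rightarrow> real" and \<xi> :: "nat \<Rightarrow> nat \<Rightarrow> complex" and k :: nat and \<kappa> :: real
    and ip :: "complex ^ 'n \<Rightarrow> complex ^ 'n \<Rightarrow> complex" and nrm :: "complex ^ 'n \<Rightarrow> real"
    and q :: "complex ^ 'n" and F \<Theta> :: "complex \<Rightarrow> complex ^ 'n"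
    and \<mu> :: nat and zs :: "nat \<Rightarrow> complex" and v :: "nat \<Rightarrow> complex ^ 'n" and \<rho> :: real +
  fixes r :: nat
  assumes r: "1 \<le> r" "k + r \<le> \<mu>"
    and small_poles: "\<And>s. s \<in> {1..k} \<Longrightarrow> \<Phi> (zs s) < \<Phi> (zs (k + 1))"
    and equal_poles: "\<And>j. j \<in> {1..r} \<Longrightarrow> \<Phi> (zs (k + j)) = \<Phi> (zs (k + 1))"
    and large_poles: "\<And>s. s \<in> {k + r + 1..\<mu>} \<Longrightarrow> \<Phi> (zs (k + 1)) < \<Phi> (zs s)"
begin

text \<open>The modulus of \<Psi>-tilde. A minimum is taken because the r values have equal growth
  rate but may differ by subexponential factors.\<close>

definition "m p = Min ((\<lambda>j. cmod (\<Psi> p (zs (k + j)))) ` {1..r})"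

lemma m_le: "j \<in> {1..r} \<Longrightarrow> m p \<le> cmod (\<Psi> p (zs (k + j)))"
  unfolding m_def by (intro Min_le) auto

lemma next_pole: "zs (k + 1) \<notin> E" "\<Phi> (zs (k + 1)) > 1"
proof -
  show "zs (k + 1) \<notin> E" using r by (intro poles(1)) simp
  then show "\<Phi> (zs (k + 1)) > 1" by (rule \<Phi>_gt_1)
qed

lemma m_lower:
  assumes \<tau>: "1 \<le> \<tau>" "\<tau> < \<Phi> (zs (k + 1))"
  shows "\<forall>\<^sub>F p in sequentially. (\<kappa> * \<tau>) ^ p \<le> m p"
proof -
  have "\<forall>\<^sub>F p in sequentially. \<forall>w\<in>(\<lambda>j. zs (k + j)) ` {1..r}. (\<kappa> * \<tau>) ^ p \<le> cmod (\<Psi> p w)"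
  proof (rule growth_lower[OF _ \<tau>(1)])
    show "\<tau> < \<Phi> w" if "w \<in> (\<lambda>j. zs (k + j)) ` {1..r}" for w
      using that equal_poles \<tau>(2) by auto
  qed (intro finite_imp_compact, simp)
  then show ?thesis
    by eventually_elim (use r in \<open>auto simp: m_def\<close>)
qed

lemma m_pos: "\<forall>\<^sub>F p in sequentially. m p > 0"
proof -
  have "\<forall>\<^sub>F p in sequentially. (\<kappa> * 1) ^ p \<le> m p" by (rule m_lower) (use next_pole in auto)
  then show ?thesis
  proof eventually_elim
    case (elim p)
    have "(\<kappa> * 1) ^ p > 0" using \<kappa>_pos by simp
    then show ?case using elim by linarith
  qed
qed

text \<open>z_{k+1}, ..., z_{k+r} are covered by the minimum itself. The rest of the support lies on
  strictly higher levels, where |\<Psi>_p| eventually exceeds |\<Psi>_p(z_{k+1})|, one of the values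
  in the minimum.\<close>

lemma m_minorant:
  assumes L0: "compact L\<^sub>0" "\<And>w. w \<in> L\<^sub>0 \<Longrightarrow> \<Phi> (zs (k + 1)) < \<Phi> w"
  shows "\<forall>\<^sub>F p in sequentially. \<forall>w\<in>L\<^sub>0 \<union> zs ` {k + 1..\<mu>}. m p \<le> cmod (\<Psi> p w)"
proof -
  let ?C = "L\<^sub>0 \<union> zs ` {k + r + 1..\<mu>}"
  have C: "compact ?C" by (intro compact_Un L0(1) finite_imp_compact) simp
  have big: "\<Phi> (zs (k + 1)) < \<Phi> w" if "w \<in> ?C" for w using that L0(2) large_poles by auto
  obtain \<epsilon> where \<epsilon>: "\<epsilon> \<longlonglongrightarrow> 0" "\<forall>\<^sub>F p in sequentially. \<forall>w\<in>?C. cmod (\<Psi> p (zs (k + 1))) \<le> \<epsilon> p * cmod (\<Psi> p w)"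
    by (rule dominated_on_compact[OF C big next_pole(1)]) (assumption, rule that)
  have "\<forall>\<^sub>F p in sequentially. \<epsilon> p < 1" by (rule order_tendstoD(2)[OF \<epsilon>(1)]) simp
  with \<epsilon>(2) show ?thesis
  proof eventually_elim
    case (elim p)
    show ?case
    proof
      fix w assume w: "w \<in> L\<^sub>0 \<union> zs ` {k + 1..\<mu>}"
      show "m p \<le> cmod (\<Psi> p w)"
      proof (cases "w \<in> ?C")
        case True
        have "m p \<le> cmod (\<Psi> p (zs (k + 1)))" using m_le[of 1 p] r by simp
        also have "\<dots> \<le> \<epsilon> p * cmod (\<Psi> p w)" using elim(1) True by blast
        also have "\<dots> \<le> 1 * cmod (\<Psi> p w)" using elim(2) by (intro mult_right_mono) auto
        finally show ?thesis by simp
      next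
        case False
        then obtain s where s: "s \<in> {k + 1..\<mu>}" "w = zs s" "s \<notin> {k + r + 1..\<mu>}" using w by blast
        then have "s - k \<in> {1..r}" "k + (s - k) = s" by auto
        then show ?thesis using m_le[of "s - k" p] s(2) by simp
      qed
    qed
  qed
qed

text \<open>A level between \<Phi>(z_i) and \<Phi>(z_{k+1}) separates the growth rates; this is
  where the gap after z_k enters.\<close>

lemma m_dominates:
  assumes i: "i \<in> {1..k}" shows "(\<lambda>p. cmod (\<Psi> p (zs i)) / m p) \<longlonglongrightarrow> 0"
proof -
  from dense[OF small_poles[OF i]] obtain \<tau> where \<tau>: "\<Phi> (zs i) < \<tau>" "\<tau> < \<Phi> (zs (k + 1))" by (elim exE conjE)
  have \<tau>1: "1 \<le> \<tau>" using \<tau>(1) \<Phi>_ge_1[of "zs i"] by linarith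
  have "zs i \<notin> E" using i k by (intro poles(1)) simp
  then show ?thesis by (rule ratio_tendsto_0[OF _ \<tau>(1) m_lower[OF \<tau>1 \<tau>(2)]])
qed

lemma gap_radius:
  assumes C: "compact C" "C \<subseteq> {z. \<Phi> z < \<rho>} - zs ` {1..\<mu>}"
  obtains \<sigma> where "1 < \<sigma>" "\<sigma> < \<rho>" "\<And>s. s \<in> {1..\<mu>} \<Longrightarrow> \<Phi> (zs s) < \<sigma>" "C \<subseteq> U \<sigma>"
    "\<And>L\<^sub>0. compact L\<^sub>0 \<Longrightarrow> (\<And>w. w \<in> L\<^sub>0 \<Longrightarrow> \<sigma> < \<Phi> w) \<Longrightarrow>
       \<forall>\<^sub>F p in sequentially. \<forall>w\<in>L\<^sub>0 \<union> zs ` {k + 1..\<mu>}. m p \<le> cmod (\<Psi> p w)"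
proof -
  have "C \<subseteq> {z. \<Phi> z < \<rho>}" using C(2) by blast
  then obtain \<sigma> where \<sigma>: "1 < \<sigma>" "\<sigma> < \<rho>" "\<And>s. s \<in> {1..\<mu>} \<Longrightarrow> \<Phi> (zs s) < \<sigma>" "\<And>z. z \<in> C \<Longrightarrow> \<Phi> z < \<sigma>"
    using sublevel_radius[OF C(1) _ rho] by metis
  show ?thesis
  proof (rule that[OF \<sigma>(1-3)])
    show "C \<subseteq> U \<sigma>" using C(2) \<sigma>(4) by (auto simp: U_def)
    fix L\<^sub>0 assume L0: "compact L\<^sub>0" "\<And>w. w \<in> L\<^sub>0 \<Longrightarrow> \<sigma> < \<Phi> w"
    have "\<Phi> (zs (k + 1)) < \<sigma>" using \<sigma>(3)[of "k + 1"] r by simp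
    then show "\<forall>\<^sub>F p in sequentially. \<forall>w\<in>L\<^sub>0 \<union> zs ` {k + 1..\<mu>}. m p \<le> cmod (\<Psi> p w)"
      using L0(2) by (intro m_minorant[OF L0(1)]) force
  qed
qed

lemma bounds_with_further_poles:
  assumes C: "compact C" "C \<subseteq> {z. \<Phi> z < \<rho>} - zs ` {1..\<mu>}"
  shows "\<forall>\<^sub>F p in sequentially. \<exists>!c. itea_coeffs ip q F (\<xi> p) p k c"
    and "\<forall>\<^sub>F p in sequentially. \<forall>c. itea_coeffs ip q F (\<xi> p) p k c \<longrightarrow>
       (\<forall>z\<in>C. itea_denominator (\<xi> p) k c z \<noteq> 0)"
    and "\<exists>D\<ge>0. \<forall>\<^sub>F p in sequentially. \<forall>z\<in>C.
       nrm (F z - itea ip q F (\<xi> p) p k z) \<le> D * (cmod (node_poly (\<xi> p) 1 p z) / m p)"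
proof -
  obtain \<sigma> where \<sigma>: "1 < \<sigma>" "\<sigma> < \<rho>" "\<And>s. s \<in> {1..\<mu>} \<Longrightarrow> \<Phi> (zs s) < \<sigma>" "C \<subseteq> U \<sigma>"
    and M: "\<And>L\<^sub>0. compact L\<^sub>0 \<Longrightarrow> (\<And>w. w \<in> L\<^sub>0 \<Longrightarrow> \<sigma> < \<Phi> w) \<Longrightarrow>
       \<forall>\<^sub>F p in sequentially. \<forall>w\<in>L\<^sub>0 \<union> zs ` {k + 1..\<mu>}. m p \<le> cmod (\<Psi> p w)"
    using gap_radius[OF C] by blast
  note b = main_bounds[OF \<sigma>(1-3) m_pos M m_dominates C(1) \<sigma>(4)]
  show "\<forall>\<^sub>F p in sequentially. \<exists>!c. itea_coeffs ip q F (\<xi> p) p k c"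
    by (rule b(1)) assumption+
  show "\<forall>\<^sub>F p in sequentially. \<forall>c. itea_coeffs ip q F (\<xi> p) p k c \<longrightarrow>
       (\<forall>z\<in>C. itea_denominator (\<xi> p) k c z \<noteq> 0)"
    by (rule b(2)) assumption+
  show "\<exists>D\<ge>0. \<forall>\<^sub>F p in sequentially. \<forall>z\<in>C.
       nrm (F z - itea ip q F (\<xi> p) p k z) \<le> D * (cmod (node_poly (\<xi> p) 1 p z) / m p)"
    by (rule b(3)) assumption+
qed

text \<open>Apart from (q, v_s), each entry is a product of at most k - 1 differences z_s - \<xi>_j,
  and the nodes stay bounded.\<close>

lemma itea_T_bounded: "\<exists>A>0. \<forall>\<^sub>F p in sequentially. cmod (itea_T ip q v zs (\<xi> p) p k (\<lambda>j. j)) \<le> A"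
proof -
  obtain B where B: "\<forall>\<^sub>F p in sequentially. \<forall>i\<in>{1..p + k}. cmod (\<xi> p i) \<le> B"
    using nodes_bounded by (elim exE)
  define R where "R = (\<Sum>s=1..k. cmod (zs s))"
  define V where "V = (\<Sum>s=1..k. cmod (ip q (v s)))"
  \<comment> \<open>Being at least 1, \<open>b\<close> allows all these products to be compared with
    \<open>b ^ k\<close>, whatever their number of factors.\<close>
  define b where "b = 1 + R + \<bar>B\<bar>"
  have R0: "R \<ge> 0" "V \<ge> 0" unfolding R_def V_def by (intro sum_nonneg norm_ge_zero)+
  have b1: "b \<ge> 1" using R0 by (simp add: b_def)
  let ?A = "\<Sum>\<pi> \<in> {\<pi>. \<pi> permutes {0..<k}}. (V * b ^ k) ^ k"
  have "\<forall>\<^sub>F p in sequentially. cmod (itea_T ip q v zs (\<xi> p) p k (\<lambda>j. j)) \<le> ?A"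
    using B
  proof eventually_elim
    case (elim p)
    show ?case
    proof (rule itea_T_bound)
      fix i s assume i: "i \<in> {1..k}" and s: "s \<in> {1..k}"
      have zR: "cmod (zs s) \<le> R" unfolding R_def using s by (intro member_le_sum[where f="\<lambda>s. cmod (zs s)"]) auto
      have vV: "cmod (ip q (v s)) \<le> V" unfolding V_def using s by (intro member_le_sum[where f="\<lambda>s. cmod (ip q (v s))"]) auto
      have "cmod (node_poly (\<xi> p) (p + i + 1) (p + k) (zs s)) \<le> (R + \<bar>B\<bar>) ^ card {p + i + 1..p + k}"
      proof (rule node_poly_bound)
        fix j assume "j \<in> {p + i + 1..p + k}"
        then have "cmod (\<xi> p j) \<le> B" using elim by simp
        then show "cmod (\<xi> p j) \<le> \<bar>B\<bar>" by linarith
      qed (use zR in auto)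
      also have "\<dots> \<le> b ^ card {p + i + 1..p + k}" using R0 by (intro power_mono) (auto simp: b_def)
      also have "\<dots> \<le> b ^ k" using b1 by (intro power_increasing) auto
      finally show "cmod (alpha ip q v zs (\<xi> p) p k i s) \<le> V * b ^ k"
        unfolding alpha_def norm_mult using vV R0 by (intro mult_mono) auto
    qed
  qed
  then have "\<forall>\<^sub>F p in sequentially. cmod (itea_T ip q v zs (\<xi> p) p k (\<lambda>j. j)) \<le> \<bar>?A\<bar> + 1"
    by (rule eventually_mono) linarith
  then show ?thesis by (intro exI[of _ "\<bar>?A\<bar> + 1"] conjI) auto
qed

text \<open>For r = 1 the pole z_{k+1} is alone on its level, so |\<Psi>_p| on the remaining support
  dominates its value there. The remainders of the components are assembled into one null sequence
  for the norm.\<close>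

lemma refined_asymptotics:
  assumes r1: "r = 1" and z: "\<Phi> z < \<rho>" "z \<notin> zs ` {1..\<mu>}"
  obtains s A where "s \<longlonglongrightarrow> (0::real)"
    "\<forall>\<^sub>F p in sequentially. nrm (F z - itea ip q F (\<xi> p) p k z -
        (node_poly (\<xi> p) 1 p z / \<Psi> p (zs (k + 1))) *s itea_B ip q v zs (\<xi> p) p k z)
      \<le> cmod (node_poly (\<xi> p) 1 p z / \<Psi> p (zs (k + 1))) * s p"
    "\<forall>\<^sub>F p in sequentially. nrm (itea_B ip q v zs (\<xi> p) p k z) \<le> A"
proof -
  have zC: "compact {z}" "{z} \<subseteq> {z. \<Phi> z < \<rho>} - zs ` {1..\<mu>}" using z by auto
  obtain \<sigma> where \<sigma>: "1 < \<sigma>" "\<sigma> < \<rho>" "\<And>s. s \<in> {1..\<mu>} \<Longrightarrow> \<Phi> (zs s) < \<sigma>" "{z} \<subseteq> U \<sigma>"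
    and M: "\<And>L\<^sub>0. compact L\<^sub>0 \<Longrightarrow> (\<And>w. w \<in> L\<^sub>0 \<Longrightarrow> \<sigma> < \<Phi> w) \<Longrightarrow>
       \<forall>\<^sub>F p in sequentially. \<forall>w\<in>L\<^sub>0 \<union> zs ` {k + 1..\<mu>}. m p \<le> cmod (\<Psi> p w)"
    using gap_radius[OF zC] by blast
  have "\<exists>L\<^sub>0 \<Lambda> Bd. compact L\<^sub>0 \<and> (\<forall>w\<in>L\<^sub>0. \<sigma> < \<Phi> w) \<and> itea_asymptotics F v zs \<mu> k \<xi> ip q (\<lambda>i. ip q (axis i 1)) \<Lambda> L\<^sub>0 (U \<sigma>) m Bd"
  proof (rule asymptotics_instance[where \<sigma>=\<sigma> and M=m])
    fix L\<^sub>0 \<Lambda> Bd assume "compact L\<^sub>0" "\<forall>w\<in>L\<^sub>0. \<sigma> < \<Phi> w" "itea_asymptotics F v zs \<mu> k \<xi> ip q (\<lambda>i. ip q (axis i 1)) \<Lambda> L\<^sub>0 (U \<sigma>) m Bd"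
    then show ?thesis by (intro exI conjI)
  qed (fact \<sigma> M m_pos m_dominates)+
  then obtain L\<^sub>0 \<Lambda> Bd where L0: "compact L\<^sub>0" "\<forall>w\<in>L\<^sub>0. \<sigma> < \<Phi> w"
    and inst: "itea_asymptotics F v zs \<mu> k \<xi> ip q (\<lambda>i. ip q (axis i 1)) \<Lambda> L\<^sub>0 (U \<sigma>) m Bd"
    by (elim exE conjE)
  interpret A: itea_asymptotics F v zs \<mu> k \<xi> ip q "\<lambda>i. ip q (axis i 1)" \<Lambda> L\<^sub>0 "U \<sigma>" m Bd by (rule inst)
  have k\<mu>: "k < \<mu>" using r by simp
  have zU: "z \<in> U \<sigma>" using \<sigma>(4) by simp
  have L2: "compact A.L\<^sub>2" unfolding A.L\<^sub>2_def by (intro compact_Un L0(1) finite_imp_compact) simp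
  have "\<Phi> (zs (k + 1)) < \<sigma>" using \<sigma>(3)[of "k + 1"] r by simp
  then have big: "\<Phi> (zs (k + 1)) < \<Phi> w" if "w \<in> A.L\<^sub>2" for w
    using that L0(2) large_poles r1 unfolding A.L\<^sub>2_def by force
  obtain \<epsilon> where \<epsilon>: "\<epsilon> \<longlonglongrightarrow> 0" "\<forall>\<^sub>F p in sequentially. \<forall>w\<in>A.L\<^sub>2. cmod (\<Psi> p (zs (k + 1))) \<le> \<epsilon> p * cmod (\<Psi> p w)"
    by (rule dominated_on_compact[OF L2 big next_pole(1)]) (assumption, rule that)
  obtain \<eta> where \<eta>: "\<And>i. \<eta> i \<longlonglongrightarrow> 0" and ev: "\<forall>\<^sub>F p in sequentially. \<forall>i. (F z - itea ip q F (\<xi> p) p k z) $ i =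
       node_poly (\<xi> p) 1 p z / \<Psi> p (zs (k + 1)) * (itea_B ip q v zs (\<xi> p) p k z $ i + \<eta> i p)"
    using A.refined_error[OF k\<mu> \<epsilon>(1) zU \<epsilon>(2)] by blast
  define s where "s = (\<lambda>p. \<Sum>i\<in>UNIV. cmod (\<eta> i p) * nrm (axis i 1))"
  have "s \<longlonglongrightarrow> (\<Sum>i\<in>UNIV. 0 * nrm (axis i 1 :: complex ^ 'n))"
    unfolding s_def by (intro tendsto_sum tendsto_mult tendsto_norm_zero \<eta> tendsto_const)
  then have s: "s \<longlonglongrightarrow> 0" by simp
  have nn: "nrm x \<ge> 0" for x using nrm unfolding is_vector_norm_def by blast
  have R: "\<forall>\<^sub>F p in sequentially. nrm (F z - itea ip q F (\<xi> p) p k z -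
        (node_poly (\<xi> p) 1 p z / \<Psi> p (zs (k + 1))) *s itea_B ip q v zs (\<xi> p) p k z)
      \<le> cmod (node_poly (\<xi> p) 1 p z / \<Psi> p (zs (k + 1))) * s p"
    using ev
  proof eventually_elim
    case (elim p)
    let ?c = "node_poly (\<xi> p) 1 p z / \<Psi> p (zs (k + 1))"
    let ?x = "F z - itea ip q F (\<xi> p) p k z - ?c *s itea_B ip q v zs (\<xi> p) p k z"
    have "?x $ i = ?c * \<eta> i p" for i
      unfolding vector_minus_component[of "F z - itea ip q F (\<xi> p) p k z"] elim[rule_format] vector_smult_component distrib_left
      by (rule add_diff_cancel_left')
    then have "nrm ?x \<le> (\<Sum>i\<in>UNIV. cmod (?c * \<eta> i p) * nrm (axis i 1))" using vector_norm_le[OF nrm, of ?x] by (simp only:)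
    then show ?case by (simp only: s_def norm_mult sum_distrib_left mult.assoc)
  qed
  have "\<forall>i. \<exists>A. \<forall>\<^sub>F p in sequentially. cmod (A.leading p i z) \<le> A"
    by (intro allI A.leading_bounded[OF k\<mu> zU])
  from choice[OF this] obtain a where a: "\<forall>i. \<forall>\<^sub>F p in sequentially. cmod (A.leading p i z) \<le> a i" by (elim exE)
  then have a': "\<forall>\<^sub>F p in sequentially. \<forall>i. cmod (A.leading p i z) \<le> a i"
    by (subst eventually_all_finite) auto
  let ?P = "A.P\<^sub>0 (zs (k + 1)) / A.P\<^sub>0 z"
  have "\<forall>\<^sub>F p in sequentially. nrm (itea_B ip q v zs (\<xi> p) p k z) \<le> (\<Sum>i\<in>UNIV. (cmod ?P * a i) * nrm (axis i 1 :: complex ^ 'n))"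
    using a'
  proof eventually_elim
    case (elim p)
    have "cmod (itea_B ip q v zs (\<xi> p) p k z $ i) \<le> cmod ?P * a i" for i
      unfolding A.itea_B_component norm_mult[of ?P] using elim by (intro mult_left_mono) auto
    then show ?case
      by (intro order.trans[OF vector_norm_le[OF nrm] sum_mono] mult_right_mono nn)
  qed
  then show ?thesis by (rule that[OF s R])
qed

text \<open>Off E the tail is bounded below, so \<psi>_{1,p} may be replaced by \<Psi>_p. On E a
  node of the tail may hit z and make \<Psi>_p(z) vanish; there the bound by \<psi>_{1,p} is the one
  that survives.\<close>

lemma bound_off_E:
  assumes C: "compact C" "C \<subseteq> {z. \<Phi> z < \<rho>} - zs ` {1..\<mu>} - E"
  shows "\<exists>M. \<forall>\<^sub>F p in sequentially. \<forall>z\<in>C.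
     nrm (F z - itea ip q F (\<xi> p) p k z) \<le> M * (cmod (\<Psi> p z) / m p)"
proof -
  have "C \<subseteq> {z. \<Phi> z < \<rho>} - zs ` {1..\<mu>}" "C \<subseteq> - E" using C(2) by auto
  obtain D where D: "D \<ge> 0" "\<forall>\<^sub>F p in sequentially. \<forall>z\<in>C.
       nrm (F z - itea ip q F (\<xi> p) p k z) \<le> D * (cmod (node_poly (\<xi> p) 1 p z) / m p)"
    using bounds_with_further_poles(3)[OF C(1) \<open>C \<subseteq> {z. \<Phi> z < \<rho>} - zs ` {1..\<mu>}\<close>] by (elim exE conjE)
  obtain \<delta> where \<delta>: "\<delta> > 0" "\<forall>\<^sub>F p in sequentially. \<forall>z\<in>C. \<delta> \<le> cmod (tail p z)"
    using tail_lower[OF C(1) \<open>C \<subseteq> - E\<close>] .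
  have "\<forall>\<^sub>F p in sequentially. \<forall>z\<in>C. nrm (F z - itea ip q F (\<xi> p) p k z) \<le> D / \<delta> * (cmod (\<Psi> p z) / m p)"
    using D(2) \<delta>(2) m_pos
  proof eventually_elim
    case (elim p)
    show ?case
    proof
      fix z assume z: "z \<in> C"
      have "cmod (node_poly (\<xi> p) 1 p z) * \<delta> \<le> cmod (\<Psi> p z)"
        unfolding \<Psi>_split norm_mult by (intro mult_left_mono) (use elim z in auto)
      then have "cmod (node_poly (\<xi> p) 1 p z) \<le> cmod (\<Psi> p z) / \<delta>" using \<delta>(1) by (simp only: pos_le_divide_eq)
      then have "D * (cmod (node_poly (\<xi> p) 1 p z) / m p) \<le> D * (cmod (\<Psi> p z) / \<delta> / m p)"
        using elim D(1) by (intro mult_left_mono divide_right_mono) auto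
      with elim(1) z have "nrm (F z - itea ip q F (\<xi> p) p k z) \<le> D * (cmod (\<Psi> p z) / \<delta> / m p)" by force
      then show "nrm (F z - itea ip q F (\<xi> p) p k z) \<le> D / \<delta> * (cmod (\<Psi> p z) / m p)" by (simp add: mult_ac)
    qed
  qed
  then show ?thesis by (rule exI)
qed

lemma gap_limsup_hypothesis:
  assumes "compact C" "C \<subseteq> {z. \<Phi> z < \<rho>} - zs ` {1..\<mu>}" "1 \<le> \<tau>" "\<tau> < \<Phi> (zs (k + 1))"
  shows "\<exists>D M. D \<ge> 0 \<and> (\<forall>\<^sub>F p in sequentially. (\<kappa> * \<tau>) ^ p \<le> M p) \<and> (\<forall>\<^sub>F p in sequentially. \<forall>z\<in>C.
        nrm (F z - itea ip q F (\<xi> p) p k z) \<le> D * (cmod (node_poly (\<xi> p) 1 p z) / M p))"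
proof -
  obtain D where "D \<ge> 0" "\<forall>\<^sub>F p in sequentially. \<forall>z\<in>C.
       nrm (F z - itea ip q F (\<xi> p) p k z) \<le> D * (cmod (node_poly (\<xi> p) 1 p z) / m p)"
    using bounds_with_further_poles(3)[OF assms(1,2)] by (elim exE conjE)
  then show ?thesis by (intro exI[of _ D] exI[of _ m] conjI m_lower[OF assms(3,4)])
qed

lemma uniform_convergence:
  assumes C: "compact C" "C \<subseteq> {z. \<Phi> z < \<Phi> (zs (k + 1))} - zs ` {1..k}"
  shows "uniform_limit C (\<lambda>p z. nrm (F z - itea ip q F (\<xi> p) p k z)) (\<lambda>z. 0) sequentially"
proof (cases "C = {}")
  case False
  let ?\<sigma> = "\<Phi> (zs (k + 1))"
  have "?\<sigma> < \<rho>" using r by (intro poles(2)) simp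
  \<comment> \<open>Poles beyond z_k have level at least \<Phi>(z_{k+1}), so below that level it
    suffices to leave out z_1, ..., z_k.\<close>
  moreover have "?\<sigma> \<le> \<Phi> (zs s)" if "s \<in> {k + 1..\<mu>}" for s
  proof (cases "s \<le> k + r")
    case True
    then show ?thesis using equal_poles[of "s - k"] that by (simp add: Suc_le_eq)
  next
    case False
    then show ?thesis using large_poles[of s] that by simp
  qed
  ultimately have CK: "C \<subseteq> {z. \<Phi> z < \<rho>} - zs ` {1..\<mu>}" using C(2) by (fastforce simp: not_less_eq_eq)
  obtain z0 where z0: "z0 \<in> C" "\<And>z. z \<in> C \<Longrightarrow> \<Phi> z \<le> \<Phi> z0"
    using continuous_attains_sup[OF C(1) False continuous_\<Phi>] by blast
  show ?thesis
  proof (rule uniform_limit_from_limsup)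
    show "limsup_le_uniformly_on C (\<lambda>p z. root p (nrm (F z - itea ip q F (\<xi> p) p k z))) (\<lambda>z. \<Phi> z / ?\<sigma>)"
      by (rule limsup_uniform[OF C(1) next_pole(2)]) (rule gap_limsup_hypothesis[OF C(1) CK])
    show "\<Phi> z / ?\<sigma> \<le> \<Phi> z0 / ?\<sigma>" if "z \<in> C" for z
      using z0(2)[OF that] next_pole(2) by (intro divide_right_mono) auto
    show "\<Phi> z0 / ?\<sigma> < 1" using z0(1) C(2) next_pole(2) by auto
  qed (rule nrm_nonneg)
qed simp

text \<open>Comparison with the leading term itself requires |B| to stay away from 0. As T is
  bounded above, a positive lower bound for the bordered determinant suffices; being nonzero for
  each p would not prevent B from tending to 0.\<close>

lemma refined_smallo:
  assumes r1: "r = 1" and z: "\<Phi> z < \<rho>" "z \<notin> zs ` {1..\<mu>}"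
  defines "\<delta> p \<equiv> nrm (F z - itea ip q F (\<xi> p) p k z -
        (node_poly (\<xi> p) 1 p z / \<Psi> p (zs (k + 1))) *s itea_B ip q v zs (\<xi> p) p k z)"
  shows "\<delta> \<in> o(\<lambda>p. cmod (node_poly (\<xi> p) 1 p z / \<Psi> p (zs (k + 1))))"
    and "\<exists>\<eta>>0. \<forall>\<^sub>F p in sequentially. nrm (itea_T_hat ip q v zs (\<xi> p) p k (\<lambda>j. j + 1) z) \<ge> \<eta> \<Longrightarrow>
      \<delta> \<in> o(\<lambda>p. nrm ((node_poly (\<xi> p) 1 p z / \<Psi> p (zs (k + 1))) *s itea_B ip q v zs (\<xi> p) p k z))"
    and "\<exists>M. \<forall>\<^sub>F p in sequentially. nrm (itea_B ip q v zs (\<xi> p) p k z) \<le> M"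
proof -
  let ?c = "\<lambda>p. node_poly (\<xi> p) 1 p z / \<Psi> p (zs (k + 1))"
  obtain s A where s: "s \<longlonglongrightarrow> (0::real)" "\<forall>\<^sub>F p in sequentially. \<delta> p \<le> cmod (?c p) * s p"
    and A: "\<forall>\<^sub>F p in sequentially. nrm (itea_B ip q v zs (\<xi> p) p k z) \<le> A"
    using refined_asymptotics[OF r1 z] unfolding \<delta>_def .
  show "\<exists>M. \<forall>\<^sub>F p in sequentially. nrm (itea_B ip q v zs (\<xi> p) p k z) \<le> M" using A by (rule exI)
  show small: "\<delta> \<in> o(\<lambda>p. cmod (?c p))"
  proof (rule landau_o.smallI)
    fix e :: real assume e: "e > 0"
    have "\<forall>\<^sub>F p in sequentially. s p < e" by (rule order_tendstoD(2)[OF s(1) e])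
    with s(2) show "\<forall>\<^sub>F p in sequentially. norm (\<delta> p) \<le> e * norm (cmod (?c p))"
    proof eventually_elim
      case (elim p)
      have "cmod (?c p) * s p \<le> cmod (?c p) * e" using elim(2) by (intro mult_left_mono) auto
      moreover have "\<delta> p \<ge> 0" unfolding \<delta>_def by (rule nrm_nonneg)
      ultimately show ?case using elim(1) by (simp add: mult.commute[of e])
    qed
  qed
  assume "\<exists>\<eta>>0. \<forall>\<^sub>F p in sequentially. nrm (itea_T_hat ip q v zs (\<xi> p) p k (\<lambda>j. j + 1) z) \<ge> \<eta>"
  then obtain \<eta> where \<eta>: "\<eta> > 0" "\<forall>\<^sub>F p in sequentially. nrm (itea_T_hat ip q v zs (\<xi> p) p k (\<lambda>j. j + 1) z) \<ge> \<eta>"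
    by (elim exE conjE)
  obtain a where a: "a > 0" "\<forall>\<^sub>F p in sequentially. cmod (itea_T ip q v zs (\<xi> p) p k (\<lambda>j. j)) \<le> a"
    using itea_T_bounded by (elim exE conjE)
  have scale: "nrm (c *s x) = cmod c * nrm x" for c x using nrm by (simp add: is_vector_norm_def)
  define P where "P = cmod (\<Prod>i=1..k. (zs (k + 1) - zs i) / (z - zs i))"
  have "zs (k + 1) \<noteq> zs i" "z \<noteq> zs i" if "i \<in> {1..k}" for i
    using inj_onD[OF inj, of "k + 1" i] that r z(2) k by auto
  then have P: "P > 0" unfolding P_def by simp
  have injk: "inj_on zs {1..k}" by (rule inj_on_subset[OF inj]) (use k in auto)
  have T: "itea_T ip q v zs (\<xi> p) p k (\<lambda>j. j) \<noteq> 0" for p by (rule itea_T_nonzero[OF injk]) (rule qv)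
  have "(\<lambda>p. cmod (?c p)) \<in> O(\<lambda>p. nrm (?c p *s itea_B ip q v zs (\<xi> p) p k z))"
  proof (rule bigoI)
    show "\<forall>\<^sub>F p in sequentially. norm (cmod (?c p)) \<le> a / (P * \<eta>) * norm (nrm (?c p *s itea_B ip q v zs (\<xi> p) p k z))"
      using \<eta>(2) a(2)
    proof eventually_elim
      case (elim p)
      let ?T = "itea_T ip q v zs (\<xi> p) p k (\<lambda>j. j)"
      have "P * \<eta> / a \<le> P * nrm (itea_T_hat ip q v zs (\<xi> p) p k (\<lambda>j. j + 1) z) / cmod ?T"
        using elim P \<eta>(1) T[of p] by (intro frac_le mult_left_mono mult_nonneg_nonneg nrm_nonneg) auto
      also have "\<dots> = nrm (itea_B ip q v zs (\<xi> p) p k z)"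
        unfolding itea_B_def scale by (simp add: P_def norm_mult norm_divide norm_power)
      finally have "1 \<le> a / (P * \<eta>) * nrm (itea_B ip q v zs (\<xi> p) p k z)"
        using P \<eta>(1) a(1) by (simp add: divide_simps mult_ac)
      then have "cmod (?c p) * 1 \<le> cmod (?c p) * (a / (P * \<eta>) * nrm (itea_B ip q v zs (\<xi> p) p k z))"
        by (intro mult_left_mono) auto
      then show ?case unfolding scale by (simp add: abs_mult nrm_nonneg mult_ac)
    qed
  qed
  then show "\<delta> \<in> o(\<lambda>p. nrm (?c p *s itea_B ip q v zs (\<xi> p) p k z))"
    by (rule landau_o.small_big_trans[OF small])
qed

end

section \<open>Assembly of the two cases\<close>

text \<open>The relation ~ is rendered as smallness of the remainder against the scalar factor for
  every z, and against the leading term where the bordered determinant stays away from 0. By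
  \<open>inside_level_curve\<close> the domains involved are sublevel sets of \<Phi> without
  poles.\<close>

theorem theorem6p4:
  fixes E :: "complex set" and g :: "complex \<Rightarrow> real"
    and \<xi> :: "nat \<Rightarrow> nat \<Rightarrow> complex"
    and ip :: "complex ^ 'n \<Rightarrow> complex ^ 'n \<Rightarrow> complex" and nrm :: "complex ^ 'n \<Rightarrow> real"
    and q :: "complex ^ 'n"
    and F \<Theta> :: "complex \<Rightarrow> complex ^ 'n"
    and \<mu> k r :: nat and zs :: "nat \<Rightarrow> complex" and v :: "nat \<Rightarrow> complex ^ 'n"
    and \<rho> :: real
  defines "\<Phi> \<equiv> green_exp E g"
  defines "E\<^sub>\<rho> \<equiv> inside (level_curve \<Phi> \<rho>)"
  defines "K' \<equiv> E\<^sub>\<rho> - zs ` {1..\<mu>}"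
  defines "\<Psi> \<equiv> (\<lambda>p z. node_poly (\<xi> p) 1 (p + k) z)"
  defines "R \<equiv> (\<lambda>p z. itea ip q F (\<xi> p) p k z)"
  defines "err \<equiv> (\<lambda>p z. nrm (F z - R p z))"
  defines "X \<equiv> (\<lambda>p z. (node_poly (\<xi> p) 1 p z / \<Psi> p (zs (k + 1))) *s itea_B ip q v zs (\<xi> p) p k z)"
  assumes E: "compact E" "greens_function E g"
    and consecutive: "\<And>p. p \<ge> 1 \<Longrightarrow> equal_points_consecutive (p + k) (\<xi> p)"
    and no_limit_points: "\<And>\<zeta>. \<zeta> \<in> - E \<Longrightarrow> \<not> finite_limit_point k \<xi> \<zeta>" "\<not> infinite_limit_point k \<xi>"
    and nodes: "\<And>C. compact C \<Longrightarrow> C \<subseteq> - E \<Longrightarrow>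
      uniform_limit C (\<lambda>p z. root p (cmod (\<Prod>i=1..p + k. z - \<xi> p i)))
        (\<lambda>z. log_capacity E * \<Phi> z) sequentially"
    and ip: "is_inner_product ip" and nrm: "is_vector_norm nrm" and q: "q \<noteq> 0"
    and rho: "\<rho> > 1"
    and poles: "inj_on zs {1..\<mu>}" "\<And>s. s \<in> {1..\<mu>} \<Longrightarrow> zs s \<in> E\<^sub>\<rho> - E"
    and residues: "\<And>s. s \<in> {1..\<mu>} \<Longrightarrow> v s \<noteq> 0"
    and Theta: "\<And>i. (\<lambda>z. \<Theta> z $ i) analytic_on E\<^sub>\<rho>"
    and F: "\<And>z. z \<in> K' \<Longrightarrow> F z = (\<Sum>s=1..\<mu>. (1 / (z - zs s)) *s v s) + \<Theta> z"
    and ordered: "\<And>s t. 1 \<le> s \<Longrightarrow> s \<le> t \<Longrightarrow> t \<le> \<mu> \<Longrightarrow> \<Phi> (zs s) \<le> \<Phi> (zs t)"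
      "\<And>s. s \<in> {1..\<mu>} \<Longrightarrow> \<Phi> (zs s) \<le> \<rho>"
    and k: "1 \<le> k" "k \<le> \<mu>"
    and qv: "(\<Prod>i=1..k. ip q (v i)) \<noteq> 0"
    and gap: "k < \<mu> \<Longrightarrow> 1 \<le> r \<and> k + r \<le> \<mu> \<and> \<Phi> (zs k) < \<Phi> (zs (k + 1))
      \<and> (\<forall>j\<in>{1..r}. \<Phi> (zs (k + j)) = \<Phi> (zs (k + 1)))
      \<and> \<Phi> (zs (k + r)) < (if k + r < \<mu> then \<Phi> (zs (k + r + 1)) else \<rho>)"
  shows
    "((\<forall>\<^sub>F p in sequentially. \<exists>!c. itea_coeffs ip q F (\<xi> p) p k c)
      \<and> (\<forall>C. compact C \<longrightarrow> C \<subseteq> K' \<longrightarrow>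
           (\<forall>\<^sub>F p in sequentially. \<forall>c. itea_coeffs ip q F (\<xi> p) p k c \<longrightarrow>
              (\<forall>z\<in>C. itea_denominator (\<xi> p) k c z \<noteq> 0))))
   \<and> (k < \<mu> \<longrightarrow>
       (\<forall>C. compact C \<longrightarrow> C \<subseteq> K' - E \<longrightarrow>
          (\<exists>M. \<forall>\<^sub>F p in sequentially. \<forall>z\<in>C.
             err p z \<le> M * (cmod (\<Psi> p z) / Min ((\<lambda>j. cmod (\<Psi> p (zs (k + j)))) ` {1..r}))))
       \<and> (\<forall>C. compact C \<longrightarrow> C \<subseteq> K' \<longrightarrow>
          (\<exists>M. \<forall>\<^sub>F p in sequentially. \<forall>z\<in>C.
             err p z \<le> M * (cmod (node_poly (\<xi> p) 1 p z)
                              / Min ((\<lambda>j. cmod (\<Psi> p (zs (k + j)))) ` {1..r}))))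
       \<and> (\<forall>z\<in>K'. limsup (\<lambda>p. ereal (root p (err p z))) \<le> ereal (\<Phi> z / \<Phi> (zs (k + 1))))
       \<and> (\<forall>C. compact C \<longrightarrow> C \<subseteq> K' \<longrightarrow>
            limsup_le_uniformly_on C (\<lambda>p z. root p (err p z)) (\<lambda>z. \<Phi> z / \<Phi> (zs (k + 1))))
       \<and> (\<forall>z\<in>E. limsup (\<lambda>p. ereal (root p (err p z))) \<le> ereal (1 / \<Phi> (zs (k + 1))))
       \<and> limsup_le_uniformly_on E (\<lambda>p z. root p (err p z)) (\<lambda>z. 1 / \<Phi> (zs (k + 1)))
       \<and> (\<forall>C. compact C \<longrightarrow> C \<subseteq> inside (level_curve \<Phi> (\<Phi> (zs (k + 1)))) - zs ` {1..k} \<longrightarrow>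
            uniform_limit C err (\<lambda>z. 0) sequentially)
       \<and> (r = 1 \<longrightarrow>
            (\<forall>p\<ge>1. itea_T ip q v zs (\<xi> p) p k (\<lambda>j. j) \<noteq> 0)
            \<and> (\<forall>z\<in>K'. (\<lambda>p. nrm (F z - R p z - X p z))
                 \<in> o(\<lambda>p. cmod (node_poly (\<xi> p) 1 p z / \<Psi> p (zs (k + 1)))))
            \<and> (\<forall>z\<in>K'. (\<exists>\<delta>>0. \<forall>\<^sub>F p in sequentially.
                            nrm (itea_T_hat ip q v zs (\<xi> p) p k (\<lambda>j. j + 1) z) \<ge> \<delta>) \<longrightarrow>
                 (\<lambda>p. nrm (F z - R p z - X p z)) \<in> o(\<lambda>p. nrm (X p z)))
            \<and> (\<forall>z\<in>K'. \<exists>M. \<forall>\<^sub>F p in sequentially. nrm (itea_B ip q v zs (\<xi> p) p k z) \<le> M)))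
   \<and> (k = \<mu> \<longrightarrow>
       (\<forall>z\<in>K'. limsup (\<lambda>p. ereal (root p (err p z))) \<le> ereal (\<Phi> z / \<rho>))
       \<and> (\<forall>C. compact C \<longrightarrow> C \<subseteq> K' \<longrightarrow>
            limsup_le_uniformly_on C (\<lambda>p z. root p (err p z)) (\<lambda>z. \<Phi> z / \<rho>))
       \<and> (\<forall>z\<in>E. limsup (\<lambda>p. ereal (root p (err p z))) \<le> ereal (1 / \<rho>))
       \<and> limsup_le_uniformly_on E (\<lambda>p z. root p (err p z)) (\<lambda>z. 1 / \<rho>))"
proof -
  interpret G: green_nodes E g \<xi> k "log_capacity E"
    by unfold_locales (use E no_limit_points nodes in \<open>auto simp: \<Phi>_def\<close>)
  have E\<rho>: "E\<^sub>\<rho> = {z. green_exp E g z < \<rho>}" unfolding E\<^sub>\<rho>_def \<Phi>_def by (rule G.inside_level_curve[OF rho])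
  have K': "K' = {z. green_exp E g z < \<rho>} - zs ` {1..\<mu>}" unfolding K'_def E\<rho> ..
  have qv': "ip q (v i) \<noteq> 0" if "i \<in> {1..k}" for i using qv that by auto
  interpret S: itea_setting E g \<xi> k "log_capacity E" ip nrm q F \<Theta> \<mu> zs v \<rho>
  proof unfold_locales
    show "zs s \<notin> E" "green_exp E g (zs s) < \<rho>" if "s \<in> {1..\<mu>}" for s using poles(2)[OF that] by (auto simp: E\<rho>)
    show "(\<lambda>z. \<Theta> z $ i) holomorphic_on {z. green_exp E g z < \<rho>}" for i
      using Theta[of i] unfolding E\<rho> by (rule analytic_imp_holomorphic)
    show "F z = (\<Sum>s=1..\<mu>. (1 / (z - zs s)) *s v s) + \<Theta> z" if "green_exp E g z < \<rho>" "z \<notin> zs ` {1..\<mu>}" for z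
      using that by (intro F) (simp add: K')
  qed (fact consecutive ip nrm rho poles(1) k qv')+
  have gapI: "itea_setting_gap E g \<xi> k (log_capacity E) ip nrm q F \<Theta> \<mu> zs v \<rho> r" if "k < \<mu>"
  proof unfold_locales
    note gap' = gap[OF that, unfolded \<Phi>_def]
    note ordered' = ordered(1)[unfolded \<Phi>_def]
    show "1 \<le> r" "k + r \<le> \<mu>" using gap' by blast+
    show "green_exp E g (zs s) < green_exp E g (zs (k + 1))" if "s \<in> {1..k}" for s
      using gap' ordered'[of s k] that k(2) by force
    show equal: "green_exp E g (zs (k + j)) = green_exp E g (zs (k + 1))" if "j \<in> {1..r}" for j
      using gap' that by blast
    \<comment> \<open>The gap is strict only at the index k + r + 1; the ordering of the poles
      carries it to the later ones.\<close>
    show "green_exp E g (zs (k + 1)) < green_exp E g (zs s)" if "s \<in> {k + r + 1..\<mu>}" for s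
      using gap' equal[of r] ordered'[of "k + r + 1" s] that by force
  qed
  have level: "inside (level_curve (green_exp E g) (green_exp E g (zs (k + 1)))) =
      {z. green_exp E g z < green_exp E g (zs (k + 1))}" if "k < \<mu>"
    using that by (intro G.inside_level_curve G.\<Phi>_gt_1 S.poles(1)) simp
  have ex: "\<forall>\<^sub>F p in sequentially. \<exists>!c. itea_coeffs ip q F (\<xi> p) p k c"
    and den: "\<And>C. compact C \<Longrightarrow> C \<subseteq> {z. green_exp E g z < \<rho>} - zs ` {1..\<mu>} \<Longrightarrow>
      \<forall>\<^sub>F p in sequentially. \<forall>c. itea_coeffs ip q F (\<xi> p) p k c \<longrightarrow> (\<forall>z\<in>C. itea_denominator (\<xi> p) k c z \<noteq> 0)"
  proof -
    have *: "(\<forall>\<^sub>F p in sequentially. \<exists>!c. itea_coeffs ip q F (\<xi> p) p k c) \<and>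
       (\<forall>\<^sub>F p in sequentially. \<forall>c. itea_coeffs ip q F (\<xi> p) p k c \<longrightarrow> (\<forall>z\<in>C. itea_denominator (\<xi> p) k c z \<noteq> 0))"
      if C: "compact C" "C \<subseteq> {z. green_exp E g z < \<rho>} - zs ` {1..\<mu>}" for C
    proof (cases "k < \<mu>")
      case True
      then interpret H: itea_setting_gap E g \<xi> k "log_capacity E" ip nrm q F \<Theta> \<mu> zs v \<rho> r by (rule gapI)
      show ?thesis by (rule conjI[OF H.bounds_with_further_poles(1,2)[OF C]])
    next
      case False
      then have "k = \<mu>" using k by simp
      show ?thesis
        by (rule conjI[OF S.bounds_without_further_poles(1,2)[OF \<open>k = \<mu>\<close> C order.refl rho]])
    qed
    show "\<forall>\<^sub>F p in sequentially. \<exists>!c. itea_coeffs ip q F (\<xi> p) p k c"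
      \<comment> \<open>Solvability does not involve \<open>C\<close>, so the empty set will
        do.\<close>
      by (rule *[of "{}", THEN conjunct1]) simp_all
    show "\<forall>\<^sub>F p in sequentially. \<forall>c. itea_coeffs ip q F (\<xi> p) p k c \<longrightarrow> (\<forall>z\<in>C. itea_denominator (\<xi> p) k c z \<noteq> 0)"
      if "compact C" "C \<subseteq> {z. green_exp E g z < \<rho>} - zs ` {1..\<mu>}" for C
      by (rule *[OF that, THEN conjunct2])
  qed
  show ?thesis
    unfolding X_def err_def R_def \<Psi>_def K' unfolding \<Phi>_def
  proof (intro conjI impI)
    assume "k < \<mu>"
    then interpret H: itea_setting_gap E g \<xi> k "log_capacity E" ip nrm q F \<Theta> \<mu> zs v \<rho> r by (rule gapI)
    show "\<forall>C. compact C \<longrightarrow> C \<subseteq> {z. green_exp E g z < \<rho>} - zs ` {1..\<mu>} - E \<longrightarrow>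
        (\<exists>M. \<forall>\<^sub>F p in sequentially. \<forall>z\<in>C. nrm (F z - itea ip q F (\<xi> p) p k z) \<le> M * (cmod (node_poly (\<xi> p) 1 (p + k) z)
           / Min ((\<lambda>j. cmod (node_poly (\<xi> p) 1 (p + k) (zs (k + j)))) ` {1..r})))"
      using H.bound_off_E unfolding H.m_def by (intro allI impI)
    show "\<forall>C. compact C \<longrightarrow> C \<subseteq> {z. green_exp E g z < \<rho>} - zs ` {1..\<mu>} \<longrightarrow>
        (\<exists>M. \<forall>\<^sub>F p in sequentially. \<forall>z\<in>C. nrm (F z - itea ip q F (\<xi> p) p k z) \<le> M * (cmod (node_poly (\<xi> p) 1 p z)
           / Min ((\<lambda>j. cmod (node_poly (\<xi> p) 1 (p + k) (zs (k + j)))) ` {1..r})))"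
      using H.bounds_with_further_poles(3) unfolding H.m_def Bex_def by blast
    show "\<forall>C. compact C \<longrightarrow> C \<subseteq> inside (level_curve (green_exp E g) (green_exp E g (zs (k + 1)))) - zs ` {1..k} \<longrightarrow>
        uniform_limit C (\<lambda>p z. nrm (F z - itea ip q F (\<xi> p) p k z)) (\<lambda>z. 0) sequentially"
      unfolding level[OF \<open>k < \<mu>\<close>] by (intro allI impI H.uniform_convergence)
    show "\<forall>z\<in>{z. green_exp E g z < \<rho>} - zs ` {1..\<mu>}.
        limsup (\<lambda>p. ereal (root p (nrm (F z - itea ip q F (\<xi> p) p k z)))) \<le> ereal (green_exp E g z / green_exp E g (zs (k + 1)))"
      "\<forall>C. compact C \<longrightarrow> C \<subseteq> {z. green_exp E g z < \<rho>} - zs ` {1..\<mu>} \<longrightarrow>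
        limsup_le_uniformly_on C (\<lambda>p z. root p (nrm (F z - itea ip q F (\<xi> p) p k z))) (\<lambda>z. green_exp E g z / green_exp E g (zs (k + 1)))"
      "\<forall>z\<in>E. limsup (\<lambda>p. ereal (root p (nrm (F z - itea ip q F (\<xi> p) p k z)))) \<le> ereal (1 / green_exp E g (zs (k + 1)))"
      "limsup_le_uniformly_on E (\<lambda>p z. root p (nrm (F z - itea ip q F (\<xi> p) p k z))) (\<lambda>z. 1 / green_exp E g (zs (k + 1)))"
      by (rule S.limsup_bounds[OF H.next_pole(2)], rule H.gap_limsup_hypothesis, assumption+)+
    have "inj_on zs {1..k}" by (rule inj_on_subset[OF poles(1)]) (use k in auto)
    then show "\<forall>p\<ge>1. itea_T ip q v zs (\<xi> p) p k (\<lambda>j. j) \<noteq> 0"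
      by (intro allI impI itea_T_nonzero qv')
    let ?K = "{z. green_exp E g z < \<rho>} - zs ` {1..\<mu>}"
    assume "r = 1"
    show "\<forall>z\<in>?K. \<exists>M. \<forall>\<^sub>F p in sequentially. nrm (itea_B ip q v zs (\<xi> p) p k z) \<le> M"
      by (intro ballI H.refined_smallo(3)[OF \<open>r = 1\<close>]) auto
    show "\<forall>z\<in>?K. (\<lambda>p. nrm (F z - itea ip q F (\<xi> p) p k z
          - (node_poly (\<xi> p) 1 p z / node_poly (\<xi> p) 1 (p + k) (zs (k + 1))) *s itea_B ip q v zs (\<xi> p) p k z))
        \<in> o(\<lambda>p. cmod (node_poly (\<xi> p) 1 p z / node_poly (\<xi> p) 1 (p + k) (zs (k + 1))))"
      by (intro ballI H.refined_smallo(1)[OF \<open>r = 1\<close>]) auto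
    show "\<forall>z\<in>?K. (\<exists>\<delta>>0. \<forall>\<^sub>F p in sequentially. nrm (itea_T_hat ip q v zs (\<xi> p) p k (\<lambda>j. j + 1) z) \<ge> \<delta>) \<longrightarrow>
        (\<lambda>p. nrm (F z - itea ip q F (\<xi> p) p k z
          - (node_poly (\<xi> p) 1 p z / node_poly (\<xi> p) 1 (p + k) (zs (k + 1))) *s itea_B ip q v zs (\<xi> p) p k z))
        \<in> o(\<lambda>p. nrm ((node_poly (\<xi> p) 1 p z / node_poly (\<xi> p) 1 (p + k) (zs (k + 1))) *s itea_B ip q v zs (\<xi> p) p k z))"
      by (intro ballI impI H.refined_smallo(2)[OF \<open>r = 1\<close>]) auto
  next
    assume "k = \<mu>"
    show "\<forall>z\<in>{z. green_exp E g z < \<rho>} - zs ` {1..\<mu>}.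
        limsup (\<lambda>p. ereal (root p (nrm (F z - itea ip q F (\<xi> p) p k z)))) \<le> ereal (green_exp E g z / \<rho>)"
      "\<forall>C. compact C \<longrightarrow> C \<subseteq> {z. green_exp E g z < \<rho>} - zs ` {1..\<mu>} \<longrightarrow>
        limsup_le_uniformly_on C (\<lambda>p z. root p (nrm (F z - itea ip q F (\<xi> p) p k z))) (\<lambda>z. green_exp E g z / \<rho>)"
      "\<forall>z\<in>E. limsup (\<lambda>p. ereal (root p (nrm (F z - itea ip q F (\<xi> p) p k z)))) \<le> ereal (1 / \<rho>)"
      "limsup_le_uniformly_on E (\<lambda>p z. root p (nrm (F z - itea ip q F (\<xi> p) p k z))) (\<lambda>z. 1 / \<rho>)"
      by (rule S.limsup_bounds[OF rho], rule S.bounds_without_further_poles(3)[OF \<open>k = \<mu>\<close>], assumption+)+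
  qed (use ex den in blast)+
qed

end
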